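(* Let $S$ be a unital semigroup with involution $\mathfrak{I}$, let $\phi$ be an action of $S$ on a set $X$, and let $\alpha:S\times X\to\mathbb{C}\setminus\{0\}$ satisfy $$\alpha(ab,x)\overline{\alpha(ab,y)}=\alpha(a,\phi(b,x))\overline{\alpha(a,\phi(b,y))}\,\alpha(b,x)\overline{\alpha(b,y)}\quad (a,b\in S,\ x,y\in X)$$ and $\alpha(a\mathfrak{I}(a),x)=1$ for all $a\in S$, $x\in X$. Let $\mathcal{H}$ be a Kreĭn space and let $K:X\times X\to\mathcal{L}(\mathcal{H})$ be a $\phi$-invariant hermitian kernel on $X$. The following assertions are equivalent: (1) There exists $L\in\mathcal{B}_\phi^+(X,\mathcal{H})$ such that $-L\le K\le L$. (2) $K$ has a Kolmogorov decomposition $(V;\mathcal{K})$ with the property that there exists a projective representation $U:S\to\mathcal{L}(\mathcal{K})$ of $S$ on $\mathcal{K}$ (that is, $U(a)U(b)=\sigma(a,b)U(ab)$ for all $a,b\in S$) such that $$V(\phi(a,x))=\alpha(a,x)U(a)V(x)\quad (x\in X,\ a\in S).$$ In addition, $\overline{\sigma(\mathfrak{I}(a),a)}\,U(\mathfrak{I}(a))=U(a)^\sharp$ for all $a\in S$. (3) $K=K_1-K_2$ for two positive definite kernels $K_1,K_2$ such that $K_1+K_2\in\mathcal{B}_\phi^+(X,\mathcal{H})$. (4) $K=K_+-K_-$ for two disjoint positive definite kernels $K_+,K_-$ such that $K_++K_-\in\mathcal{B}_\phi^+(X,\mathcal{H})$.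
   Context: A Kreĭn space is an indefinite inner product space $(\mathcal{H},[\cdot,\cdot])$ for which there is a positive inner product $\langle\cdot,\cdot\rangle$ turning $\mathcal{H}$ into a Hilbert space, and $J=J^*=J^{-1}$ on $\mathcal{H}$, with $[\xi,\eta]=\langle J\xi,\eta\rangle$. $\mathcal{L}(\mathcal{H},\mathcal{K})$ is the set of bounded linear operators; $T^\sharp$ is the adjoint with respect to the indefinite inner products. Kernels. A hermitian kernel on a set $X$ is a map $K:X\times X\to\mathcal{L}(\mathcal{H})$ with $K(x,y)=K(y,x)^\sharp$. $\mathcal{F}_0(X,\mathcal{H})$ is the vector space of finitely supported functions $X\to\mathcal{H}$, with inner product $[f,g]_K=\sum_{x,y\in X}[K(x,y)f(y),g(x)]_{\mathcal{H}}$. $K$ is positive definite if $[f,f]_K\ge0$ for all $f$. For hermitian kernels, $A\le B$ means $[f,f]_A\le[f,f]_B$ for all $f\in\mathcal{F}_0(X,\mathcal{H})$. Two positive definite kernels $A,B$ are disjoint if every positive definite kernel $P$ with $P\le A$ and $P\le B$ is $0$. A Kolmogorov decomposition of $K$ is a pair $(V;\mathcal{K})$ with $\mathcal{K}$ a Kreĭn space and $V(x)\in\mathcal{L}(\mathcal{H},\mathcal{K})$, $x\in X$, such that $K(x,y)=V(x)^\sharp V(y)$ for all $x,y$ and the linear span of $\bigcup_{x}V(x)\mathcal{H}$ is dense in $\mathcal{K}$. Action and cocycle. An action of the unital semigroup $S$ (unit $e$) on $X$ is a map $\phi:S\times X\to X$ with $\phi(a,\phi(b,x))=\phi(ab,x)$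 and $\phi(e,x)=x$. An involution on $S$ is a map $\mathfrak{I}:S\to S$ with $\mathfrak{I}(\mathfrak{I}(a))=a$, $\mathfrak{I}(ab)=\mathfrak{I}(b)\mathfrak{I}(a)$. Given $\alpha$ as in the claim, $\sigma(a,b)=\alpha(a,\phi(b,x))^{-1}\alpha(b,x)^{-1}\alpha(ab,x)$, which does not depend on $x$ and satisfies $|\sigma(a,b)|=1$ and $\sigma(a,b)\sigma(ab,c)=\sigma(a,bc)\sigma(b,c)$. $\phi$-bounded kernels. For $\xi\in\mathcal{H}$, $x\in X$, let $\xi_x\in\mathcal{F}_0(X,\mathcal{H})$ be the function equal to $\xi$ at $x$ and $0$ elsewhere. For $a\in S$, $\psi_a:\mathcal{F}_0(X,\mathcal{H})\to\mathcal{F}_0(X,\mathcal{H})$ is the linear map with $\psi_a(\xi_x)=\alpha(a,x)^{-1}\xi_{\phi(a,x)}$. A positive definite kernel $L$ is $\phi$-bounded if for every $a\in S$ the map $\psi_a$ is bounded with respect to the seminorm $[\cdot,\cdot]_L^{1/2}$. $\mathcal{B}_\phi^+(X,\mathcal{H})$ is the set of positive definite $\phi$-bounded $\mathcal{L}(\mathcal{H})$-valued kernels on $X$. $\phi$-invariance. A hermitian kernel $K$ is $\phi$-invariant if $K(x,\phi(a,y))=\overline{\alpha(a,\phi(\mathfrak{I}(a),x))}\,\alpha(a,y)\,K(\phi(\mathfrak{I}(a),x),y)$ for all $x,y\in X$, $a\in S$. *)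

theory Defs
  imports "HOL-Analysis.Analysis" "HOL-Library.Function_Algebras"
begin

section \<open>Krein spaces\<close>

text \<open>
  The distribution has no complex inner product spaces, and the theorem quantifies
  existentially over Krein spaces, so a space is a record: a linear subspace \<open>kcarrier\<close> of an
  ambient complex vector space (addition from the type, complex scaling \<open>kscale\<close>), with an
  indefinite inner product \<open>kform\<close>, linear in its first argument.
\<close>

record 'a kspace =
  kscale :: "complex \<Rightarrow> 'a \<Rightarrow> 'a"
  kcarrier :: "'a set"
  kform :: "'a \<Rightarrow> 'a \<Rightarrow> complex"

definition linear_map_on ::
    "('a::ab_group_add) kspace \<Rightarrow> ('b::ab_group_add) kspace \<Rightarrow> ('a \<Rightarrow> 'b) \<Rightarrow> bool" where
  "linear_map_on H K T \<longleftrightarrow>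
     (\<forall>x\<in>kcarrier H. T x \<in> kcarrier K) \<and>
     (\<forall>x\<in>kcarrier H. \<forall>y\<in>kcarrier H. T (x + y) = T x + T y) \<and>
     (\<forall>c. \<forall>x\<in>kcarrier H. T (kscale H c x) = kscale K c (T x))"

definition inner_product_on ::
    "('a::ab_group_add) kspace \<Rightarrow> ('a \<Rightarrow> 'a \<Rightarrow> complex) \<Rightarrow> bool" where
  "inner_product_on H g \<longleftrightarrow>
     (\<forall>x\<in>kcarrier H. \<forall>y\<in>kcarrier H. \<forall>z\<in>kcarrier H. g (x + y) z = g x z + g y z) \<and>
     (\<forall>c. \<forall>x\<in>kcarrier H. \<forall>y\<in>kcarrier H. g (kscale H c x) y = c * g x y) \<and>
     (\<forall>x\<in>kcarrier H. \<forall>y\<in>kcarrier H. g y x = cnj (g x y))"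

text \<open>
  The last condition only fixes the values off the carrier; it makes the distance below satisfy
  \<open>Metric_space\<close>, two of whose axioms are not relativised to the carrier.
\<close>

definition hilbert_product_on ::
    "('a::ab_group_add) kspace \<Rightarrow> ('a \<Rightarrow> 'a \<Rightarrow> complex) \<Rightarrow> bool" where
  "hilbert_product_on H g \<longleftrightarrow>
     inner_product_on H g \<and>
     (\<forall>x\<in>kcarrier H. x \<noteq> 0 \<longrightarrow> 0 < Re (g x x)) \<and>
     Metric_space.mcomplete (kcarrier H) (\<lambda>x y. sqrt (Re (g (x - y) (x - y)))) \<and>
     (\<forall>x y. x \<notin> kcarrier H \<or> y \<notin> kcarrier H \<longrightarrow> g x y = 0)"

definition fundamental_symmetry ::
    "('a::ab_group_add) kspace \<Rightarrow> ('a \<Rightarrow> 'a \<Rightarrow> complex) \<Rightarrow> ('a \<Rightarrow> 'a) \<Rightarrow> bool" where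
  "fundamental_symmetry H g J \<longleftrightarrow>
     hilbert_product_on H g \<and>
     linear_map_on H H J \<and>
     (\<forall>x\<in>kcarrier H. J (J x) = x) \<and>
     (\<forall>x\<in>kcarrier H. \<forall>y\<in>kcarrier H. g (J x) y = g x (J y)) \<and>
     (\<forall>x\<in>kcarrier H. \<forall>y\<in>kcarrier H. kform H x y = g (J x) y)"

definition krein_space :: "('a::ab_group_add) kspace \<Rightarrow> bool" where
  "krein_space H \<longleftrightarrow>
     vector_space (kscale H) \<and>
     module.subspace (kscale H) (kcarrier H) \<and>
     inner_product_on H (kform H) \<and>
     (\<exists>g J. fundamental_symmetry H g J)"

text \<open>
  All Hilbert space norms arising from fundamental symmetries of a Krein space are equivalent,
  so boundedness and density below do not depend on the choice made here.
\<close>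

definition krein_norm :: "('a::ab_group_add) kspace \<Rightarrow> 'a \<Rightarrow> real" where
  "krein_norm H x = sqrt (Re ((SOME g. \<exists>J. fundamental_symmetry H g J) x x))"

definition krein_topology :: "('a::ab_group_add) kspace \<Rightarrow> 'a topology" where
  "krein_topology H = Metric_space.mtopology (kcarrier H) (\<lambda>x y. krein_norm H (x - y))"

text \<open>
  Operators are set to \<open>0\<close> off the carrier of their domain, so that equality of operators is
  equality of functions, and sums, differences and composites of operators are those of functions.
\<close>

definition bounded_ops ::
    "('a::ab_group_add) kspace \<Rightarrow> ('b::ab_group_add) kspace \<Rightarrow> ('a \<Rightarrow> 'b) set" where
  "bounded_ops H K =
     {T. linear_map_on H K T \<and>
         (\<exists>C. \<forall>x\<in>kcarrier H. krein_norm K (T x) \<le> C * krein_norm H x) \<and>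
         (\<forall>x. x \<notin> kcarrier H \<longrightarrow> T x = 0)}"

definition krein_adjoint ::
    "('a::ab_group_add) kspace \<Rightarrow> ('b::ab_group_add) kspace \<Rightarrow> ('a \<Rightarrow> 'b) \<Rightarrow> 'b \<Rightarrow> 'a" where
  "krein_adjoint H K T \<eta> =
     (if \<eta> \<in> kcarrier K
      then THE \<zeta>. \<zeta> \<in> kcarrier H \<and> (\<forall>\<xi>\<in>kcarrier H. kform K (T \<xi>) \<eta> = kform H \<xi> \<zeta>)
      else 0)"


section \<open>Operator-valued kernels\<close>

type_synonym ('x, 'h) kernel = "'x \<Rightarrow> 'x \<Rightarrow> 'h \<Rightarrow> 'h"

definition hermitian_kernel :: "('h::ab_group_add) kspace \<Rightarrow> ('x, 'h) kernel \<Rightarrow> bool" where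
  "hermitian_kernel H K \<longleftrightarrow>
     (\<forall>x y. K x y \<in> bounded_ops H H) \<and> (\<forall>x y. K x y = krein_adjoint H H (K y x))"

definition fsupp_functions :: "('h::ab_group_add) kspace \<Rightarrow> ('x \<Rightarrow> 'h) set" where
  "fsupp_functions H = {f. finite {x. f x \<noteq> 0} \<and> range f \<subseteq> kcarrier H}"

definition kernel_form ::
    "('h::ab_group_add) kspace \<Rightarrow> ('x, 'h) kernel \<Rightarrow> ('x \<Rightarrow> 'h) \<Rightarrow> ('x \<Rightarrow> 'h) \<Rightarrow> complex" where
  "kernel_form H K f g =
     (\<Sum>x\<in>{x. g x \<noteq> 0}. \<Sum>y\<in>{y. f y \<noteq> 0}. kform H (K x y (f y)) (g x))"

text \<open>
  For a hermitian kernel, \<open>kernel_form H K f f\<close> is a real number; the real part only serves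
  to compare it in the type of reals.
\<close>

definition positive_definite_kernel :: "('h::ab_group_add) kspace \<Rightarrow> ('x, 'h) kernel \<Rightarrow> bool" where
  "positive_definite_kernel H K \<longleftrightarrow>
     hermitian_kernel H K \<and> (\<forall>f\<in>fsupp_functions H. 0 \<le> Re (kernel_form H K f f))"

definition kernel_le :: "('h::ab_group_add) kspace \<Rightarrow> ('x, 'h) kernel \<Rightarrow> ('x, 'h) kernel \<Rightarrow> bool" where
  "kernel_le H A B \<longleftrightarrow>
     (\<forall>f\<in>fsupp_functions H. Re (kernel_form H A f f) \<le> Re (kernel_form H B f f))"

definition disjoint_kernels ::
    "('h::ab_group_add) kspace \<Rightarrow> ('x, 'h) kernel \<Rightarrow> ('x, 'h) kernel \<Rightarrow> bool" where
  "disjoint_kernels H A B \<longleftrightarrow>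
     (\<forall>P. positive_definite_kernel H P \<and> kernel_le H P A \<and> kernel_le H P B \<longrightarrow> P = 0)"

definition kolmogorov_decomposition ::
    "('h::ab_group_add) kspace \<Rightarrow> ('x, 'h) kernel \<Rightarrow> ('x \<Rightarrow> 'h \<Rightarrow> 'k) \<Rightarrow>
     ('k::ab_group_add) kspace \<Rightarrow> bool" where
  "kolmogorov_decomposition H K V \<K> \<longleftrightarrow>
     krein_space \<K> \<and>
     (\<forall>x. V x \<in> bounded_ops H \<K>) \<and>
     (\<forall>x y. K x y = krein_adjoint H \<K> (V x) \<circ> V y) \<and>
     krein_topology \<K> closure_of (module.span (kscale \<K>) (\<Union>x. V x ` kcarrier H)) = kcarrier \<K>"


section \<open>Actions, multipliers and invariance\<close>

definition semigroup_action :: "('s::monoid_mult \<Rightarrow> 'x \<Rightarrow> 'x) \<Rightarrow> bool" where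
  "semigroup_action \<phi> \<longleftrightarrow> (\<forall>a b x. \<phi> a (\<phi> b x) = \<phi> (a * b) x) \<and> (\<forall>x. \<phi> 1 x = x)"

definition semigroup_involution :: "('s::monoid_mult \<Rightarrow> 's) \<Rightarrow> bool" where
  "semigroup_involution \<I> \<longleftrightarrow> (\<forall>a. \<I> (\<I> a) = a) \<and> (\<forall>a b. \<I> (a * b) = \<I> b * \<I> a)"

text \<open>The common value over all \<open>x\<close>; see \<open>cocycle_eq\<close> below.\<close>

definition cocycle ::
    "('s::monoid_mult \<Rightarrow> 'x \<Rightarrow> 'x) \<Rightarrow> ('s \<Rightarrow> 'x \<Rightarrow> complex) \<Rightarrow> 's \<Rightarrow> 's \<Rightarrow> complex" where
  "cocycle \<phi> \<alpha> a b =
     (THE s. \<forall>x. s = inverse (\<alpha> a (\<phi> b x)) * inverse (\<alpha> b x) * \<alpha> (a * b) x)"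

definition delta_fun :: "'x \<Rightarrow> 'h \<Rightarrow> 'x \<Rightarrow> 'h::ab_group_add" where
  "delta_fun x \<xi> = (\<lambda>y. if y = x then \<xi> else 0)"

text \<open>Linear extension of \<open>delta_fun x \<xi> \<mapsto> \<alpha>(a,x)\<inverse> delta_fun (\<phi>(a,x)) \<xi>\<close>; see \<open>shift_map_delta\<close> below.\<close>

definition shift_map ::
    "('h::ab_group_add) kspace \<Rightarrow> ('s \<Rightarrow> 'x \<Rightarrow> 'x) \<Rightarrow> ('s \<Rightarrow> 'x \<Rightarrow> complex) \<Rightarrow>
     's \<Rightarrow> ('x \<Rightarrow> 'h) \<Rightarrow> 'x \<Rightarrow> 'h" where
  "shift_map H \<phi> \<alpha> a f =
     (\<lambda>z. \<Sum>x\<in>{x. f x \<noteq> 0}. kscale H (inverse (\<alpha> a x)) (delta_fun (\<phi> a x) (f x) z))"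

definition bounded_kernels ::
    "('h::ab_group_add) kspace \<Rightarrow> ('s \<Rightarrow> 'x \<Rightarrow> 'x) \<Rightarrow> ('s \<Rightarrow> 'x \<Rightarrow> complex) \<Rightarrow>
     ('x, 'h) kernel set" where
  "bounded_kernels H \<phi> \<alpha> =
     {L. positive_definite_kernel H L \<and>
         (\<forall>a. \<exists>C. \<forall>f\<in>fsupp_functions H.
            sqrt (Re (kernel_form H L (shift_map H \<phi> \<alpha> a f) (shift_map H \<phi> \<alpha> a f)))
              \<le> C * sqrt (Re (kernel_form H L f f)))}"

definition invariant_kernel ::
    "('h::ab_group_add) kspace \<Rightarrow> ('s \<Rightarrow> 'x \<Rightarrow> 'x) \<Rightarrow> ('s \<Rightarrow> 'x \<Rightarrow> complex) \<Rightarrow> ('s \<Rightarrow> 's) \<Rightarrow>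
     ('x, 'h) kernel \<Rightarrow> bool" where
  "invariant_kernel H \<phi> \<alpha> \<I> K \<longleftrightarrow>
     (\<forall>x y a. K x (\<phi> a y) =
        kscale H (cnj (\<alpha> a (\<phi> (\<I> a) x)) * \<alpha> a y) \<circ> K (\<phi> (\<I> a) x) y)"

definition projective_representation ::
    "('s::monoid_mult \<Rightarrow> 's \<Rightarrow> complex) \<Rightarrow> ('k::ab_group_add) kspace \<Rightarrow> ('s \<Rightarrow> 'k \<Rightarrow> 'k) \<Rightarrow> bool" where
  "projective_representation \<sigma> \<K> U \<longleftrightarrow>
     (\<forall>a. U a \<in> bounded_ops \<K> \<K>) \<and>
     (\<forall>a b. U a \<circ> U b = kscale \<K> (\<sigma> a b) \<circ> U (a * b))"

text \<open>
  Instead of quantifying over the ambient type of \<open>\<K>\<close>, one may take the type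
  \<open>'x \<Rightarrow> 'h \<Rightarrow> complex\<close> with pointwise operations: for any decomposition, density makes
  \<open>k \<mapsto> (\<lambda>x \<xi>. [k, V x \<xi>])\<close> an injective linear map on \<open>\<K>\<close>, along which \<open>V\<close>, \<open>\<K>\<close> and \<open>U\<close>
  can be transported.
\<close>

definition invariant_kolmogorov_decomposition ::
    "('h::ab_group_add) kspace \<Rightarrow> ('s::monoid_mult \<Rightarrow> 'x \<Rightarrow> 'x) \<Rightarrow> ('s \<Rightarrow> 'x \<Rightarrow> complex) \<Rightarrow> ('s \<Rightarrow> 's) \<Rightarrow>
     ('x, 'h) kernel \<Rightarrow> ('x \<Rightarrow> 'h \<Rightarrow> 'k) \<Rightarrow> ('k::ab_group_add) kspace \<Rightarrow> bool" where
  "invariant_kolmogorov_decomposition H \<phi> \<alpha> \<I> K V \<K> \<longleftrightarrow>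
     kolmogorov_decomposition H K V \<K> \<and>
     (\<exists>U. projective_representation (cocycle \<phi> \<alpha>) \<K> U \<and>
          (\<forall>a x. V (\<phi> a x) = kscale \<K> (\<alpha> a x) \<circ> U a \<circ> V x) \<and>
          (\<forall>a. kscale \<K> (cnj (cocycle \<phi> \<alpha> (\<I> a) a)) \<circ> U (\<I> a) = krein_adjoint \<K> \<K> (U a)))"


section \<open>Well-definedness\<close>

lemma cocycle_eq:
  assumes nz: "\<And>a x. \<alpha> a x \<noteq> 0"
    and \<alpha>: "\<And>a b x y. \<alpha> (a * b) x * cnj (\<alpha> (a * b) y) =
      \<alpha> a (\<phi> b x) * cnj (\<alpha> a (\<phi> b y)) * (\<alpha> b x * cnj (\<alpha> b y))"
  shows "cocycle \<phi> \<alpha> a b = inverse (\<alpha> a (\<phi> b x)) * inverse (\<alpha> b x) * \<alpha> (a * b) x"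
proof -
  define r where "r x = inverse (\<alpha> a (\<phi> b x)) * inverse (\<alpha> b x) * \<alpha> (a * b) x" for x
  have r: "r x * cnj (r y) = 1" for x y
    using \<alpha>[of a b x y] nz by (simp add: r_def field_simps)
  have eq: "r y = r x" for y
    using r[of y x] r[of x x] by (metis mult_cancel_right mult_zero_right zero_neq_one)
  show ?thesis
    unfolding cocycle_def r_def[symmetric] by (rule the_equality) (use eq in metis)+
qed

lemma shift_map_delta:
  assumes "vector_space (kscale H)"
  shows "shift_map H \<phi> \<alpha> a (delta_fun x \<xi>) =
    (\<lambda>z. kscale H (inverse (\<alpha> a x)) (delta_fun (\<phi> a x) \<xi> z))"
proof -
  interpret vector_space "kscale H" by fact
  show ?thesis
  proof (cases "\<xi> = 0")
    case False
    then have "{y. delta_fun x \<xi> y \<noteq> 0} = {x}" by (auto simp: delta_fun_def)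
    then show ?thesis by (simp add: shift_map_def) (simp add: delta_fun_def)
  qed (simp add: shift_map_def delta_fun_def)
qed

end

theory Submission
  imports Defs
begin

text \<open>
  The hard implication is (1) to (2). On the finitely supported functions consider the hermitian
  form of \<open>K\<close> and the quadratic form \<open>q\<close> of \<open>L\<close>, so that \<open>|K(f,f)| \<le> q(f)\<close>. If \<open>A\<close> represents
  \<open>K\<close> in the Hilbert space of \<open>q\<close>, the form of \<open>|A|\<close> is reached without spectral theory by the Newton
  iteration \<open>q \<mapsto> (q + q\<^sup>*) / 2\<close>, where \<open>q\<^sup>*(f)\<close> is the squared \<open>q\<close>-dual norm of \<open>K(f,\<cdot>)\<close>:
  it decreases, preserves \<open>|K| \<le> q\<close>, and preserves every bound \<open>q(Sf) \<le> C q(f)\<close> that holds both for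
  \<open>S\<close> and for a \<open>K\<close>-adjoint of \<open>S\<close>. Its limit satisfies \<open>q = q\<^sup>*\<close>. For such \<open>q\<close> the space of
  \<open>q\<close>-bounded antilinear functionals is a Krein space with fundamental symmetry
  \<open>\<langle>f,\<cdot>\<rangle> \<mapsto> K(f,\<cdot>)\<close>; the vectors \<open>K(f,\<cdot>)\<close> are dense in it and \<open>U(a)\<close> maps \<open>K(f,\<cdot>)\<close> to
  \<open>K(\<psi>\<^sub>a f,\<cdot>)\<close>.

  For (2) to (4) the fundamental symmetry \<open>J\<close> gives \<open>K\<^sub>\<plusminus> = V\<^sup>\<sharp> J (1 \<plusminus> J)/2 V\<close>. If
  \<open>P \<le> K\<^sub>+\<close> and \<open>P \<le> K\<^sub>-\<close>, approximate \<open>(1 + J)/2 Vf\<close> by vectors \<open>Vh\<close>: then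
  \<open>P(f,f) \<le> 2 P(f-h,f-h) + 2 P(h,h) \<le> 2 \<parallel>(1 + J)/2 Vf - Vh\<parallel>\<^sup>2\<close> is arbitrarily small.
\<close>

section \<open>Sesquilinear forms and quadratic forms\<close>

text \<open>The obstacle is that \<open>q\<close> is only a seminorm on
  \<open>fsupp_functions H\<close>, with null vectors and without completeness, so there is no space
  on which an operator could act. Everything is phrased through functions \<open>q\<close> obeying
  the parallelogram law, and the Hilbert space is produced only at the end, as a dual space, which
  is complete and free of null vectors by itself. The iteration is Newton's method for a square
  root: if \<open>q(f) = <Bf,f>\<close> with \<open>B\<close> invertible and
  \<open>K(f,g) = <Af,g>\<close>, then the dual term is \<open><A B^-1 A f,f>\<close>, so the step
  is \<open>B -> (B + A B^-1 A)/2\<close>, which started at the identity tends to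
  \<open>|A|\<close>. A fixed point is needed because for a general dominating \<open>q\<close> the
  map \<open>f -> K(f,.)\<close> only contracts norms; at a fixed point it preserves them, whence
  \<open>J^2 = 1\<close>. Duality turns an operator into its adjoint, so bounds on the shifts
  survive the iteration only because the involution and the invariance of \<open>K\<close> supply
  the adjoint of a shift. Since \<open>krein_norm\<close> rests on one chosen fundamental symmetry,
  comparison with the constructed one needs the equivalence of all such norms.\<close>

lemma le_sqrt_multI:
  fixes a b c :: real
  assumes le: "\<And>t. t > 0 \<Longrightarrow> 2 * a \<le> t * b + c / t" and b: "b \<ge> 0" and c: "c \<ge> 0"
  shows "a \<le> sqrt b * sqrt c"
proof (cases "a \<le> 0")
  case True
  then show ?thesis using b c by (meson mult_nonneg_nonneg order_trans real_sqrt_ge_zero)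
next
  case False
  then have a: "a > 0" by simp
  have "b > 0"
  proof (rule ccontr)
    assume "\<not> b > 0"
    \<comment> \<open>With \<open>b = 0\<close> the parameter \<open>t = (c + 1) / a\<close> brings
      \<open>c / t\<close> below \<open>a\<close>, hence below \<open>2 * a\<close>.\<close>
    then have "2 * a \<le> c / ((c + 1) / a)" using le[of "(c + 1) / a"] a b c by simp
    also have "\<dots> = (c / (c + 1)) * a" using a c by simp
    also have "\<dots> \<le> 1 * a" using a c by (intro mult_right_mono) auto
    finally show False using a by simp
  qed
  moreover have "c > 0"
  proof (rule ccontr)
    assume "\<not> c > 0"
    then have "2 * a \<le> (a / b) * b" using le[of "a / b"] a c calculation by simp
    then show False using a calculation by simp
  qed
  \<comment> \<open>This \<open>t\<close> balances the two terms: each becomes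
    \<open>sqrt b * sqrt c\<close>.\<close>
  ultimately have "2 * a \<le> sqrt (c / b) * b + c / sqrt (c / b)" using le[of "sqrt (c / b)"] by simp
  also have "sqrt (c / b) * b = sqrt b * sqrt c"
    using \<open>b > 0\<close> \<open>c > 0\<close> by (simp add: real_sqrt_divide field_simps)
  also have "c / sqrt (c / b) = sqrt b * sqrt c"
    using \<open>b > 0\<close> \<open>c > 0\<close> by (simp add: real_sqrt_divide field_simps)
  finally show ?thesis by simp
qed

text \<open>Cauchy's functional equation. The defect \<open>D\<close> from linearity is additive and
  vanishes on the integers, so it has period 1 and stays bounded; since
  \<open>D (n * t) = n * D t\<close>, a bounded \<open>D\<close> is zero.\<close>

lemma additive_bounded_imp_linear:
  fixes A :: "real \<Rightarrow> real"
  assumes add: "\<And>s t. A (s + t) = A s + A t" and bd: "\<And>t. \<bar>t\<bar> \<le> 1 \<Longrightarrow> \<bar>A t\<bar> \<le> M"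
  shows "A t = t * A 1"
proof -
  define D where "D t = A t - t * A 1" for t
  have D_add: "D (s + t) = D s + D t" for s t by (simp add: D_def add algebra_simps)
  have D1: "D 1 = 0" by (simp add: D_def)
  have D0: "D 0 = 0" using D_add[of 0 0] by simp
  have D_nat: "D (of_nat n * t) = of_nat n * D t" for n t
    by (induction n) (simp_all add: D0 D_add algebra_simps)
  have D_neg: "D (- t) = - D t" for t using D_add[of t "- t"] D0 by simp
  have D_int: "D (of_int k) = 0" for k
    using D_nat[of "nat k" 1] D_nat[of "nat (- k)" 1] D_neg[of "of_int k"] D1
    by (cases "k \<ge> 0") auto
  have D_bd: "\<bar>D t\<bar> \<le> M + \<bar>A 1\<bar>" for t
  proof -
    have "D t = D (frac t)" using D_add[of "of_int \<lfloor>t\<rfloor>" "frac t"] D_int by (simp add: frac_def)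
    also have "\<bar>\<dots>\<bar> \<le> \<bar>A (frac t)\<bar> + \<bar>frac t\<bar> * \<bar>A 1\<bar>"
      using abs_triangle_ineq4[of "A (frac t)" "frac t * A 1"] by (simp add: D_def abs_mult)
    also have "\<dots> \<le> M + 1 * \<bar>A 1\<bar>"
      using frac_ge_0[of t] frac_lt_1[of t]
      by (intro add_mono bd mult_right_mono) auto
    finally show ?thesis by simp
  qed
  have "D t = 0"
  proof (rule ccontr)
    assume "D t \<noteq> 0"
    then obtain n :: nat where "(M + \<bar>A 1\<bar>) / \<bar>D t\<bar> < of_nat n"
      using reals_Archimedean2 by blast
    then have "M + \<bar>A 1\<bar> < \<bar>D (of_nat n * t)\<bar>"
      using \<open>D t \<noteq> 0\<close> unfolding D_nat by (simp add: abs_mult pos_divide_less_eq)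
    then show False using D_bd[of "of_nat n * t"] by simp
  qed
  then show ?thesis by (simp add: D_def)
qed

lemma cnj_sgn_mult: "cnj (sgn z) * z = of_real (cmod z)"
proof (cases "z = 0")
  case False
  have "cnj (sgn z) * z = of_real ((cmod z)\<^sup>2 / cmod z)"
    using complex_norm_square[of z] by (simp add: sgn_div_norm scaleR_conv_of_real field_simps)
  then show ?thesis using False by (simp add: power2_eq_square)
qed simp

section \<open>Hermitian forms and antilinear functionals on a subspace\<close>

definition hform :: "(complex \<Rightarrow> 'e::ab_group_add \<Rightarrow> 'e) \<Rightarrow> 'e set \<Rightarrow> ('e \<Rightarrow> 'e \<Rightarrow> complex) \<Rightarrow> bool" where
  "hform sc E \<kappa> \<longleftrightarrow>
     (\<forall>x\<in>E. \<forall>y\<in>E. \<forall>z\<in>E. \<kappa> (x + y) z = \<kappa> x z + \<kappa> y z) \<and>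
     (\<forall>c. \<forall>x\<in>E. \<forall>y\<in>E. \<kappa> (sc c x) y = c * \<kappa> x y) \<and>
     (\<forall>x\<in>E. \<forall>y\<in>E. \<kappa> y x = cnj (\<kappa> x y))"

text \<open>Forms are linear in the first argument, so the functionals \<open>\<kappa> f\<close>
  that they induce in the second one are antilinear.\<close>

definition antilinear_on :: "(complex \<Rightarrow> 'e::ab_group_add \<Rightarrow> 'e) \<Rightarrow> 'e set \<Rightarrow> ('e \<Rightarrow> complex) \<Rightarrow> bool" where
  "antilinear_on sc E h \<longleftrightarrow>
     (\<forall>x\<in>E. \<forall>y\<in>E. h (x + y) = h x + h y) \<and> (\<forall>c. \<forall>x\<in>E. h (sc c x) = cnj c * h x)"

locale cspace = vector_space sc for sc :: "complex \<Rightarrow> 'e::ab_group_add \<Rightarrow> 'e" +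
  fixes E :: "'e set"
  assumes subE: "subspace E"
begin

lemma zeroE[simp, intro]: "0 \<in> E" using subE subspace_0 by blast
lemma addE[simp, intro]: "f \<in> E \<Longrightarrow> g \<in> E \<Longrightarrow> f + g \<in> E" using subE subspace_add by blast
lemma diffE[simp, intro]: "f \<in> E \<Longrightarrow> g \<in> E \<Longrightarrow> f - g \<in> E" using subE subspace_diff by blast
lemma scE[simp, intro]: "f \<in> E \<Longrightarrow> sc c f \<in> E" using subE subspace_scale by blast
lemma negE[simp, intro]: "f \<in> E \<Longrightarrow> - f \<in> E" using subE subspace_neg by blast

lemma antilinear_simps:
  assumes h: "antilinear_on sc E h"
  shows "f \<in> E \<Longrightarrow> g \<in> E \<Longrightarrow> h (f + g) = h f + h g"
    and "f \<in> E \<Longrightarrow> h (sc c f) = cnj c * h f"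
    and "h 0 = 0"
    and "f \<in> E \<Longrightarrow> h (- f) = - h f"
    and "f \<in> E \<Longrightarrow> g \<in> E \<Longrightarrow> h (f - g) = h f - h g"
proof -
  show add: "f \<in> E \<Longrightarrow> g \<in> E \<Longrightarrow> h (f + g) = h f + h g" for f g
    using h by (auto simp: antilinear_on_def)
  show sc: "f \<in> E \<Longrightarrow> h (sc c f) = cnj c * h f" for c f
    using h by (auto simp: antilinear_on_def)
  show "h 0 = 0" using add[of 0 0] by simp
  show neg: "h (- f) = - h f" if "f \<in> E" for f using sc[OF that, of "-1"] by (simp add: scale_minus_left)
  show "f \<in> E \<Longrightarrow> g \<in> E \<Longrightarrow> h (f - g) = h f - h g"
    using add[of f "- g"] neg[of g] by auto
qed

lemma hform_simps:
  assumes k: "hform sc E \<kappa>"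
  shows "f \<in> E \<Longrightarrow> g \<in> E \<Longrightarrow> h \<in> E \<Longrightarrow> \<kappa> (f + g) h = \<kappa> f h + \<kappa> g h"
    and "f \<in> E \<Longrightarrow> g \<in> E \<Longrightarrow> \<kappa> (sc c f) g = c * \<kappa> f g"
    and "f \<in> E \<Longrightarrow> g \<in> E \<Longrightarrow> \<kappa> g f = cnj (\<kappa> f g)"
    and "f \<in> E \<Longrightarrow> g \<in> E \<Longrightarrow> h \<in> E \<Longrightarrow> \<kappa> f (g + h) = \<kappa> f g + \<kappa> f h"
    and "f \<in> E \<Longrightarrow> g \<in> E \<Longrightarrow> \<kappa> f (sc c g) = cnj c * \<kappa> f g"
    and "f \<in> E \<Longrightarrow> g \<in> E \<Longrightarrow> h \<in> E \<Longrightarrow> \<kappa> (f - g) h = \<kappa> f h - \<kappa> g h"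
    and "f \<in> E \<Longrightarrow> g \<in> E \<Longrightarrow> h \<in> E \<Longrightarrow> \<kappa> f (g - h) = \<kappa> f g - \<kappa> f h"
    and "f \<in> E \<Longrightarrow> \<kappa> 0 f = 0" and "f \<in> E \<Longrightarrow> \<kappa> f 0 = 0"
    and "f \<in> E \<Longrightarrow> g \<in> E \<Longrightarrow> \<kappa> (- f) g = - \<kappa> f g"
    and "f \<in> E \<Longrightarrow> g \<in> E \<Longrightarrow> \<kappa> f (- g) = - \<kappa> f g"
proof -
  show add: "f \<in> E \<Longrightarrow> g \<in> E \<Longrightarrow> h \<in> E \<Longrightarrow> \<kappa> (f + g) h = \<kappa> f h + \<kappa> g h" for f g h
    using k unfolding hform_def by blast
  show scl: "f \<in> E \<Longrightarrow> g \<in> E \<Longrightarrow> \<kappa> (sc c f) g = c * \<kappa> f g" for c f g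
    using k unfolding hform_def by blast
  show herm: "\<kappa> g f = cnj (\<kappa> f g)" if "f \<in> E" "g \<in> E" for f g
    using k that unfolding hform_def by blast
  show add2: "\<kappa> f (g + h) = \<kappa> f g + \<kappa> f h" if "f \<in> E" "g \<in> E" "h \<in> E" for f g h
    using herm[of "g + h" f] herm[of g f] herm[of h f] add[of g h f] that by auto
  show scl2: "\<kappa> f (sc c g) = cnj c * \<kappa> f g" if "f \<in> E" "g \<in> E" for c f g
    using herm[of "sc c g" f] herm[of g f] scl[of g f c] that by auto
  show neg: "\<kappa> (- f) g = - \<kappa> f g" if "f \<in> E" "g \<in> E" for f g
    using scl[of f g "-1"] that by (simp add: scale_minus_left)
  show neg2: "\<kappa> f (- g) = - \<kappa> f g" if "f \<in> E" "g \<in> E" for f g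
    using scl2[of f g "-1"] that by (simp add: scale_minus_left)
  show "f \<in> E \<Longrightarrow> g \<in> E \<Longrightarrow> h \<in> E \<Longrightarrow> \<kappa> (f - g) h = \<kappa> f h - \<kappa> g h"
    using add[of f "- g" h] neg[of g h] by auto
  show "f \<in> E \<Longrightarrow> g \<in> E \<Longrightarrow> h \<in> E \<Longrightarrow> \<kappa> f (g - h) = \<kappa> f g - \<kappa> f h"
    using add2[of f g "- h"] neg2[of f h] by auto
  show "f \<in> E \<Longrightarrow> \<kappa> 0 f = 0" using add[of 0 0 f] by auto
  show "f \<in> E \<Longrightarrow> \<kappa> f 0 = 0" using add2[of f 0 0] by auto
qed

lemma hform_antilinear: "hform sc E \<kappa> \<Longrightarrow> f \<in> E \<Longrightarrow> antilinear_on sc E (\<kappa> f)"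
  unfolding antilinear_on_def by (simp add: hform_simps(4,5))

lemma hform_self: "hform sc E \<kappa> \<Longrightarrow> f \<in> E \<Longrightarrow> \<kappa> f f = of_real (Re (\<kappa> f f))"
  using hform_simps(3)[of \<kappa> f f] by (simp add: complex_eq_iff)

lemma hform_polar:
  assumes "hform sc E \<kappa>" "f \<in> E" "g \<in> E"
  shows "4 * Re (\<kappa> f g) = Re (\<kappa> (f + g) (f + g)) - Re (\<kappa> (f - g) (f - g))"
  using assms hform_simps(3)[of \<kappa> f g]
  by (simp add: hform_simps(1,4,6,7)[OF assms(1)] addE diffE)

lemma hform_parallelogram:
  assumes "hform sc E \<kappa>" "f \<in> E" "g \<in> E"
  shows "Re (\<kappa> (f + g) (f + g)) + Re (\<kappa> (f - g) (f - g)) = 2 * Re (\<kappa> f f) + 2 * Re (\<kappa> g g)"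
  using assms by (simp add: hform_simps(1,4,6,7)[OF assms(1)] addE diffE)

text \<open>Polarization recovers the real part from the diagonal; replacing \<open>g\<close> by
  \<open>sc \<i> g\<close> turns the imaginary part into a real part.\<close>

lemma hform_eqI:
  assumes "hform sc E \<kappa>" "hform sc E \<kappa>'"
    and "\<And>f. f \<in> E \<Longrightarrow> Re (\<kappa> f f) = Re (\<kappa>' f f)" and f: "f \<in> E" and g: "g \<in> E"
  shows "\<kappa> f g = \<kappa>' f g"
proof (rule complex_eqI)
  have *: "Re (\<kappa> f g) = Re (\<kappa>' f g)" if "f \<in> E" "g \<in> E" for f g
    using hform_polar[OF assms(1) that] hform_polar[OF assms(2) that] assms(3) that by (simp add: addE diffE)
  show "Re (\<kappa> f g) = Re (\<kappa>' f g)" using * f g .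
  have "Re (\<kappa> f (sc \<i> g)) = Re (\<kappa>' f (sc \<i> g))" using * f g by auto
  then show "Im (\<kappa> f g) = Im (\<kappa>' f g)" using f g by (simp add: hform_simps(5)[OF assms(1)] hform_simps(5)[OF assms(2)])
qed

end

section \<open>Quadratic seminorms, their polar forms and their duals\<close>

text \<open>The axioms mention only the function \<open>q\<close>, because dual norms and limits of
  the iteration arrive as functions without an inner product. Null vectors are allowed.\<close>

locale qform = cspace sc E for sc :: "complex \<Rightarrow> 'e::ab_group_add \<Rightarrow> 'e" and E +
  fixes q :: "'e \<Rightarrow> real"
  assumes q_sc: "f \<in> E \<Longrightarrow> q (sc c f) = (cmod c)\<^sup>2 * q f"
    and q_par: "f \<in> E \<Longrightarrow> g \<in> E \<Longrightarrow> q (f + g) + q (f - g) = 2 * q f + 2 * q g"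
    and q_nonneg: "f \<in> E \<Longrightarrow> 0 \<le> q f"
begin

lemma q_0[simp]: "q 0 = 0" using q_sc[of 0 0] by simp
lemma q_neg: "f \<in> E \<Longrightarrow> q (- f) = q f" using q_sc[of f "-1"] by (simp add: scale_minus_left)
lemma q_add_le: "f \<in> E \<Longrightarrow> g \<in> E \<Longrightarrow> q (f + g) \<le> 2 * q f + 2 * q g"
  using q_par[of f g] q_nonneg[of "f - g"] by auto
lemma q_diff_commute: "f \<in> E \<Longrightarrow> g \<in> E \<Longrightarrow> q (f - g) = q (g - f)"
  using q_neg[of "f - g"] by auto

definition rpolar :: "'e \<Rightarrow> 'e \<Rightarrow> real" where
  "rpolar f g = (q (f + g) - q (f - g)) / 4"

definition polar :: "'e \<Rightarrow> 'e \<Rightarrow> complex" where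
  "polar f g = Complex (rpolar f g) (rpolar f (sc \<i> g))"

lemma rpolar_0: "g \<in> E \<Longrightarrow> rpolar 0 g = 0" by (simp add: rpolar_def q_neg)

lemma rpolar_bound: "f \<in> E \<Longrightarrow> g \<in> E \<Longrightarrow> \<bar>rpolar f g\<bar> \<le> (q f + q g) / 2"
  using q_par[of f g] q_nonneg[of "f - g"] q_nonneg[of "f + g"]
  by (simp add: rpolar_def abs_le_iff field_simps)

lemma rpolar_add_diff:
  assumes "a \<in> E" "b \<in> E" "g \<in> E"
  shows "rpolar (a + b) g + rpolar (a - b) g = 2 * rpolar a g"
  using q_par[of "a + g" b] q_par[of "a - g" b] assms
  by (simp add: rpolar_def field_simps)

text \<open>The Jordan-von Neumann argument: \<open>rpolar_add_diff\<close> with equal arguments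
  gives doubling, and applied to the half sum and half difference of \<open>a\<close> and
  \<open>b\<close> it becomes additivity.\<close>

lemma rpolar_add:
  assumes "a \<in> E" "b \<in> E" "g \<in> E"
  shows "rpolar (a + b) g = rpolar a g + rpolar b g"
proof -
  let ?h = "\<lambda>x. sc (1/2) x"
  have dbl: "rpolar (x + x) g = 2 * rpolar x g" if "x \<in> E" for x
    using rpolar_add_diff[OF that that assms(3)] rpolar_0[OF assms(3)] by simp
  have half: "?h x + ?h x = x" for x by (simp add: scale_left_distrib[symmetric])
  have 1: "?h (a + b) + ?h (a - b) = a" "?h (a + b) - ?h (a - b) = b"
    using half[of a] half[of b] by (simp_all add: scale_right_distrib scale_right_diff_distrib algebra_simps)
  have "rpolar a g + rpolar b g = 2 * rpolar (?h (a + b)) g"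
    using rpolar_add_diff[of "?h (a + b)" "?h (a - b)" g] assms 1 by (simp add: addE diffE scE)
  also have "\<dots> = rpolar (a + b) g" using dbl[of "?h (a + b)"] half assms by (simp add: addE scE)
  finally show ?thesis by simp
qed

lemma rpolar_real:
  assumes "f \<in> E" "g \<in> E"
  shows "rpolar (sc (of_real t) f) g = t * rpolar f g"
proof -
  have "rpolar (sc (of_real t) f) g = t * rpolar (sc (of_real 1) f) g"
  \<comment> \<open>Boundedness for \<open>\<bar>t\<bar> \<le> 1\<close>, from
    \<open>rpolar_bound\<close> and \<open>q_sc\<close>, stands in for continuity in
    \<open>t\<close>.\<close>
  proof (rule additive_bounded_imp_linear[of "\<lambda>t. rpolar (sc (of_real t) f) g" "(q f + q g) / 2"])
    show "rpolar (sc (of_real (s + t)) f) g = rpolar (sc (of_real s) f) g + rpolar (sc (of_real t) f) g" for s t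
      using assms by (simp add: scale_left_distrib rpolar_add scE)
    fix t :: real assume t: "\<bar>t\<bar> \<le> 1"
    have "\<bar>rpolar (sc (of_real t) f) g\<bar> \<le> (q (sc (of_real t) f) + q g) / 2"
      using rpolar_bound assms by auto
    also have "q (sc (of_real t) f) \<le> 1 * q f"
      using assms t q_nonneg[of f] abs_square_le_1[of t] by (subst q_sc) (auto intro: mult_left_le_one_le)
    finally show "\<bar>rpolar (sc (of_real t) f) g\<bar> \<le> (q f + q g) / 2" by simp
  qed
  then show ?thesis by simp
qed

lemma q_rot: "f \<in> E \<Longrightarrow> q (sc \<i> f) = q f"
  by (simp add: q_sc)

lemma rpolar_i:
  assumes "f \<in> E" "g \<in> E"
  shows "rpolar (sc \<i> f) g = - rpolar f (sc \<i> g)"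
proof -
  have "- ((a - b) / 4) = (b - a) / 4" for a b :: real by (simp add: minus_divide_left)
  note neg = this
  have "sc \<i> f + g = sc \<i> (f - sc \<i> g)" "sc \<i> f - g = sc \<i> (f + sc \<i> g)"
    by (simp_all add: scale_right_distrib scale_right_diff_distrib scale_minus_left)
  then show ?thesis using assms by (simp add: rpolar_def q_rot neg)
qed

lemma rpolar_sym: "f \<in> E \<Longrightarrow> g \<in> E \<Longrightarrow> rpolar g f = rpolar f g"
  using q_diff_commute[of f g] by (simp add: rpolar_def add.commute)

lemma polar_hform: "hform sc E polar"
  unfolding hform_def
proof (intro conjI ballI allI)
  fix x y assume xy: "x \<in> E" "y \<in> E"
  show "polar (x + y) z = polar x z + polar y z" if "z \<in> E" for z
    using xy that by (simp add: polar_def rpolar_add scE complex_eq_iff)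
  have ii: "rpolar (sc \<i> x) (sc \<i> y) = rpolar x y"
    using xy by (simp add: rpolar_i) (simp add: rpolar_def scale_minus_left field_simps)
  show "polar (sc c x) y = c * polar x y" for c
  proof -
    have c: "sc c x = sc (of_real (Re c)) x + sc (of_real (Im c)) (sc \<i> x)"
      by (simp add: scale_left_distrib[symmetric]) (metis complex_eq mult.commute)
    have "rpolar (sc c x) z = Re c * rpolar x z - Im c * rpolar x (sc \<i> z)" if "z \<in> E" for z
      unfolding c using xy that by (simp only: rpolar_add rpolar_real rpolar_i scE)
    from this[of y] this[of "sc \<i> y"] show ?thesis
      using xy rpolar_i[of x "sc \<i> y"] ii by (simp add: polar_def complex_eq_iff scE algebra_simps)
  qed
  show "polar y x = cnj (polar x y)"
    using xy rpolar_sym[of x y] rpolar_sym[of y "sc \<i> x"] rpolar_i[of x y] by (simp add: polar_def complex_eq_iff scE)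
qed

lemma polar_self: assumes "f \<in> E" shows "polar f f = of_real (q f)"
proof -
  have "rpolar f f = q f"
    using q_sc[OF assms, of 2] scale_left_distrib[of 1 1 f] by (simp add: rpolar_def)
  then show ?thesis using hform_self[OF polar_hform assms] by (simp add: polar_def)
qed

lemmas polar_simps = hform_simps[OF polar_hform]

text \<open>Here \<open>\<kappa>\<close> may be indefinite. Polarization and the parallelogram law
  of \<open>q\<close> give the additive bound; a phase on \<open>f\<close> and the scalings
  \<open>sqrt t\<close> and \<open>1 / sqrt t\<close> turn it into the product bound.\<close>

lemma cauchy_schwarz:
  assumes \<kappa>: "hform sc E \<kappa>" and le: "\<And>f. f \<in> E \<Longrightarrow> \<bar>Re (\<kappa> f f)\<bar> \<le> q f"
  shows "f \<in> E \<Longrightarrow> g \<in> E \<Longrightarrow> 2 * Re (\<kappa> f g) \<le> q f + q g"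
    and "f \<in> E \<Longrightarrow> g \<in> E \<Longrightarrow> cmod (\<kappa> f g) \<le> sqrt (q f) * sqrt (q g)"
proof -
  show re: "2 * Re (\<kappa> f g) \<le> q f + q g" if "f \<in> E" "g \<in> E" for f g
    using hform_polar[OF \<kappa> that] le[of "f + g"] le[of "f - g"] q_par[OF that] that
    by (simp add: addE diffE abs_le_iff)
  assume f: "f \<in> E" and g: "g \<in> E"
  show "cmod (\<kappa> f g) \<le> sqrt (q f) * sqrt (q g)"
  proof (rule le_sqrt_multI)
    fix t :: real assume t: "t > 0"
    define w where "w = cnj (sgn (\<kappa> f g))"
    have w: "w * \<kappa> f g = of_real (cmod (\<kappa> f g))" "cmod w \<le> 1"
      by (simp_all add: w_def cnj_sgn_mult norm_sgn)
    have "2 * Re (\<kappa> (sc (w * of_real (sqrt t)) f) (sc (of_real (1 / sqrt t)) g))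
        \<le> q (sc (w * of_real (sqrt t)) f) + q (sc (of_real (1 / sqrt t)) g)"
      using re f g by auto
    also have "\<kappa> (sc (w * of_real (sqrt t)) f) (sc (of_real (1 / sqrt t)) g) = w * \<kappa> f g"
      using f g t by (simp add: hform_simps(2,5)[OF \<kappa>])
    also have "Re \<dots> = cmod (\<kappa> f g)" using w by simp
    also have "q (sc (w * of_real (sqrt t)) f) \<le> t * q f"
      using f t w(2) q_nonneg[OF f] by (auto simp: q_sc norm_mult power_mult_distrib power_le_one intro!: mult_right_mono mult_left_le_one_le)
    also have "q (sc (of_real (1 / sqrt t)) g) = q g / t"
      using g t by (subst q_sc) (auto simp: norm_divide power_divide)
    finally show "2 * cmod (\<kappa> f g) \<le> t * q f + q g / t" by simp
  qed (use f g q_nonneg in auto)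
qed

lemma polar_bound: "f \<in> E \<Longrightarrow> g \<in> E \<Longrightarrow> cmod (polar f g) \<le> sqrt (q f) * sqrt (q g)"
  by (rule cauchy_schwarz(2)[OF polar_hform]) (simp_all add: polar_self q_nonneg)

lemma q_add: "f \<in> E \<Longrightarrow> g \<in> E \<Longrightarrow> q (f + g) = q f + q g + 2 * Re (polar f g)"
  using q_par[of f g] by (simp add: polar_def rpolar_def field_simps)

lemma q_diff: "f \<in> E \<Longrightarrow> g \<in> E \<Longrightarrow> q (f - g) = q f + q g - 2 * Re (polar f g)"
  using q_par[of f g] by (simp add: polar_def rpolar_def field_simps)

lemma triangle: assumes "f \<in> E" "g \<in> E" shows "sqrt (q (f + g)) \<le> sqrt (q f) + sqrt (q g)"
proof (rule real_le_lsqrt)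
  have "Re (polar f g) \<le> sqrt (q f) * sqrt (q g)"
    using polar_bound[OF assms] complex_Re_le_cmod order_trans by blast
  then show "q (f + g) \<le> (sqrt (q f) + sqrt (q g))\<^sup>2"
    using assms q_nonneg by (simp add: q_add power2_sum)
qed (use assms q_nonneg in auto)

text \<open>By completing the square, this is the square of the dual norm.\<close>

definition dualsq :: "('e \<Rightarrow> complex) \<Rightarrow> real" where
  "dualsq h = (SUP f\<in>E. 2 * Re (h f) - q f)"

definition bfun :: "('e \<Rightarrow> complex) \<Rightarrow> bool" where
  "bfun h \<longleftrightarrow> antilinear_on sc E h \<and> bdd_above ((\<lambda>f. 2 * Re (h f) - q f) ` E)"

lemma bfunI: "antilinear_on sc E h \<Longrightarrow> (\<And>f. f \<in> E \<Longrightarrow> 2 * Re (h f) - q f \<le> C) \<Longrightarrow> bfun h"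
  using bdd_aboveI2[of E "\<lambda>f. 2 * Re (h f) - q f" C] by (simp add: bfun_def)

lemma bfun_antilinear: "bfun h \<Longrightarrow> antilinear_on sc E h" by (simp add: bfun_def)

lemma dualsq_upper: "bfun h \<Longrightarrow> f \<in> E \<Longrightarrow> 2 * Re (h f) - q f \<le> dualsq h"
  unfolding dualsq_def bfun_def by (intro cSUP_upper) auto

lemma dualsq_least: "(\<And>f. f \<in> E \<Longrightarrow> 2 * Re (h f) - q f \<le> C) \<Longrightarrow> dualsq h \<le> C"
  unfolding dualsq_def by (intro cSUP_least) auto

lemma dualsq_nonneg: "bfun h \<Longrightarrow> 0 \<le> dualsq h"
  using dualsq_upper[of h 0] antilinear_simps(3)[of h] by (simp add: bfun_antilinear)

lemma dualsq_cong: "(\<And>f. f \<in> E \<Longrightarrow> h f = h' f) \<Longrightarrow> dualsq h = dualsq h'"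
  by (simp add: dualsq_def)

lemma bfun_cong: "(\<And>f. f \<in> E \<Longrightarrow> h f = h' f) \<Longrightarrow> bfun h = bfun h'"
  by (simp add: bfun_def antilinear_on_def addE scE)

lemma dualsq_bound:
  assumes h: "bfun h" and f: "f \<in> E"
  shows "cmod (h f) \<le> sqrt (dualsq h) * sqrt (q f)"
proof (rule le_sqrt_multI)
  note al = bfun_antilinear[OF h]
  fix t :: real assume t: "t > 0"
  define w where "w = sgn (h f)"
  have w: "cnj w * h f = of_real (cmod (h f))" "cmod w \<le> 1"
    by (simp_all add: w_def cnj_sgn_mult norm_sgn)
  \<comment> \<open>Testing at \<open>f\<close> scaled by \<open>w / t\<close> makes the value of
    \<open>h\<close> real and introduces the parameter; multiplying by \<open>t\<close> will give
    the hypothesis of \<open>le_sqrt_multI\<close>.\<close>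
  have "2 * Re (h (sc (w * of_real (1 / t)) f)) - q (sc (w * of_real (1 / t)) f) \<le> dualsq h"
    using dualsq_upper[OF h] f by auto
  also have "h (sc (w * of_real (1 / t)) f) = of_real (cmod (h f) / t)"
    using f w(1) by (simp add: antilinear_simps(2)[OF al])
  finally have "2 * (cmod (h f) / t) - q (sc (w * of_real (1 / t)) f) \<le> dualsq h" by simp
  moreover have "q (sc (w * of_real (1 / t)) f) \<le> q f / t\<^sup>2"
  proof -
    have "(cmod w)\<^sup>2 * (q f / t\<^sup>2) \<le> 1 * (q f / t\<^sup>2)"
      using w(2) q_nonneg[OF f] by (intro mult_right_mono power_le_one) auto
    then show ?thesis using f t by (simp add: q_sc norm_mult power_mult_distrib norm_divide power_divide)
  qed
  ultimately have "2 * (cmod (h f) / t) \<le> dualsq h + q f / t\<^sup>2" by linarith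
  then have "t * (2 * (cmod (h f) / t)) \<le> t * (dualsq h + q f / t\<^sup>2)" using t by (intro mult_left_mono) auto
  also have "t * (dualsq h + q f / t\<^sup>2) = t * dualsq h + q f / t"
    using t by (simp add: field_simps power2_eq_square)
  finally show "2 * cmod (h f) \<le> t * dualsq h + q f / t" using t by simp
qed (use f q_nonneg dualsq_nonneg[OF h] in auto)

text \<open>Together with \<open>dualsq_bound\<close> this identifies \<open>sqrt (dualsq h)\<close>
  with the least constant \<open>c\<close> in \<open>cmod (h f) \<le> c * sqrt (q f)\<close>. The
  reason is the inequality between arithmetic and geometric mean.\<close>

lemma bfunI':
  assumes al: "antilinear_on sc E h" and C: "0 \<le> C" "\<And>f. f \<in> E \<Longrightarrow> cmod (h f) \<le> sqrt C * sqrt (q f)"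
  shows "bfun h \<and> dualsq h \<le> C"
proof -
  have *: "2 * Re (h f) - q f \<le> C" if "f \<in> E" for f
  proof -
    have "2 * Re (h f) \<le> 2 * (sqrt C * sqrt (q f))" using C(2)[OF that] complex_Re_le_cmod[of "h f"] by linarith
    also have "\<dots> \<le> C + q f"
      using sum_squares_bound[of "sqrt C" "sqrt (q f)"] C(1) q_nonneg[OF that] by simp
    finally show ?thesis by simp
  qed
  then show ?thesis using bfunI[OF al] dualsq_least by auto
qed

lemma antilinear_lincomb:
  assumes "antilinear_on sc E h" "antilinear_on sc E h'"
  shows "antilinear_on sc E (\<lambda>f. h f + h' f)" "antilinear_on sc E (\<lambda>f. h f - h' f)"
    "antilinear_on sc E (\<lambda>f. c * h f)"
  using assms by (auto simp: antilinear_on_def algebra_simps)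

lemma bfun_scale:
  assumes h: "bfun h"
  shows "bfun (\<lambda>f. c * h f)" "dualsq (\<lambda>f. c * h f) = (cmod c)\<^sup>2 * dualsq h"
proof -
  have *: "bfun (\<lambda>f. c * h f) \<and> dualsq (\<lambda>f. c * h f) \<le> (cmod c)\<^sup>2 * dualsq h" if h: "bfun h" for c h
  proof (rule bfunI')
    show "antilinear_on sc E (\<lambda>f. c * h f)" using antilinear_lincomb(3) h bfun_antilinear by blast
    fix f assume "f \<in> E"
    then show "cmod (c * h f) \<le> sqrt ((cmod c)\<^sup>2 * dualsq h) * sqrt (q f)"
      using dualsq_bound[OF h] by (auto simp: norm_mult real_sqrt_mult mult.assoc intro: mult_left_mono)
  qed (use dualsq_nonneg[OF h] in auto)
  show 1: "bfun (\<lambda>f. c * h f)" using * h by blast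
  show "dualsq (\<lambda>f. c * h f) = (cmod c)\<^sup>2 * dualsq h"
  proof (cases "c = 0")
    case True
    then show ?thesis using *[OF h, of 0] dualsq_nonneg[OF 1] by simp
  next
    case False
    \<comment> \<open>The same upper bound with \<open>1 / c\<close>, applied to the scaled
      functional, gives the reverse inequality.\<close>
    have "dualsq (\<lambda>f. (1 / c) * (c * h f)) \<le> (cmod (1 / c))\<^sup>2 * dualsq (\<lambda>f. c * h f)"
      using *[OF 1] by blast
    then have "(cmod c)\<^sup>2 * dualsq h \<le> dualsq (\<lambda>f. c * h f)"
      using False by (simp add: norm_divide power_divide field_simps)
    then show ?thesis using *[OF h, of c] by simp
  qed
qed

lemma bfun_add: assumes h: "bfun h" "bfun h'" shows "bfun (\<lambda>f. h f + h' f)"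
proof -
  have "bfun (\<lambda>f. h f + h' f) \<and> dualsq (\<lambda>f. h f + h' f) \<le> (sqrt (dualsq h) + sqrt (dualsq h'))\<^sup>2"
  proof (rule bfunI')
    show "antilinear_on sc E (\<lambda>f. h f + h' f)" using antilinear_lincomb(1) h bfun_antilinear by blast
    fix f assume f: "f \<in> E"
    have "cmod (h f + h' f) \<le> (sqrt (dualsq h) + sqrt (dualsq h')) * sqrt (q f)"
      using norm_triangle_ineq[of "h f" "h' f"] dualsq_bound[OF h(1) f] dualsq_bound[OF h(2) f]
      by (simp add: algebra_simps)
    then show "cmod (h f + h' f) \<le> sqrt ((sqrt (dualsq h) + sqrt (dualsq h'))\<^sup>2) * sqrt (q f)"
      using dualsq_nonneg h by simp
  qed simp
  then show ?thesis by blast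
qed

lemma bfun_diff: assumes h: "bfun h" "bfun h'" shows "bfun (\<lambda>f. h f - h' f)"
  using bfun_add[OF h(1) bfun_scale(1)[OF h(2), of "-1"]] by simp

lemma dualsq_par:
  assumes h: "bfun h" "bfun h'"
  shows "dualsq (\<lambda>f. h f + h' f) + dualsq (\<lambda>f. h f - h' f) = 2 * dualsq h + 2 * dualsq h'"
proof (rule antisym)
  note al = antilinear_simps[OF bfun_antilinear[OF h(1)]] antilinear_simps[OF bfun_antilinear[OF h(2)]]
  note hp = bfun_add[OF h] and hm = bfun_diff[OF h]
  text \<open>The substitution \<open>f = a + b\<close>, \<open>g = a - b\<close> is a bijection of pairs.\<close>
  let ?half = "\<lambda>x. sc (1/2) x"
  have "dualsq (\<lambda>f. h f + h' f) \<le> 2 * dualsq h + 2 * dualsq h' - dualsq (\<lambda>f. h f - h' f)"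
  proof (rule dualsq_least)
    fix f assume f: "f \<in> E"
    have "dualsq (\<lambda>f. h f - h' f) \<le> 2 * dualsq h + 2 * dualsq h' - (2 * Re (h f + h' f) - q f)"
    proof (rule dualsq_least)
      fix g assume g: "g \<in> E"
      let ?a = "?half (f + g)" and ?b = "?half (f - g)"
      have ab: "?a \<in> E" "?b \<in> E" using f g by auto
      have fg: "?a + ?b = f" "?a - ?b = g"
        by (simp_all add: scale_right_distrib scale_right_diff_distrib algebra_simps)
          (simp_all add: scale_left_distrib[symmetric])
      have "2 * q ?a + 2 * q ?b = q f + q g" using q_par[OF ab] fg by simp
      moreover have "h f = h ?a + h ?b" "h g = h ?a - h ?b" "h' f = h' ?a + h' ?b" "h' g = h' ?a - h' ?b"
        using al(1,5,6,10) ab fg by metis+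
      ultimately show "2 * Re (h g - h' g) - q g \<le> 2 * dualsq h + 2 * dualsq h' - (2 * Re (h f + h' f) - q f)"
        using dualsq_upper[OF h(1) ab(1)] dualsq_upper[OF h(2) ab(2)] by simp
    qed
    then show "2 * Re (h f + h' f) - q f \<le> 2 * dualsq h + 2 * dualsq h' - dualsq (\<lambda>f. h f - h' f)" by simp
  qed
  then show "dualsq (\<lambda>f. h f + h' f) + dualsq (\<lambda>f. h f - h' f) \<le> 2 * dualsq h + 2 * dualsq h'" by simp
  let ?S = "dualsq (\<lambda>f. h f + h' f) + dualsq (\<lambda>f. h f - h' f)"
  have "dualsq h \<le> ?S / 2 - dualsq h'"
  proof (rule dualsq_least)
    fix a assume a: "a \<in> E"
    have "dualsq h' \<le> ?S / 2 - (2 * Re (h a) - q a)"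
    proof (rule dualsq_least)
      fix b assume b: "b \<in> E"
      have "2 * Re (h (a + b) + h' (a + b)) - q (a + b) + (2 * Re (h (a - b) - h' (a - b)) - q (a - b)) \<le> ?S"
        using dualsq_upper[OF hp, of "a + b"] dualsq_upper[OF hm, of "a - b"] a b by (simp add: addE diffE)
      then show "2 * Re (h' b) - q b \<le> ?S / 2 - (2 * Re (h a) - q a)"
        using al(1,5,6,10) a b q_par[OF a b] by (simp add: field_simps)
    qed
    then show "2 * Re (h a) - q a \<le> ?S / 2 - dualsq h'" by simp
  qed
  then show "2 * dualsq h + 2 * dualsq h' \<le> ?S" by (simp add: field_simps)
qed

lemma bfun_polar: "g \<in> E \<Longrightarrow> bfun (polar g)"
  using bfunI'[of "polar g" "q g"] by (simp add: hform_antilinear[OF polar_hform] q_nonneg polar_bound)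

text \<open>Translating the supremum by \<open>g\<close> completes the square: \<open>h g\<close>
  acts as the inner product of \<open>h\<close> with the functional of \<open>g\<close>.\<close>

lemma dualsq_diff_polar:
  assumes h: "bfun h" and g: "g \<in> E"
  shows "dualsq (\<lambda>f. h f - polar g f) = dualsq h - 2 * Re (h g) + q g"
proof (rule antisym)
  note al = antilinear_simps[OF bfun_antilinear[OF h]]
  have id: "2 * Re (h f - polar g f) - q f = 2 * Re (h (f + g)) - q (f + g) - 2 * Re (h g) + q g"
    if "f \<in> E" for f
    using that g al(1) q_add[OF that g] polar_simps(3)[of f g] by simp
  show "dualsq (\<lambda>f. h f - polar g f) \<le> dualsq h - 2 * Re (h g) + q g"
    by (rule dualsq_least) (use id dualsq_upper[OF h] g in \<open>auto simp: addE\<close>)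
  have "dualsq h \<le> dualsq (\<lambda>f. h f - polar g f) + 2 * Re (h g) - q g"
  proof (rule dualsq_least)
    fix f assume f: "f \<in> E"
    show "2 * Re (h f) - q f \<le> dualsq (\<lambda>f. h f - polar g f) + 2 * Re (h g) - q g"
      using dualsq_upper[OF bfun_diff[OF h bfun_polar[OF g]], of "f - g"] id[of "f - g"] f g by (auto simp: diffE)
  qed
  then show "dualsq h - 2 * Re (h g) + q g \<le> dualsq (\<lambda>f. h f - polar g f)" by simp
qed

text \<open>The approximations are the near-maximizers of the supremum in \<open>dualsq h\<close>,
  since \<open>dualsq_diff_polar\<close> expresses the squared distance as the gap to the
  supremum.\<close>

lemma polar_dense:
  assumes h: "bfun h" and e: "e > 0"
  obtains g where "g \<in> E" "dualsq (\<lambda>f. h f - polar g f) < e"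
proof -
  have "\<exists>g\<in>E. dualsq h - e < 2 * Re (h g) - q g"
    using less_cSUP_iff[of E "\<lambda>f. 2 * Re (h f) - q f" "dualsq h - e"] h e zeroE
    unfolding dualsq_def bfun_def by fastforce
  then show ?thesis using that dualsq_diff_polar[OF h] by fastforce
qed

lemma bfun_0: "bfun (\<lambda>f. 0)" "dualsq (\<lambda>f. 0) = 0"
proof -
  have "bfun (\<lambda>f. 0) \<and> dualsq (\<lambda>f. 0) \<le> 0" by (rule bfunI') (auto simp: antilinear_on_def q_nonneg)
  then show "bfun (\<lambda>f. 0)" "dualsq (\<lambda>f. 0) = 0" using dualsq_nonneg by force+
qed

lemma dualsq_polar: assumes "g \<in> E" shows "dualsq (polar g) = q g"
proof -
  have "dualsq (\<lambda>f. 0 - polar g f) = q g" using dualsq_diff_polar[OF bfun_0(1) assms] bfun_0(2) by simp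
  then show ?thesis using bfun_scale(2)[OF bfun_polar[OF assms], of "-1"] by simp
qed

end

lemma (in cspace) hform_qform:
  assumes k: "hform sc E \<kappa>" and pos: "\<And>f. f \<in> E \<Longrightarrow> 0 \<le> Re (\<kappa> f f)"
  shows "qform sc E (\<lambda>f. Re (\<kappa> f f))"
proof
  fix f h c assume f: "f \<in> E"
  have "\<kappa> (sc c f) (sc c f) = of_real ((cmod c)\<^sup>2) * \<kappa> f f"
    using f by (simp add: hform_simps(2,5)[OF k] complex_norm_square mult_ac del: of_real_power)
  then show "Re (\<kappa> (sc c f) (sc c f)) = (cmod c)\<^sup>2 * Re (\<kappa> f f)" by (simp del: of_real_power)
  show "0 \<le> Re (\<kappa> f f)" using pos[OF f] .
  assume h: "h \<in> E"
  show "Re (\<kappa> (f + h) (f + h)) + Re (\<kappa> (f - h) (f - h)) = 2 * Re (\<kappa> f f) + 2 * Re (\<kappa> h h)"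
    by (rule hform_parallelogram[OF k f h])
qed

section \<open>The Newton iteration and the dual Krein space\<close>

context cspace
begin

definition majorant :: "('e \<Rightarrow> 'e \<Rightarrow> complex) \<Rightarrow> ('e \<Rightarrow> real) \<Rightarrow> bool" where
  "majorant \<kappa> q \<longleftrightarrow> qform sc E q \<and> (\<forall>f\<in>E. \<bar>Re (\<kappa> f f)\<bar> \<le> q f)"

text \<open>One Newton step towards the modulus of \<open>\<kappa>\<close> relative to \<open>q\<close>.\<close>

definition newton :: "('e \<Rightarrow> 'e \<Rightarrow> complex) \<Rightarrow> ('e \<Rightarrow> real) \<Rightarrow> 'e \<Rightarrow> real" where
  "newton \<kappa> q f = (q f + qform.dualsq E q (\<kappa> f)) / 2"

text \<open>The bound on the dual term is Cauchy-Schwarz for a dominated form; it makes the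
  iteration decrease, while the lower bound on \<open>newton\<close> keeps each step a
  majorant.\<close>

lemma majorant_dual:
  assumes \<kappa>: "hform sc E \<kappa>" and q: "majorant \<kappa> q" and f: "f \<in> E"
  shows "qform.bfun sc E q (\<kappa> f)" "qform.dualsq E q (\<kappa> f) \<le> q f"
    and "\<bar>Re (\<kappa> f f)\<bar> \<le> newton \<kappa> q f" "newton \<kappa> q f \<le> q f"
proof -
  interpret q: qform sc E q using q by (simp add: majorant_def)
  have le: "\<bar>Re (\<kappa> f f)\<bar> \<le> q f" if "f \<in> E" for f using q that by (simp add: majorant_def)
  have "q.bfun (\<kappa> f) \<and> q.dualsq (\<kappa> f) \<le> q f"
    by (rule q.bfunI'[OF hform_antilinear[OF \<kappa> f]])
      (use q.cauchy_schwarz(2)[OF \<kappa> le f] q.q_nonneg[OF f] in auto)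
  then show b: "q.bfun (\<kappa> f)" and d: "q.dualsq (\<kappa> f) \<le> q f" by auto
  show "newton \<kappa> q f \<le> q f" using d by (simp add: newton_def)
  \<comment> \<open>Testing the supremum at \<open>f\<close> and \<open>- f\<close> shows that the
    dual term is at least \<open>2 * \<bar>Re (\<kappa> f f)\<bar> - q f\<close>.\<close>
  show "\<bar>Re (\<kappa> f f)\<bar> \<le> newton \<kappa> q f"
    using q.dualsq_upper[OF b f] q.dualsq_upper[OF b, of "- f"] f
    by (simp add: newton_def hform_simps(11)[OF \<kappa>] q.q_neg abs_le_iff)
qed

text \<open>Since \<open>f\<close> enters linearly through \<open>\<kappa> f\<close>, the
  parallelogram law of the dual norm, \<open>dualsq_par\<close>, passes to \<open>f\<close>.\<close>

lemma dual_qform: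
  assumes \<kappa>: "hform sc E \<kappa>" and q: "majorant \<kappa> q"
  shows "qform sc E (\<lambda>f. qform.dualsq E q (\<kappa> f))"
proof -
  interpret q: qform sc E q using q by (simp add: majorant_def)
  note b = majorant_dual(1)[OF \<kappa> q]
  show ?thesis
  proof
    fix f c assume f: "f \<in> E"
    have "q.dualsq (\<kappa> (sc c f)) = q.dualsq (\<lambda>g. c * \<kappa> f g)"
      using f by (intro q.dualsq_cong) (simp add: hform_simps(2)[OF \<kappa>])
    then show "q.dualsq (\<kappa> (sc c f)) = (cmod c)\<^sup>2 * q.dualsq (\<kappa> f)"
      by (simp add: q.bfun_scale(2)[OF b[OF f]])
    show "0 \<le> q.dualsq (\<kappa> f)" using q.dualsq_nonneg b f by blast
    fix g assume g: "g \<in> E"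
    have "q.dualsq (\<kappa> (f + g)) = q.dualsq (\<lambda>h. \<kappa> f h + \<kappa> g h)"
      "q.dualsq (\<kappa> (f - g)) = q.dualsq (\<lambda>h. \<kappa> f h - \<kappa> g h)"
      using f g by (auto intro!: q.dualsq_cong simp: hform_simps(1,6)[OF \<kappa>])
    then show "q.dualsq (\<kappa> (f + g)) + q.dualsq (\<kappa> (f - g)) = 2 * q.dualsq (\<kappa> f) + 2 * q.dualsq (\<kappa> g)"
      using q.dualsq_par[OF b[OF f] b[OF g]] by simp
  qed
qed

lemma majorant_newton:
  assumes \<kappa>: "hform sc E \<kappa>" and q: "majorant \<kappa> q"
  shows "majorant \<kappa> (newton \<kappa> q)"
proof -
  interpret q: qform sc E q using q by (simp add: majorant_def)
  interpret d: qform sc E "\<lambda>f. q.dualsq (\<kappa> f)" using dual_qform[OF \<kappa> q] .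
  have "qform sc E (newton \<kappa> q)"
  proof
    fix f c assume f: "f \<in> E"
    show "newton \<kappa> q (sc c f) = (cmod c)\<^sup>2 * newton \<kappa> q f"
      using f by (simp add: newton_def q.q_sc d.q_sc field_simps)
    show "0 \<le> newton \<kappa> q f" using f by (simp add: newton_def q.q_nonneg d.q_nonneg)
    fix g assume g: "g \<in> E"
    show "newton \<kappa> q (f + g) + newton \<kappa> q (f - g) = 2 * newton \<kappa> q f + 2 * newton \<kappa> q g"
      using q.q_par[OF f g] d.q_par[OF f g] by (simp add: newton_def field_simps)
  qed
  then show ?thesis using majorant_dual(3)[OF \<kappa> q] by (simp add: majorant_def)
qed

text \<open>Moving \<open>S\<close> across \<open>\<kappa>\<close> puts \<open>T\<close> into the
  supremum, so the first summand of \<open>newton\<close> uses the bound for \<open>S\<close> and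
  the dual summand the bound for \<open>T\<close>.\<close>

lemma newton_bounded:
  assumes \<kappa>: "hform sc E \<kappa>" and q: "majorant \<kappa> q"
    and S: "S ` E \<subseteq> E" and T: "T ` E \<subseteq> E"
    and adj: "\<And>f g. f \<in> E \<Longrightarrow> g \<in> E \<Longrightarrow> \<kappa> (S f) g = \<kappa> f (T g)"
    and C: "C > 0" "\<And>f. f \<in> E \<Longrightarrow> q (S f) \<le> C * q f" "\<And>f. f \<in> E \<Longrightarrow> q (T f) \<le> C * q f"
    and f: "f \<in> E"
  shows "newton \<kappa> q (S f) \<le> C * newton \<kappa> q f"
proof -
  interpret q: qform sc E q using q by (simp add: majorant_def)
  have "q.dualsq (\<kappa> (S f)) \<le> C * q.dualsq (\<kappa> f)"
  proof (rule q.dualsq_least)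
    fix g assume g: "g \<in> E"
    \<comment> \<open>The scaling gives \<open>q ?h \<le> q g / C\<close>, so that testing at
      \<open>?h\<close> yields the wanted expression divided by \<open>C\<close>.\<close>
    let ?h = "sc (of_real (1 / C)) (T g)"
    have Tg: "T g \<in> E" using T g by blast
    have "2 * Re (\<kappa> f ?h) - q ?h \<le> q.dualsq (\<kappa> f)"
      by (rule q.dualsq_upper[OF majorant_dual(1)[OF \<kappa> q f]]) (use Tg in blast)
    moreover have "\<kappa> f ?h = \<kappa> (S f) g / of_real C" using adj[OF f g] Tg f by (simp add: hform_simps(5)[OF \<kappa>])
    moreover have "q ?h \<le> q g / C"
      using C Tg C(3)[OF g] by (subst q.q_sc) (auto simp: norm_divide power2_eq_square field_simps)
    ultimately have "2 * Re (\<kappa> (S f) g) / C - q g / C \<le> q.dualsq (\<kappa> f)" by simp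
    then show "2 * Re (\<kappa> (S f) g) - q g \<le> C * q.dualsq (\<kappa> f)"
      using C(1) by (simp add: field_simps)
  qed
  then show ?thesis using C(2)[OF f] by (simp add: newton_def field_simps)
qed

text \<open>Saturation is stated as one inequality; the reverse one holds for every majorant by
  \<open>majorant_dual\<close>. The last clause concludes for \<open>S\<close> alone, as hermitian
  symmetry of \<open>\<kappa>\<close> lets \<open>S\<close> and \<open>T\<close> be
  exchanged.\<close>

lemma saturated_majorant:
  assumes \<kappa>: "hform sc E \<kappa>" and q0: "majorant \<kappa> q0"
  shows "\<exists>q. majorant \<kappa> q \<and> (\<forall>f\<in>E. q f \<le> q0 f) \<and> (\<forall>f\<in>E. q f \<le> qform.dualsq E q (\<kappa> f)) \<and>
    (\<forall>S T C. S ` E \<subseteq> E \<longrightarrow> T ` E \<subseteq> E \<longrightarrow> (\<forall>f\<in>E. \<forall>g\<in>E. \<kappa> (S f) g = \<kappa> f (T g)) \<longrightarrow>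
      C > 0 \<longrightarrow> (\<forall>f\<in>E. q0 (S f) \<le> C * q0 f \<and> q0 (T f) \<le> C * q0 f) \<longrightarrow> (\<forall>f\<in>E. q (S f) \<le> C * q f))"
proof -
  define Q where "Q n = (newton \<kappa> ^^ n) q0" for n
  have Q_0: "Q 0 = q0" and Q_Suc: "Q (Suc n) = newton \<kappa> (Q n)" for n by (simp_all add: Q_def)
  have maj: "majorant \<kappa> (Q n)" for n
    by (induction n) (simp_all add: Q_0 Q_Suc q0 majorant_newton[OF \<kappa>])
  have qf: "qform sc E (Q n)" for n using maj by (simp add: majorant_def)
  have dec: "decseq (\<lambda>n. Q n f)" if "f \<in> E" for f
    by (rule decseq_SucI) (use majorant_dual(4)[OF \<kappa> maj that] Q_Suc in simp)
  define q where "q f = lim (\<lambda>n. Q n f)" for f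
  have lim: "(\<lambda>n. Q n f) \<longlonglongrightarrow> q f" if f: "f \<in> E" for f
    unfolding q_def
    by (rule convergent_LIMSEQ_iff[THEN iffD1], rule Bseq_monoseq_convergent)
      (use dec[OF f] decseq_bounded[OF dec[OF f], of 0] qform.q_nonneg[OF qf f] in \<open>auto simp: decseq_imp_monoseq\<close>)
  have le: "q f \<le> Q n f" if "f \<in> E" for f n
    using decseq_ge[OF dec lim] that by blast
  have q: "qform sc E q"
  proof
    fix f c assume f: "f \<in> E"
    have "(\<lambda>n. Q n (sc c f)) \<longlonglongrightarrow> (cmod c)\<^sup>2 * q f"
      using tendsto_mult_left[OF lim[OF f]] by (simp add: qform.q_sc[OF qf f])
    then show "q (sc c f) = (cmod c)\<^sup>2 * q f" using lim[of "sc c f"] LIMSEQ_unique f by blast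
    show "0 \<le> q f" using LIMSEQ_le_const[OF lim[OF f]] qform.q_nonneg[OF qf f] by blast
    fix g assume g: "g \<in> E"
    have "(\<lambda>n. Q n (f + g) + Q n (f - g)) \<longlonglongrightarrow> 2 * q f + 2 * q g"
      unfolding qform.q_par[OF qf f g] by (intro tendsto_intros lim f g)
    moreover have "(\<lambda>n. Q n (f + g) + Q n (f - g)) \<longlonglongrightarrow> q (f + g) + q (f - g)"
      by (intro tendsto_intros lim addE diffE f g)
    ultimately show "q (f + g) + q (f - g) = 2 * q f + 2 * q g" using LIMSEQ_unique by blast
  qed
  have maj_q: "majorant \<kappa> q"
    unfolding majorant_def using q LIMSEQ_le_const[OF lim] maj by (auto simp: majorant_def)
  have sat: "q f \<le> qform.dualsq E q (\<kappa> f)" if f: "f \<in> E" for f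
  proof -
    \<comment> \<open>The left side is the dual term of \<open>Q n\<close>, which is at most that of
      \<open>q\<close> because \<open>q \<le> Q n\<close> and duality reverses order. In the limit
      the left side becomes \<open>q f\<close>.\<close>
    have "2 * Q (Suc n) f - Q n f \<le> qform.dualsq E q (\<kappa> f)" for n
    proof -
      have "2 * Q (Suc n) f - Q n f = qform.dualsq E (Q n) (\<kappa> f)"
        unfolding Q_Suc newton_def by (simp only: field_simps) simp
      also have "\<dots> \<le> qform.dualsq E q (\<kappa> f)"
      proof (rule qform.dualsq_least[OF qf])
        fix g assume "g \<in> E"
        then show "2 * Re (\<kappa> f g) - Q n g \<le> qform.dualsq E q (\<kappa> f)"
          using qform.dualsq_upper[OF q majorant_dual(1)[OF \<kappa> maj_q f], of g] le[of g n] by simp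
      qed
      finally show ?thesis .
    qed
    moreover have "(\<lambda>n. 2 * Q (Suc n) f - Q n f) \<longlonglongrightarrow> 2 * q f - q f"
      by (intro tendsto_intros LIMSEQ_Suc lim f)
    ultimately show ?thesis using LIMSEQ_le_const2 by fastforce
  qed
  have bdd: "q (S f) \<le> C * q f"
    if S: "S ` E \<subseteq> E" and T: "T ` E \<subseteq> E"
      and adj: "\<And>f g. f \<in> E \<Longrightarrow> g \<in> E \<Longrightarrow> \<kappa> (S f) g = \<kappa> f (T g)"
      and C: "C > 0" "\<And>f. f \<in> E \<Longrightarrow> q0 (S f) \<le> C * q0 f" "\<And>f. f \<in> E \<Longrightarrow> q0 (T f) \<le> C * q0 f"
      and f: "f \<in> E" for S T C f
  proof -
    have adj': "\<kappa> (T f) g = \<kappa> f (S g)" if "f \<in> E" "g \<in> E" for f g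
      using adj[OF that(2,1)] hform_simps(3)[OF \<kappa>, of "S g" f] hform_simps(3)[OF \<kappa>, of g "T f"] that S T
      by (auto simp: image_subset_iff)
    \<comment> \<open>The bounds for \<open>S\<close> and \<open>T\<close> are carried together,
      since one step for either uses the other.\<close>
    have "(\<forall>f\<in>E. Q n (S f) \<le> C * Q n f) \<and> (\<forall>f\<in>E. Q n (T f) \<le> C * Q n f)" for n
    proof (induction n)
      case 0
      then show ?case using C by (simp add: Q_0)
    next
      case (Suc n)
      then show ?case
        using newton_bounded[OF \<kappa> maj[of n] S T adj C(1)] newton_bounded[OF \<kappa> maj[of n] T S adj' C(1)]
        by (auto simp: Q_Suc)
    qed
    then have "\<And>n. Q n (S f) \<le> C * Q n f" using f by blast
    then show ?thesis
      using LIMSEQ_le[OF lim[of "S f"] tendsto_mult_left[OF lim[OF f]]] S f by blast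
  qed
  have le0: "q f \<le> q0 f" if "f \<in> E" for f using le[OF that, of 0] by (simp add: Q_0)
  show ?thesis
  proof (intro exI[of _ q] conjI allI impI ballI)
    fix S T C f
    assume "S ` E \<subseteq> E" "T ` E \<subseteq> E" "\<forall>f\<in>E. \<forall>g\<in>E. \<kappa> (S f) g = \<kappa> f (T g)" "C > 0"
      "\<forall>f\<in>E. q0 (S f) \<le> C * q0 f \<and> q0 (T f) \<le> C * q0 f" "f \<in> E"
    then show "q (S f) \<le> C * q f" by (intro bdd[of S T]) auto
  qed (use maj_q le0 sat in auto)
qed

end

text \<open>\<open>ev\<close> identifies \<open>U0\<close> with the space of all antilinear functionals on \<open>E\<close>.\<close>

locale pairing = cspace sc E + U: cspace scu U0
  for sc :: "complex \<Rightarrow> 'e::ab_group_add \<Rightarrow> 'e" and E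
    and scu :: "complex \<Rightarrow> 'u::ab_group_add \<Rightarrow> 'u" and U0 +
  fixes ev :: "'u \<Rightarrow> 'e \<Rightarrow> complex"
  assumes ev_antilinear: "u \<in> U0 \<Longrightarrow> antilinear_on sc E (ev u)"
    and ev_add: "u \<in> U0 \<Longrightarrow> v \<in> U0 \<Longrightarrow> f \<in> E \<Longrightarrow> ev (u + v) f = ev u f + ev v f"
    and ev_scu: "u \<in> U0 \<Longrightarrow> f \<in> E \<Longrightarrow> ev (scu c u) f = c * ev u f"
    and ev_eq_0: "u \<in> U0 \<Longrightarrow> (\<And>f. f \<in> E \<Longrightarrow> ev u f = 0) \<Longrightarrow> u = 0"
    and ev_ex: "antilinear_on sc E h \<Longrightarrow> \<exists>u\<in>U0. \<forall>f\<in>E. ev u f = h f"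
begin

lemma ev_uminus: "u \<in> U0 \<Longrightarrow> f \<in> E \<Longrightarrow> ev (- u) f = - ev u f"
  using ev_scu[of u f "-1"] by (simp add: U.scale_minus_left)

lemma ev_diff: "u \<in> U0 \<Longrightarrow> v \<in> U0 \<Longrightarrow> f \<in> E \<Longrightarrow> ev (u - v) f = ev u f - ev v f"
  using ev_add[of u "- v" f] ev_uminus[of v f] by auto

lemma ev_inject: "u \<in> U0 \<Longrightarrow> v \<in> U0 \<Longrightarrow> (\<And>f. f \<in> E \<Longrightarrow> ev u f = ev v f) \<Longrightarrow> u = v"
  using ev_eq_0[of "u - v"] by (simp add: ev_diff)

definition rep :: "('e \<Rightarrow> complex) \<Rightarrow> 'u" where
  "rep h = (SOME u. u \<in> U0 \<and> (\<forall>f\<in>E. ev u f = h f))"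

lemma rep:
  assumes "antilinear_on sc E h"
  shows "rep h \<in> U0" "f \<in> E \<Longrightarrow> ev (rep h) f = h f"
proof -
  have "rep h \<in> U0 \<and> (\<forall>f\<in>E. ev (rep h) f = h f)"
    unfolding rep_def by (rule someI_ex) (use ev_ex[OF assms] in blast)
  then show "rep h \<in> U0" "f \<in> E \<Longrightarrow> ev (rep h) f = h f" by auto
qed

end

section \<open>The Hilbert space of bounded antilinear functionals\<close>

locale dual = pairing sc E scu U0 ev + qform sc E q
  for sc :: "complex \<Rightarrow> 'e::ab_group_add \<Rightarrow> 'e" and E
    and scu :: "complex \<Rightarrow> 'u::ab_group_add \<Rightarrow> 'u" and U0 and ev and q
begin

definition D :: "'u set" where "D = {u \<in> U0. bfun (ev u)}"

definition nq :: "'u \<Rightarrow> real" where "nq u = dualsq (ev u)"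

lemma DU: "u \<in> D \<Longrightarrow> u \<in> U0" and D_bfun: "u \<in> D \<Longrightarrow> bfun (ev u)" by (auto simp: D_def)

lemma D_add: "u \<in> D \<Longrightarrow> v \<in> D \<Longrightarrow> bfun (ev (u + v))" "u \<in> D \<Longrightarrow> v \<in> D \<Longrightarrow> nq (u + v) = dualsq (\<lambda>f. ev u f + ev v f)"
  using bfun_cong[of "ev (u + v)" "\<lambda>f. ev u f + ev v f"] bfun_add[of "ev u" "ev v"]
  by (auto simp: D_def nq_def ev_add intro!: dualsq_cong)

lemma D_diff: "u \<in> D \<Longrightarrow> v \<in> D \<Longrightarrow> nq (u - v) = dualsq (\<lambda>f. ev u f - ev v f)"
  by (auto simp: D_def nq_def ev_diff intro!: dualsq_cong)

lemma D_scale: "u \<in> D \<Longrightarrow> bfun (ev (scu c u))" "u \<in> D \<Longrightarrow> nq (scu c u) = dualsq (\<lambda>f. c * ev u f)"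
  using bfun_cong[of "ev (scu c u)" "\<lambda>f. c * ev u f"] bfun_scale(1)[of "ev u" c]
  by (auto simp: D_def nq_def ev_scu intro!: dualsq_cong)

sublocale D: qform scu D nq
proof
  have "ev 0 f = 0" if "f \<in> E" for f using ev_scu[of 0 f 0] that by simp
  then have "bfun (ev 0)" using bfun_cong[of "ev 0" "\<lambda>f. 0"] bfun_0(1) by simp
  then show "U.subspace D"
    unfolding U.subspace_def using D_add(1) D_scale(1) by (auto simp: D_def)
  fix u c assume u: "u \<in> D"
  show "nq (scu c u) = (cmod c)\<^sup>2 * nq u"
    using D_scale(2)[OF u] bfun_scale(2)[OF D_bfun[OF u]] by (simp add: nq_def)
  show "0 \<le> nq u" using u dualsq_nonneg by (auto simp: nq_def D_def)
  fix v assume v: "v \<in> D"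
  show "nq (u + v) + nq (u - v) = 2 * nq u + 2 * nq v"
    using dualsq_par[OF D_bfun[OF u] D_bfun[OF v]] D_add(2)[OF u v] D_diff[OF u v] by (simp add: nq_def)
qed

abbreviation ip :: "'u \<Rightarrow> 'u \<Rightarrow> complex" where "ip \<equiv> D.polar"

lemma rep_D: "bfun h \<Longrightarrow> rep h \<in> D" "bfun h \<Longrightarrow> nq (rep h) = dualsq h" "bfun h \<Longrightarrow> f \<in> E \<Longrightarrow> ev (rep h) f = h f"
proof -
  assume h: "bfun h"
  note r = rep[OF bfun_antilinear[OF h]]
  show "rep h \<in> D" using r h bfun_cong[of "ev (rep h)" h] by (simp add: D_def)
  show "nq (rep h) = dualsq h" using r dualsq_cong[of "ev (rep h)" h] by (simp add: nq_def)
  show "f \<in> E \<Longrightarrow> ev (rep h) f = h f" using r by blast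
qed

lemma D_inject: "u \<in> D \<Longrightarrow> v \<in> D \<Longrightarrow> (\<And>f. f \<in> E \<Longrightarrow> ev u f = ev v f) \<Longrightarrow> u = v"
  using ev_inject DU by blast

lemma ev_bound: "u \<in> D \<Longrightarrow> f \<in> E \<Longrightarrow> cmod (ev u f) \<le> sqrt (nq u) * sqrt (q f)"
  unfolding nq_def using dualsq_bound D_bfun by blast

lemma nq_eq_0: "u \<in> D \<Longrightarrow> nq u = 0 \<Longrightarrow> u = 0"
  using ev_eq_0[of u] DU ev_bound[of u] by auto

text \<open>The canonical map into the dual; its image stands for the quotient of \<open>E\<close>
  by the null vectors of \<open>q\<close>.\<close>

definition rv :: "'e \<Rightarrow> 'u" where "rv g = rep (polar g)"

lemma rv: "g \<in> E \<Longrightarrow> rv g \<in> D" "g \<in> E \<Longrightarrow> nq (rv g) = q g" "g \<in> E \<Longrightarrow> f \<in> E \<Longrightarrow> ev (rv g) f = polar g f"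
  using rep_D[OF bfun_polar] dualsq_polar by (simp_all add: rv_def)

lemma rv_scale: "g \<in> E \<Longrightarrow> rv (sc c g) = scu c (rv g)"
  by (intro D_inject) (simp_all add: rv ev_scu DU polar_simps(2))

lemma nq_diff_rv: "u \<in> D \<Longrightarrow> g \<in> E \<Longrightarrow> nq (u - rv g) = nq u - 2 * Re (ev u g) + q g"
proof -
  assume u: "u \<in> D" and g: "g \<in> E"
  have "nq (u - rv g) = dualsq (\<lambda>f. ev u f - polar g f)"
    unfolding D_diff[OF u rv(1)[OF g]] using g by (intro dualsq_cong) (simp add: rv)
  then show ?thesis using dualsq_diff_polar[OF D_bfun[OF u] g] by (simp add: nq_def)
qed

text \<open>The reproducing property. The real part comes from comparing two expansions of
  \<open>nq (u - rv g)\<close>, one by completing the square and one by the inner product of the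
  dual.\<close>

lemma ip_rv: assumes u: "u \<in> D" and g: "g \<in> E" shows "ip u (rv g) = ev u g"
proof -
  have re: "Re (ip u (rv g)) = Re (ev u g)" if g: "g \<in> E" for g
    using nq_diff_rv[OF u g] D.q_diff[OF u rv(1)[OF g]] rv(2)[OF g] by simp
  have "Re (ip u (rv (sc \<i> g))) = Re (ev u (sc \<i> g))" using re g by blast
  then have "Im (ip u (rv g)) = Im (ev u g)"
    using u g by (simp add: rv_scale D.polar_simps(5) rv antilinear_simps(2)[OF ev_antilinear[OF DU[OF u]]])
  then show ?thesis using re[OF g] by (simp add: complex_eq_iff)
qed

lemma rv_dense: assumes u: "u \<in> D" and e: "e > 0" obtains g where "g \<in> E" "nq (u - rv g) < e"
proof -
  obtain g where g: "g \<in> E" "dualsq (\<lambda>f. ev u f - polar g f) < e" using polar_dense[OF D_bfun[OF u] e] .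
  moreover have "nq (u - rv g) = dualsq (\<lambda>f. ev u f - polar g f)"
    unfolding D_diff[OF u rv(1)[OF g(1)]] using g by (intro dualsq_cong) (simp add: rv)
  ultimately show ?thesis using that by simp
qed

text \<open>As for any dual space, completeness rests on pointwise limits, whether or not
  \<open>E\<close> is complete.\<close>

lemma D_complete:
  fixes s :: "nat \<Rightarrow> 'u"
  assumes s: "\<And>n. s n \<in> D" and cau: "\<And>e. e > 0 \<Longrightarrow> \<exists>N. \<forall>m\<ge>N. \<forall>n\<ge>N. nq (s m - s n) < e"
  shows "\<exists>l\<in>D. \<forall>e>0. \<exists>N. \<forall>n\<ge>N. nq (s n - l) < e"
proof -
  have dist: "cmod (ev (s m) f - ev (s n) f) \<le> sqrt e * sqrt (q f)"
    if "nq (s m - s n) < e" "f \<in> E" for m n e f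
  proof -
    have "cmod (ev (s m - s n) f) \<le> sqrt (nq (s m - s n)) * sqrt (q f)" using ev_bound s that by blast
    also have "\<dots> \<le> sqrt e * sqrt (q f)" using that q_nonneg by (intro mult_right_mono) auto
    finally show ?thesis using that s by (simp add: ev_diff DU)
  qed
  define h where "h f = lim (\<lambda>n. ev (s n) f)" for f
  have lim: "(\<lambda>n. ev (s n) f) \<longlonglongrightarrow> h f" if f: "f \<in> E" for f
  proof -
    have "Cauchy (\<lambda>n. ev (s n) f)"
    proof (rule metric_CauchyI)
      fix e :: real assume e: "e > 0"
      \<comment> \<open>The summand 1 keeps the denominator positive when \<open>q f = 0\<close> and
        makes \<open>d * sqrt (q f) < e\<close> strict.\<close>
      define d where "d = e / (1 + sqrt (q f))"
      have d: "d > 0" "d * sqrt (q f) < e"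
        using e q_nonneg[OF f] by (auto simp: d_def pos_divide_less_eq add_pos_nonneg algebra_simps)
      obtain N where N: "\<forall>m\<ge>N. \<forall>n\<ge>N. nq (s m - s n) < d\<^sup>2" using cau[of "d\<^sup>2"] d by auto
      show "\<exists>M. \<forall>m\<ge>M. \<forall>n\<ge>M. dist (ev (s m) f) (ev (s n) f) < e"
        by (rule exI[of _ N]) (use dist[OF N[rule_format] f] d in \<open>auto simp: dist_norm intro: le_less_trans\<close>)
    qed
    then show ?thesis unfolding h_def using Cauchy_convergent convergent_LIMSEQ_iff by blast
  qed
  have h_al: "antilinear_on sc E h"
    unfolding antilinear_on_def
  proof (intro conjI ballI allI)
    note al = antilinear_simps[OF ev_antilinear[OF DU[OF s]]]
    fix x y c assume x: "x \<in> E"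
    have "(\<lambda>n. ev (s n) (sc c x)) \<longlonglongrightarrow> cnj c * h x" unfolding al(2)[OF x] by (intro tendsto_intros lim x)
    then show "h (sc c x) = cnj c * h x" using lim[of "sc c x"] x LIMSEQ_unique by blast
    assume y: "y \<in> E"
    have "(\<lambda>n. ev (s n) (x + y)) \<longlonglongrightarrow> h x + h y" unfolding al(1)[OF x y] by (intro tendsto_intros lim x y)
    then show "h (x + y) = h x + h y" using lim[of "x + y"] x y LIMSEQ_unique by blast
  qed
  have near: "bfun (\<lambda>f. ev (s n) f - h f) \<and> dualsq (\<lambda>f. ev (s n) f - h f) \<le> e"
    if N: "\<forall>m\<ge>N. \<forall>n\<ge>N. nq (s m - s n) < e" "n \<ge> N" "e > 0" for N n e
  proof (rule bfunI')
    show "antilinear_on sc E (\<lambda>f. ev (s n) f - h f)"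
      by (rule antilinear_lincomb(2)[OF ev_antilinear[OF DU[OF s]] h_al])
    fix f assume f: "f \<in> E"
    have "(\<lambda>m. cmod (ev (s n) f - ev (s m) f)) \<longlonglongrightarrow> cmod (ev (s n) f - h f)"
      by (intro tendsto_intros lim f)
    then show "cmod (ev (s n) f - h f) \<le> sqrt e * sqrt (q f)"
      by (rule LIMSEQ_le_const2) (use dist N f in \<open>auto intro!: exI[of _ N]\<close>)
  qed (use that in auto)
  obtain N where N: "\<forall>m\<ge>N. \<forall>n\<ge>N. nq (s m - s n) < 1" using cau[of 1] by auto
  \<comment> \<open>The limit is bounded as a bounded functional minus a bounded error.\<close>
  have "bfun (\<lambda>f. ev (s N) f - (ev (s N) f - h f))"
    by (rule bfun_diff[OF D_bfun[OF s]]) (use near[OF N] in auto)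
  then have h: "bfun h" by simp
  have nql: "nq (s n - rep h) = dualsq (\<lambda>f. ev (s n) f - h f)" for n
    unfolding D_diff[OF s rep_D(1)[OF h]] by (intro dualsq_cong) (simp add: rep_D(3)[OF h])
  have "\<exists>N. \<forall>n\<ge>N. nq (s n - rep h) < e" if "e > 0" for e
  proof -
    obtain N where N: "\<forall>m\<ge>N. \<forall>n\<ge>N. nq (s m - s n) < e / 2" using cau[of "e / 2"] \<open>e > 0\<close> by auto
    then have "\<forall>n\<ge>N. nq (s n - rep h) < e" using near[OF N] that by (force simp: nql)
    then show ?thesis by blast
  qed
  then show ?thesis using rep_D(1)[OF h] by blast
qed

end

section \<open>The Krein space dual to a saturated majorant\<close>

text \<open>By \<open>majorant_dual\<close> the last assumption is an equality, so \<open>kv\<close>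
  preserves norms just as \<open>rv\<close> does; the fundamental symmetry is the isometry that
  exchanges the two.\<close>

locale krein_dual = dual sc E scu U0 ev q
  for sc :: "complex \<Rightarrow> 'e::ab_group_add \<Rightarrow> 'e" and E
    and scu :: "complex \<Rightarrow> 'u::ab_group_add \<Rightarrow> 'u" and U0 and ev and q +
  fixes \<kappa> :: "'e \<Rightarrow> 'e \<Rightarrow> complex"
  assumes \<kappa>: "hform sc E \<kappa>" and \<kappa>_maj: "majorant \<kappa> q"
    and \<kappa>_sat: "f \<in> E \<Longrightarrow> q f \<le> dualsq (\<kappa> f)"
begin

definition kv :: "'e \<Rightarrow> 'u" where "kv g = rep (\<kappa> g)"

lemma kv: "g \<in> E \<Longrightarrow> kv g \<in> D" "g \<in> E \<Longrightarrow> nq (kv g) = q g" "g \<in> E \<Longrightarrow> f \<in> E \<Longrightarrow> ev (kv g) f = \<kappa> g f"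
  using rep_D[OF majorant_dual(1)[OF \<kappa> \<kappa>_maj]] majorant_dual(2)[OF \<kappa> \<kappa>_maj] \<kappa>_sat
  by (simp_all add: kv_def antisym)

lemma kv_add: "f \<in> E \<Longrightarrow> g \<in> E \<Longrightarrow> kv (f + g) = kv f + kv g"
  by (intro D_inject) (simp_all add: kv ev_add DU hform_simps(1)[OF \<kappa>])

lemma kv_scale: "g \<in> E \<Longrightarrow> kv (sc c g) = scu c (kv g)"
  by (intro D_inject) (simp_all add: kv ev_scu DU hform_simps(2)[OF \<kappa>])

lemma ip_kv: assumes "f \<in> E" "g \<in> E" shows "ip (kv f) (kv g) = polar f g"
proof (rule hform_eqI[OF _ polar_hform _ assms])
  show "hform sc E (\<lambda>f g. ip (kv f) (kv g))"
    unfolding hform_def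
    by (intro conjI ballI allI, simp_all add: kv kv_add kv_scale D.polar_simps(1,2))
      (simp add: D.polar_simps(3)[symmetric] kv)
  show "Re (ip (kv f) (kv f)) = Re (polar f f)" if "f \<in> E" for f
    using that by (simp add: D.polar_self polar_self kv)
qed

text \<open>Defined by duality, which gives it on all of \<open>D\<close> at once instead of
  extending \<open>rv g \<mapsto> kv g\<close> from a dense subspace.\<close>

definition J :: "'u \<Rightarrow> 'u" where "J u = rep (\<lambda>f. ip u (kv f))"

lemma J:
  assumes u: "u \<in> D"
  shows "J u \<in> D" "nq (J u) \<le> nq u" "f \<in> E \<Longrightarrow> ev (J u) f = ip u (kv f)"
proof -
  have "bfun (\<lambda>f. ip u (kv f)) \<and> dualsq (\<lambda>f. ip u (kv f)) \<le> nq u"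
    by (rule bfunI')
      (use u D.polar_bound[OF u kv(1)] in \<open>auto simp: antilinear_on_def kv kv_add kv_scale D.polar_simps(4,5) D.q_nonneg\<close>)
  then show "J u \<in> D" "nq (J u) \<le> nq u" "f \<in> E \<Longrightarrow> ev (J u) f = ip u (kv f)"
    using rep_D[of "\<lambda>f. ip u (kv f)"] by (auto simp: J_def)
qed

lemma J_add: "u \<in> D \<Longrightarrow> v \<in> D \<Longrightarrow> J (u + v) = J u + J v"
  by (intro D_inject) (simp_all add: J kv ev_add DU D.polar_simps(1))

lemma J_scale: "u \<in> D \<Longrightarrow> J (scu c u) = scu c (J u)"
  by (intro D_inject) (simp_all add: J kv ev_scu DU D.polar_simps(2))

lemma J_diff: "u \<in> D \<Longrightarrow> v \<in> D \<Longrightarrow> J (u - v) = J u - J v"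
  by (intro D_inject) (simp_all add: J kv ev_diff DU D.polar_simps(6))

lemma J_rv: "g \<in> E \<Longrightarrow> J (rv g) = kv g"
  by (intro D_inject) (simp_all add: J kv rv D.polar_simps(3)[of "kv _" "rv g"] ip_rv hform_simps(3)[OF \<kappa>, of _ g])

lemma J_kv: "g \<in> E \<Longrightarrow> J (kv g) = rv g"
  by (intro D_inject) (simp_all add: J kv rv ip_kv)

text \<open>The common form of the density arguments below; the approximants \<open>w\<close> come
  from \<open>rv_dense\<close> or \<open>kv_dense\<close>.\<close>

lemma continuous_functional_eq_0:
  assumes F: "\<And>v w. v \<in> D \<Longrightarrow> w \<in> D \<Longrightarrow> F (v - w) = (F v - F w :: complex)"
    and C: "\<And>v. v \<in> D \<Longrightarrow> cmod (F v) \<le> C * sqrt (nq v)"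
    and dense: "\<And>e. e > 0 \<Longrightarrow> \<exists>w\<in>D. nq (v - w) < e \<and> F w = 0"
    and v: "v \<in> D"
  shows "F v = 0"
proof (rule ccontr)
  assume "F v \<noteq> 0"
  define d where "d = cmod (F v) / (\<bar>C\<bar> + 1)"
  have d: "d > 0" "\<bar>C\<bar> * d < cmod (F v)" using \<open>F v \<noteq> 0\<close> by (auto simp: d_def field_simps)
  obtain w where w: "w \<in> D" "nq (v - w) < d\<^sup>2" "F w = 0" using dense[of "d\<^sup>2"] d by auto
  have "cmod (F v) = cmod (F (v - w))" using F v w by simp
  also have "\<dots> \<le> C * sqrt (nq (v - w))" using C v w by blast
  also have "\<dots> \<le> \<bar>C\<bar> * sqrt (nq (v - w))" using v w by (intro mult_right_mono) (auto simp: D.q_nonneg)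
  also have "\<dots> \<le> \<bar>C\<bar> * d" using w(2) d by (intro mult_left_mono real_le_lsqrt) auto
  finally show False using d by simp
qed

text \<open>For \<open>v = rv g\<close> both sides equal \<open>ip u (kv g)\<close>: the left one by
  the reproducing property and the definition of \<open>J\<close>, the right one by
  \<open>J_rv\<close>. Density of the vectors \<open>rv g\<close> does the rest.\<close>

lemma J_sym: assumes u: "u \<in> D" and v: "v \<in> D" shows "ip (J u) v = ip u (J v)"
proof -
  define F where "F v = cnj (ip (J u) v - ip u (J v))" for v
  have "F v = 0"
  proof (rule continuous_functional_eq_0[of F "2 * sqrt (nq u)"])
    fix v assume v: "v \<in> D"
    show "cmod (F v) \<le> 2 * sqrt (nq u) * sqrt (nq v)"
    proof -
      have "cmod (ip (J u) v) \<le> sqrt (nq (J u)) * sqrt (nq v)" using D.polar_bound J u v by blast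
      also have "\<dots> \<le> sqrt (nq u) * sqrt (nq v)"
        using J(2)[OF u] v by (intro mult_right_mono) (auto simp: D.q_nonneg)
      finally have 1: "cmod (ip (J u) v) \<le> sqrt (nq u) * sqrt (nq v)" .
      have "cmod (ip u (J v)) \<le> sqrt (nq u) * sqrt (nq (J v))" using D.polar_bound J u v by blast
      also have "\<dots> \<le> sqrt (nq u) * sqrt (nq v)"
        using J(2)[OF v] u by (intro mult_left_mono) (auto simp: D.q_nonneg)
      finally show ?thesis using 1 norm_triangle_ineq4[of "ip (J u) v" "ip u (J v)"] by (simp add: F_def del: complex_cnj_diff)
    qed
    fix w assume w: "w \<in> D"
    show "F (v - w) = F v - F w"
      using u v w by (simp add: F_def J_diff J D.polar_simps(7))
  next
    fix e :: real assume "e > 0"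
    then obtain g where "g \<in> E" "nq (v - rv g) < e" using rv_dense[OF v] by blast
    then show "\<exists>w\<in>D. nq (v - w) < e \<and> F w = 0"
      using u by (intro bexI[of _ "rv g"]) (auto simp: F_def ip_rv J J_rv rv)
  qed (rule v)
  then show ?thesis by (simp add: F_def)
qed

lemma J_J: "u \<in> D \<Longrightarrow> J (J u) = u"
  by (intro D_inject) (simp_all add: J kv J_sym J_kv ip_rv)

lemma nq_J: "u \<in> D \<Longrightarrow> nq (J u) = nq u"
  using J(2)[of "J u"] J(2)[of u] J(1)[of u] by (simp add: J_J antisym)

text \<open>\<open>J\<close> is an isometric involution taking \<open>rv g\<close> to
  \<open>kv g\<close>, so it transports \<open>rv_dense\<close>.\<close>

lemma kv_dense: assumes u: "u \<in> D" and e: "e > 0" obtains g where "g \<in> E" "nq (u - kv g) < e"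
proof -
  obtain g where g: "g \<in> E" "nq (J u - rv g) < e" using rv_dense[OF J(1)[OF u] e] .
  have "J (J u - rv g) = u - kv g" using u g by (simp add: J_diff J J_J J_rv rv)
  then have "nq (u - kv g) = nq (J u - rv g)" using nq_J[of "J u - rv g"] u g by (simp add: J rv)
  then show ?thesis using that g by simp
qed

definition kip :: "'u \<Rightarrow> 'u \<Rightarrow> complex" where "kip u v = ip (J u) v"

text \<open>For the indefinite product the reproducing vectors are the \<open>kv f\<close>. In
  particular \<open>kip (kv f) (kv g) = \<kappa> f g\<close>, the factorization asked of a
  Kolmogorov decomposition.\<close>

lemma kip_kv: "u \<in> D \<Longrightarrow> f \<in> E \<Longrightarrow> kip u (kv f) = ev u f"
  by (simp add: kip_def J_sym kv J_kv ip_rv)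

lemma kip_hform: "hform scu D kip"
  unfolding hform_def
  by (simp add: kip_def J J_add J_scale D.polar_simps(1,2)) (simp add: J J_sym D.polar_simps(3)[symmetric])

lemma kip_bound: "u \<in> D \<Longrightarrow> v \<in> D \<Longrightarrow> cmod (kip u v) \<le> sqrt (nq u) * sqrt (nq v)"
  using D.polar_bound[of "J u" v] by (simp add: kip_def J nq_J)

text \<open>The transpose of \<open>S\<close>: composition of functionals with \<open>S\<close> is
  defined on all of \<open>D\<close> and inherits the bound of \<open>S\<close>, so nothing has to
  be extended by continuity.\<close>

definition dop :: "('e \<Rightarrow> 'e) \<Rightarrow> 'u \<Rightarrow> 'u" where
  "dop S u = (if u \<in> D then rep (\<lambda>f. ev u (S f)) else 0)"

lemma dop:
  assumes S: "\<And>f. f \<in> E \<Longrightarrow> S f \<in> E" "\<And>f g. f \<in> E \<Longrightarrow> g \<in> E \<Longrightarrow> S (f + g) = S f + S g"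
      "\<And>f c. f \<in> E \<Longrightarrow> S (sc c f) = sc c (S f)"
    and C: "0 \<le> C" "\<And>f. f \<in> E \<Longrightarrow> q (S f) \<le> C * q f" and u: "u \<in> D"
  shows "dop S u \<in> D" "nq (dop S u) \<le> C * nq u" "f \<in> E \<Longrightarrow> ev (dop S u) f = ev u (S f)"
proof -
  note al = antilinear_simps[OF ev_antilinear[OF DU[OF u]]]
  have "bfun (\<lambda>f. ev u (S f)) \<and> dualsq (\<lambda>f. ev u (S f)) \<le> C * nq u"
  proof (rule bfunI')
    show "antilinear_on sc E (\<lambda>f. ev u (S f))" by (simp add: antilinear_on_def S al)
    fix f assume f: "f \<in> E"
    have "cmod (ev u (S f)) \<le> sqrt (nq u) * sqrt (q (S f))" using ev_bound u S(1) f by blast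
    also have "\<dots> \<le> sqrt (nq u) * sqrt (C * q f)" using C(2)[OF f] u by (intro mult_left_mono) (auto simp: D.q_nonneg)
    finally show "cmod (ev u (S f)) \<le> sqrt (C * nq u) * sqrt (q f)" by (simp add: real_sqrt_mult mult_ac)
  qed (use C u D.q_nonneg in simp)
  then show "dop S u \<in> D" "nq (dop S u) \<le> C * nq u" "f \<in> E \<Longrightarrow> ev (dop S u) f = ev u (S f)"
    using rep_D[of "\<lambda>f. ev u (S f)"] u by (auto simp: dop_def)
qed

end

section \<open>Krein spaces and bounded operators\<close>

lemma (in qform) metric_space:
  assumes pos: "\<And>x. x \<in> E \<Longrightarrow> q x = 0 \<Longrightarrow> x = 0" and off: "\<And>x. x \<notin> E \<Longrightarrow> q x = 0"
  shows "Metric_space E (\<lambda>x y. sqrt (q (x - y)))"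
proof
  fix x y z
  show "0 \<le> sqrt (q (x - y))" using q_nonneg off by (cases "x - y \<in> E") auto
  show "sqrt (q (x - y)) = sqrt (q (y - x))"
    using q_neg[of "x - y"] off[of "x - y"] off[of "y - x"] negE[of "x - y"] negE[of "y - x"]
    by (cases "x - y \<in> E") auto
  assume x: "x \<in> E" and y: "y \<in> E"
  show "(sqrt (q (x - y)) = 0) = (x = y)" using pos[of "x - y"] x y by auto
  assume z: "z \<in> E"
  show "sqrt (q (x - z)) \<le> sqrt (q (x - y)) + sqrt (q (y - z))"
    using triangle[of "x - y" "y - z"] x y z by simp
qed

text \<open>Squared distances are used so that \<open>D_complete\<close> applies directly.\<close>

definition (in qform) complete_form :: bool where
  "complete_form \<longleftrightarrow> (\<forall>s :: nat \<Rightarrow> 'e. (\<forall>n. s n \<in> E) \<longrightarrow>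
     (\<forall>e>0. \<exists>N. \<forall>m\<ge>N. \<forall>n\<ge>N. q (s m - s n) < e) \<longrightarrow> (\<exists>l\<in>E. \<forall>e>0. \<exists>N. \<forall>n\<ge>N. q (s n - l) < e))"

lemma (in qform) mcomplete_iff:
  assumes pos: "\<And>x. x \<in> E \<Longrightarrow> q x = 0 \<Longrightarrow> x = 0" and off: "\<And>x. x \<notin> E \<Longrightarrow> q x = 0"
  shows "Metric_space.mcomplete E (\<lambda>x y. sqrt (q (x - y))) \<longleftrightarrow> complete_form"
proof -
  interpret M: Metric_space E "\<lambda>x y. sqrt (q (x - y))" by (rule metric_space[OF assms])
  have lt: "(sqrt a < e) = (a < e\<^sup>2)" if "e > 0" for a e :: real
    using that real_sqrt_less_iff[of a "e\<^sup>2"] by simp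
  have cau: "(\<forall>e>0. \<exists>N. \<forall>m\<ge>N. \<forall>n\<ge>N. sqrt (q (s m - s n)) < e) \<longleftrightarrow>
     (\<forall>e>0. \<exists>N. \<forall>m\<ge>N. \<forall>n\<ge>N. q (s m - s n) < e)" (is "?L \<longleftrightarrow> ?R") for s :: "nat \<Rightarrow> 'e"
  proof
    assume L: ?L
    show ?R
    proof (intro allI impI)
      fix e :: real assume "e > 0"
      then show "\<exists>N. \<forall>m\<ge>N. \<forall>n\<ge>N. q (s m - s n) < e" using L[rule_format, of "sqrt e"] by simp
    qed
  next
    assume R: ?R
    show ?L using R[rule_format, of "_\<^sup>2"] by (simp add: lt)
  qed
  have lim: "(\<forall>e>0. \<exists>N. \<forall>n\<ge>N. sqrt (q (s n - l)) < e) \<longleftrightarrow>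
     (\<forall>e>0. \<exists>N. \<forall>n\<ge>N. q (s n - l) < e)" (is "?L \<longleftrightarrow> ?R") for s :: "nat \<Rightarrow> 'e" and l
  proof
    assume L: ?L
    show ?R
    proof (intro allI impI)
      fix e :: real assume "e > 0"
      then show "\<exists>N. \<forall>n\<ge>N. q (s n - l) < e" using L[rule_format, of "sqrt e"] by simp
    qed
  next
    assume R: ?R
    show ?L using R[rule_format, of "_\<^sup>2"] by (simp add: lt)
  qed
  have 1: "M.MCauchy s \<longleftrightarrow> (\<forall>n. s n \<in> E) \<and> (\<forall>e>0. \<exists>N. \<forall>m\<ge>N. \<forall>n\<ge>N. q (s m - s n) < e)" for s
    unfolding M.MCauchy_def cau[symmetric] by (auto simp: image_subset_iff)
  have 2: "limitin M.mtopology s l sequentially \<longleftrightarrow> l \<in> E \<and> (\<forall>e>0. \<exists>N. \<forall>n\<ge>N. q (s n - l) < e)"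
    if "\<forall>n. s n \<in> E" for s l
    unfolding M.limit_metric_sequentially lim[symmetric] using that by simp
  have 3: "(\<exists>l. limitin M.mtopology s l sequentially) \<longleftrightarrow> (\<exists>l\<in>E. \<forall>e>0. \<exists>N. \<forall>n\<ge>N. q (s n - l) < e)"
    if "\<forall>n. s n \<in> E" for s
    unfolding 2[OF that] Bex_def ..
  show ?thesis
    unfolding M.mcomplete_def complete_form_def 1 imp_conjL by (intro all_cong1 imp_cong refl 3)
qed

text \<open>\<open>polar\<close> maps \<open>E\<close> isometrically onto a dense subspace of its
  dual, so completeness of \<open>E\<close> makes it onto.\<close>

lemma (in qform) riesz:
  assumes complete: "complete_form" and pos: "\<And>x. x \<in> E \<Longrightarrow> q x = 0 \<Longrightarrow> x = 0" and u: "bfun u"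
  obtains z where "z \<in> E" "\<And>x. x \<in> E \<Longrightarrow> u x = polar z x" "q z = dualsq u"
proof -
  have "\<exists>g\<in>E. dualsq (\<lambda>f. u f - polar g f) < 1 / Suc n" for n
    using polar_dense[OF u, of "1 / Suc n"] by auto
  then obtain s where s: "\<And>n. s n \<in> E" "\<And>n. dualsq (\<lambda>f. u f - polar (s n) f) < 1 / Suc n" by metis
  have b: "bfun (\<lambda>f. u f - polar (s n) f)" for n using bfun_diff[OF u bfun_polar[OF s(1)]] .
  \<comment> \<open>Each of the two approximants contributes at most \<open>2 / Suc N\<close>
    through the parallelogram law, whence the 4.\<close>
  have d: "q (s m - s n) < 4 / Suc N" if "m \<ge> N" "n \<ge> N" for m n N
  proof -
    have "q (s m - s n) = dualsq (polar (s n - s m))"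
      using s q_diff_commute[of "s m" "s n"] by (simp add: dualsq_polar)
    also have "\<dots> = dualsq (\<lambda>f. (u f - polar (s m) f) - (u f - polar (s n) f))"
      using s by (intro dualsq_cong) (simp add: polar_simps(6))
    also have "\<dots> \<le> 2 * dualsq (\<lambda>f. u f - polar (s m) f) + 2 * dualsq (\<lambda>f. u f - polar (s n) f)"
      using dualsq_par[OF b b, of m n] dualsq_nonneg[OF bfun_add[OF b b], of m n] by linarith
    also have "\<dots> < 2 * (1 / Suc m) + 2 * (1 / Suc n)" using s(2)[of m] s(2)[of n] by linarith
    also have "\<dots> \<le> 2 * (1 / Suc N) + 2 * (1 / Suc N)"
      using that by (intro add_mono mult_left_mono divide_left_mono) auto
    finally show ?thesis by simp
  qed
  have small: "\<exists>N. 4 / Suc N < e" if "e > 0" for e :: real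
  proof -
    obtain N :: nat where "4 / e < N" using reals_Archimedean2 by blast
    then have "4 / Suc N < e" using that by (simp add: field_simps)
    then show ?thesis by blast
  qed
  have "\<forall>e>0. \<exists>N. \<forall>m\<ge>N. \<forall>n\<ge>N. q (s m - s n) < e"
    using d small by (meson less_trans)
  then obtain z where z: "z \<in> E" "\<forall>e>0. \<exists>N. \<forall>n\<ge>N. q (s n - z) < e"
    using complete[unfolded complete_form_def, rule_format, of s] s(1) by blast
  have *: "dualsq (\<lambda>f. u f - polar z f) = 0"
  proof (rule ccontr)
    have bz: "bfun (\<lambda>f. u f - polar z f)" using bfun_diff[OF u bfun_polar[OF z(1)]] .
    define e where "e = dualsq (\<lambda>f. u f - polar z f)"
    assume "dualsq (\<lambda>f. u f - polar z f) \<noteq> 0"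
    then have e: "e > 0" using dualsq_nonneg[OF bz] by (simp add: e_def)
    obtain N where N: "\<forall>n\<ge>N. q (s n - z) < e / 4" using z(2) e by (meson divide_pos_pos zero_less_numeral)
    obtain M where M: "4 / Suc M < e" using small[OF e] by blast
    let ?n = "max N M"
    have "e = dualsq (\<lambda>f. (u f - polar (s ?n) f) + polar (s ?n - z) f)"
      unfolding e_def using s z by (intro dualsq_cong) (simp add: polar_simps(6))
    also have "\<dots> \<le> 2 * dualsq (\<lambda>f. u f - polar (s ?n) f) + 2 * q (s ?n - z)"
      using dualsq_par[OF b bfun_polar, of "s ?n - z" ?n] dualsq_polar[of "s ?n - z"] s z
        dualsq_nonneg[OF bfun_diff[OF b bfun_polar, of "s ?n - z" ?n]] by simp
    also have "\<dots> < 2 * (1 / Suc ?n) + 2 * (e / 4)"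
      using s(2)[of ?n] N[rule_format, of ?n] by linarith
    also have "2 * (1 / Suc ?n) \<le> 2 * (1 / Suc M)" by (intro mult_left_mono divide_left_mono) auto
    finally show False using M by simp
  qed
  have eq: "u x = polar z x" if "x \<in> E" for x
    using dualsq_bound[OF bfun_diff[OF u bfun_polar[OF z(1)]] that] * by simp
  have "dualsq u = q z" using dualsq_polar[OF z(1)] dualsq_cong[of u "polar z"] eq by simp
  then show ?thesis using that z eq by simp
qed

lemma inner_product_on_hform: "inner_product_on H g \<longleftrightarrow> hform (kscale H) (kcarrier H) g"
  by (simp add: inner_product_on_def hform_def)

section \<open>Fundamental symmetries and the equivalence of their norms\<close>

locale fsym = cspace "kscale H" "kcarrier H" for H :: "'h::ab_group_add kspace" +
  fixes g J
  assumes fs: "fundamental_symmetry H g J" and kf: "inner_product_on H (kform H)"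
begin

lemma kform_hform: "hform (kscale H) (kcarrier H) (kform H)"
  using kf by (simp add: inner_product_on_hform)

lemma g_hform: "hform (kscale H) (kcarrier H) g"
  using fs by (simp add: fundamental_symmetry_def hilbert_product_on_def inner_product_on_hform)

lemma g_pos: "x \<in> kcarrier H \<Longrightarrow> x \<noteq> 0 \<Longrightarrow> 0 < Re (g x x)"
  using fs by (simp add: fundamental_symmetry_def hilbert_product_on_def)

lemma g_off: "x \<notin> kcarrier H \<Longrightarrow> g x x = 0"
  using fs by (simp add: fundamental_symmetry_def hilbert_product_on_def)

lemmas g_simps = hform_simps[OF g_hform]
lemmas kform_simps = hform_simps[OF kform_hform]

sublocale qform "kscale H" "kcarrier H" "\<lambda>x. Re (g x x)"
proof (rule hform_qform[OF g_hform])
  show "0 \<le> Re (g x x)" if "x \<in> kcarrier H" for x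
    using g_pos[OF that] g_simps(8)[OF that] by (cases "x = 0") auto
qed

lemma q_eq_0: "x \<in> kcarrier H \<Longrightarrow> Re (g x x) = 0 \<Longrightarrow> x = 0" using g_pos by force

lemma complete: "complete_form"
  using fs mcomplete_iff[OF q_eq_0] g_off by (auto simp: fundamental_symmetry_def hilbert_product_on_def)

lemma polar_g: "x \<in> kcarrier H \<Longrightarrow> y \<in> kcarrier H \<Longrightarrow> polar x y = g x y"
  by (rule hform_eqI[OF polar_hform g_hform]) (simp_all add: polar_self)

lemma g_bound: "x \<in> kcarrier H \<Longrightarrow> y \<in> kcarrier H \<Longrightarrow> cmod (g x y) \<le> sqrt (Re (g x x)) * sqrt (Re (g y y))"
  using polar_bound polar_g by simp

lemma J_closed[simp, intro]: "x \<in> kcarrier H \<Longrightarrow> J x \<in> kcarrier H"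
  and J_add: "x \<in> kcarrier H \<Longrightarrow> y \<in> kcarrier H \<Longrightarrow> J (x + y) = J x + J y"
  and J_scale: "x \<in> kcarrier H \<Longrightarrow> J (kscale H c x) = kscale H c (J x)"
  and J_J[simp]: "x \<in> kcarrier H \<Longrightarrow> J (J x) = x"
  and J_sym: "x \<in> kcarrier H \<Longrightarrow> y \<in> kcarrier H \<Longrightarrow> g (J x) y = g x (J y)"
  and kform_g: "x \<in> kcarrier H \<Longrightarrow> y \<in> kcarrier H \<Longrightarrow> kform H x y = g (J x) y"
  using fs by (auto simp: fundamental_symmetry_def linear_map_on_def)

lemma q_J: "x \<in> kcarrier H \<Longrightarrow> Re (g (J x) (J x)) = Re (g x x)"
  by (simp add: J_sym)

lemma kform_bound:
  "x \<in> kcarrier H \<Longrightarrow> y \<in> kcarrier H \<Longrightarrow> cmod (kform H x y) \<le> sqrt (Re (g x x)) * sqrt (Re (g y y))"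
  using g_bound[of "J x" y] by (simp add: kform_g q_J)

lemma kform_J: "x \<in> kcarrier H \<Longrightarrow> y \<in> kcarrier H \<Longrightarrow> kform H (J x) y = g x y"
  by (simp add: kform_g)

lemma nondegenerate:
  assumes "y \<in> kcarrier H" "y' \<in> kcarrier H" "\<And>x. x \<in> kcarrier H \<Longrightarrow> kform H x y = kform H x y'"
  shows "y = y'"
proof -
  have "g (y - y') (y - y') = 0"
    using assms(1,2) assms(3)[of "J (y - y')"] kform_J[of "y - y'" y] kform_J[of "y - y'" y']
    by (simp add: g_simps(7))
  then show ?thesis using q_eq_0[of "y - y'"] assms by simp
qed

text \<open>If \<open>z\<close> represents \<open>u\<close> for the Hilbert product, then
  \<open>J z\<close> represents it for the indefinite one and has the same norm.\<close>

lemma kform_riesz: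
  assumes "antilinear_on (kscale H) (kcarrier H) u" "0 \<le> C"
    and "\<And>x. x \<in> kcarrier H \<Longrightarrow> cmod (u x) \<le> C * sqrt (Re (g x x))"
  obtains z where "z \<in> kcarrier H" "\<And>x. x \<in> kcarrier H \<Longrightarrow> kform H z x = u x" "sqrt (Re (g z z)) \<le> C"
proof -
  have b: "bfun u \<and> dualsq u \<le> C\<^sup>2" using bfunI'[OF assms(1), of "C\<^sup>2"] assms by simp
  obtain z where z: "z \<in> kcarrier H" "\<And>x. x \<in> kcarrier H \<Longrightarrow> u x = polar z x" "Re (g z z) = dualsq u"
    using riesz[OF complete q_eq_0, of u] b by blast
  show ?thesis
  proof (rule that[of "J z"])
    show "sqrt (Re (g (J z) (J z))) \<le> C"
      using z b assms(2) by (auto simp: q_J intro: real_le_lsqrt)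
  qed (use z in \<open>auto simp: kform_J polar_g\<close>)
qed

end

lemma kscale_cspace: "krein_space H \<Longrightarrow> cspace (kscale H) (kcarrier H)"
  by (simp add: krein_space_def cspace_def cspace_axioms_def)

lemma fsymI: "krein_space H \<Longrightarrow> fundamental_symmetry H g J \<Longrightarrow> fsym H g J"
  by (simp add: fsym_def fsym_axioms_def kscale_cspace krein_space_def)

text \<open>The uniform boundedness principle, in the form of a gliding hump argument.\<close>

lemma fsym_norms_le:
  assumes "fsym H g1 J1" "fsym H g2 J2"
  obtains C where "C > 0" "\<And>x. x \<in> kcarrier H \<Longrightarrow> Re (g2 x x) \<le> C * Re (g1 x x)"
proof -
  interpret A: fsym H g1 J1 by fact
  interpret B: fsym H g2 J2 by fact
  let ?E = "kcarrier H"
  let ?n1 = "\<lambda>x. sqrt (Re (g1 x x))" and ?n2 = "\<lambda>x. sqrt (Re (g2 x x))"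
  have "\<exists>C>0. \<forall>x\<in>?E. Re (g2 x x) \<le> C * Re (g1 x x)"
  proof (rule ccontr)
    assume neg: "\<not> ?thesis"
    \<comment> \<open>The factor \<open>3 ^ n\<close> offsets the step length
      \<open>1 / 3 ^ n\<close> below, the 2 pays for the half of each hump that later steps may
      cancel, and \<open>Suc n\<close> is the growth that gives the contradiction.\<close>
    have "\<exists>y\<in>?E. 2 * real (Suc n) * 3 ^ n * ?n1 y < ?n2 y" for n
    proof -
      have "(2 * real (Suc n) * 3 ^ n)\<^sup>2 > 0" by simp
      then obtain y where y: "y \<in> ?E" "\<not> Re (g2 y y) \<le> (2 * real (Suc n) * 3 ^ n)\<^sup>2 * Re (g1 y y)"
        using neg by blast
      then have "sqrt ((2 * real (Suc n) * 3 ^ n)\<^sup>2 * Re (g1 y y)) < ?n2 y" by simp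
      then show ?thesis using y(1) by (auto simp: real_sqrt_mult)
    qed
    then obtain y where y: "\<And>n. y n \<in> ?E" "\<And>n. 2 * real (Suc n) * 3 ^ n * ?n1 (y n) < ?n2 (y n)" by metis
    have pos: "?n2 (y n) > 0" for n
    proof -
      have "0 \<le> 2 * real (Suc n) * 3 ^ n * ?n1 (y n)"
        using A.q_nonneg[OF y(1)] by (intro mult_nonneg_nonneg) auto
      then show ?thesis using y(2)[of n] by linarith
    qed
    \<comment> \<open>A norming vector: it has \<open>g2\<close>-norm 1, and its product with
      \<open>y n\<close> attains the bound of \<open>kform_bound\<close>.\<close>
    define z where "z n = kscale H (of_real (1 / ?n2 (y n))) (J2 (y n))" for n
    have z: "z n \<in> ?E" "?n2 (z n) = 1" "kform H (z n) (y n) = of_real (?n2 (y n))" for n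
    proof -
      show "z n \<in> ?E" using y by (simp add: z_def)
      have "Re (g2 (z n) (z n)) = 1"
        using y(1) pos[of n] B.q_nonneg[OF y(1)[of n]] by (simp add: z_def B.q_sc B.q_J norm_divide power_divide)
      then show "?n2 (z n) = 1" by simp
      show "kform H (z n) (y n) = of_real (?n2 (y n))"
        using y(1)[of n] A.hform_self[OF B.g_hform y(1)[of n]] pos[of n] B.q_nonneg[OF y(1)[of n]]
        by (simp add: z_def B.kform_simps(2) B.kform_J field_simps flip: of_real_mult)
    qed
    \<comment> \<open>The values at \<open>x + ?w\<close> and \<open>x - ?w\<close> differ by twice
      the hump, so one of the two signs keeps a full hump, whatever the earlier steps
      contributed.\<close>
    have step: "\<exists>x'. x' \<in> ?E \<and> ?n2 (x' - x) \<le> 1 / 3 ^ n \<and> ?n2 (y n) / 3 ^ n \<le> cmod (kform H x' (y n))"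
      if x: "x \<in> ?E" for x n
    proof -
      let ?w = "kscale H (of_real (1 / 3 ^ n)) (z n)"
      have w: "?w \<in> ?E" "?n2 ?w = 1 / 3 ^ n" "kform H ?w (y n) = of_real (?n2 (y n) / 3 ^ n)"
        using z y by (simp_all add: B.q_sc B.kform_simps(2) real_sqrt_mult norm_divide norm_power)
      have "2 * (?n2 (y n) / 3 ^ n) = cmod (kform H (x + ?w) (y n) - kform H (x - ?w) (y n))"
        using w(1,3) x y pos[of n] by (simp add: B.kform_simps(1,6) norm_mult norm_divide norm_power)
      also have "\<dots> \<le> cmod (kform H (x + ?w) (y n)) + cmod (kform H (x - ?w) (y n))"
        by (rule norm_triangle_ineq4)
      finally consider "?n2 (y n) / 3 ^ n \<le> cmod (kform H (x + ?w) (y n))" | "?n2 (y n) / 3 ^ n \<le> cmod (kform H (x - ?w) (y n))"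
        by linarith
      then show ?thesis
      proof cases
        case 1
        then show ?thesis using x w by (intro exI[of _ "x + ?w"]) auto
      next
        case 2
        moreover have "x - ?w - x = - ?w" by simp
        ultimately show ?thesis using x w B.q_neg[OF w(1)] by (intro exI[of _ "x - ?w"]) auto
      qed
    qed
    obtain x where x: "\<And>n. x n \<in> ?E" "\<And>n. ?n2 (x (Suc n) - x n) \<le> 1 / 3 ^ n"
      "\<And>n. ?n2 (y n) / 3 ^ n \<le> cmod (kform H (x (Suc n)) (y n))"
      using dependent_nat_choice[of "\<lambda>_ x. x \<in> ?E" "\<lambda>n x x'. ?n2 (x' - x) \<le> 1 / 3 ^ n \<and> ?n2 (y n) / 3 ^ n \<le> cmod (kform H x' (y n))"]
        step A.zeroE by blast
    \<comment> \<open>A geometric sum of ratio 1/3. From \<open>x (Suc n)\<close> on it leaves at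
      most half of \<open>1 / 3 ^ n\<close>.\<close>
    have tail: "?n2 (x (n + k) - x n) \<le> 3 / 2 * (1 / 3 ^ n)" for n k
    proof -
      have "?n2 (x (n + k) - x n) \<le> 3 / 2 * (1 / 3 ^ n - 1 / 3 ^ (n + k))"
      proof (induction k)
        case (Suc k)
        have "?n2 (x (n + Suc k) - x n) \<le> ?n2 (x (Suc (n + k)) - x (n + k)) + ?n2 (x (n + k) - x n)"
          using B.triangle[of "x (Suc (n + k)) - x (n + k)" "x (n + k) - x n"] x(1) by simp
        also have "\<dots> \<le> 1 / 3 ^ (n + k) + 3 / 2 * (1 / 3 ^ n - 1 / 3 ^ (n + k))"
          using Suc x(2)[of "n + k"] by linarith
        also have "\<dots> = 3 / 2 * (1 / 3 ^ n - 1 / 3 ^ (n + Suc k))"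
        proof -
          have *: "b = a / 3 \<Longrightarrow> a + 3 / 2 * (c - a) = 3 / 2 * (c - b)" for a b c :: real by (simp add: field_simps)
          show ?thesis by (rule *) simp
        qed
        finally show ?case .
      qed (simp add: B.g_simps(8))
      also have "\<dots> \<le> 3 / 2 * (1 / 3 ^ n)" by simp
      finally show ?thesis .
    qed
    have small: "\<exists>N. 3 / 2 * (1 / 3 ^ N) < e" if "e > 0" for e :: real
    proof -
      have "\<exists>N. (1 / 3) ^ N < e / 2" using that by (intro real_arch_pow_inv) auto
      then obtain N where "(1 / 3) ^ N < e / 2" by blast
      then have "3 / 2 * (1 / 3 ^ N) < e" using that by (simp add: power_divide)
      then show ?thesis by blast
    qed
    have "\<exists>N. \<forall>m\<ge>N. \<forall>n\<ge>N. Re (g2 (x m - x n) (x m - x n)) < e" if e: "e > 0" for e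
    proof -
      obtain N where N: "3 / 2 * (1 / 3 ^ N) < sqrt e / 2" using small[of "sqrt e / 2"] e by auto
      have "Re (g2 (x m - x n) (x m - x n)) < e" if mn: "m \<ge> N" "n \<ge> N" for m n
      proof -
        have t: "?n2 (x m - x N) \<le> 3 / 2 * (1 / 3 ^ N)" if "m \<ge> N" for m
          using tail[of N "m - N"] that by simp
        have "?n2 (x m - x n) \<le> ?n2 (x m - x N) + ?n2 (x N - x n)"
          using B.triangle[of "x m - x N" "x N - x n"] x(1) by simp
        also have "?n2 (x N - x n) = ?n2 (x n - x N)" using B.q_diff_commute x(1) by simp
        finally have "?n2 (x m - x n) < sqrt e"
          using t[OF mn(1)] t[OF mn(2)] N by linarith
        then show ?thesis by simp
      qed
      then show ?thesis by blast
    qed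
    then obtain l where l: "l \<in> ?E" "\<And>e. e > 0 \<Longrightarrow> \<exists>N. \<forall>n\<ge>N. Re (g2 (x n - l) (x n - l)) < e"
      using B.complete[unfolded B.complete_form_def, rule_format, of x] x(1) by blast
    have l_near: "?n2 (l - x n) \<le> 3 / 2 * (1 / 3 ^ n)" for n
    proof (rule field_le_epsilon)
      fix e :: real assume e: "e > 0"
      then obtain N where N: "\<forall>n\<ge>N. Re (g2 (x n - l) (x n - l)) < e\<^sup>2" using l(2)[of "e\<^sup>2"] by auto
      have "?n2 (l - x n) \<le> ?n2 (l - x (n + N)) + ?n2 (x (n + N) - x n)"
        using B.triangle[of "l - x (n + N)" "x (n + N) - x n"] x(1) l(1) by simp
      also have "?n2 (l - x (n + N)) = ?n2 (x (n + N) - l)" using B.q_diff_commute x(1) l(1) by simp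
      also have "\<dots> \<le> e" using N[rule_format, of "n + N"] e by (intro real_le_lsqrt) auto
      finally show "?n2 (l - x n) \<le> 3 / 2 * (1 / 3 ^ n) + e" using tail[of n N] by simp
    qed
    \<comment> \<open>Half of the hump at \<open>y n\<close> survives in the limit \<open>l\<close>,
      while the other symmetry bounds the same value by \<open>?n1 l * ?n1 (y n)\<close>; the choice
      of \<open>y n\<close> then pushes \<open>?n1 l\<close> above every integer.\<close>
    have "real (Suc n) \<le> ?n1 l" for n
    proof -
      have half_le: "d \<le> a / 2 \<Longrightarrow> a \<le> b \<Longrightarrow> b - d \<le> c \<Longrightarrow> a / 2 \<le> c" for a b c d :: real by linarith
      have "cmod (kform H (l - x (Suc n)) (y n)) \<le> ?n2 (l - x (Suc n)) * ?n2 (y n)"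
        using B.kform_bound l(1) x(1) y(1) by blast
      also have "\<dots> \<le> (1 / 2 * (1 / 3 ^ n)) * ?n2 (y n)"
        using l_near[of "Suc n"] pos[of n] by (intro mult_right_mono) auto
      finally have 1: "cmod (kform H (l - x (Suc n)) (y n)) \<le> ?n2 (y n) / 3 ^ n / 2" by simp
      have "kform H l (y n) = kform H (x (Suc n)) (y n) + kform H (l - x (Suc n)) (y n)"
        using l(1) x(1) y(1) by (simp add: B.kform_simps(6))
      then have "?n2 (y n) / 3 ^ n / 2 \<le> cmod (kform H l (y n))"
        using half_le[OF 1 x(3) norm_diff_ineq] by simp
      also have "\<dots> \<le> ?n1 l * ?n1 (y n)" using A.kform_bound l(1) y(1) by blast
      finally have "?n2 (y n) / 3 ^ n / 2 \<le> ?n1 l * ?n1 (y n)" .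
      moreover have "real (Suc n) * ?n1 (y n) < ?n2 (y n) / 3 ^ n / 2" using y(2)[of n] by (simp add: field_simps)
      ultimately have "real (Suc n) * ?n1 (y n) < ?n1 l * ?n1 (y n)" by linarith
      then show ?thesis using A.q_nonneg[OF y(1)[of n]] by (meson less_imp_le mult_less_cancel_right real_sqrt_ge_zero not_le)
    qed
    moreover obtain n where "?n1 l < real n" using reals_Archimedean2 by blast
    ultimately show False using of_nat_mono[of n "Suc n"] by (metis le_SucI le_refl not_less of_nat_mono order_less_le_trans)
  qed
  then show ?thesis using that by blast
qed

section \<open>Bounded operators and adjoints\<close>

text \<open>The same choice as in \<open>krein_norm\<close>, so that \<open>krein_norm_eq\<close> is
  a matter of unfolding.\<close>

definition kg :: "'h::ab_group_add kspace \<Rightarrow> 'h \<Rightarrow> 'h \<Rightarrow> complex" where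
  "kg H = (SOME g. \<exists>J. fundamental_symmetry H g J)"

definition kJ :: "'h::ab_group_add kspace \<Rightarrow> 'h \<Rightarrow> 'h" where
  "kJ H = (SOME J. fundamental_symmetry H (kg H) J)"

lemma krein_fsym: assumes "krein_space H" shows "fsym H (kg H) (kJ H)"
proof -
  have "\<exists>g J. fundamental_symmetry H g J" using assms by (simp add: krein_space_def)
  then have "\<exists>J. fundamental_symmetry H (kg H) J" unfolding kg_def by (rule someI_ex)
  then have "fundamental_symmetry H (kg H) (kJ H)" unfolding kJ_def by (rule someI_ex)
  then show ?thesis using fsymI assms by blast
qed

lemma krein_norm_eq: "krein_norm H x = sqrt (Re (kg H x x))"
  by (simp add: krein_norm_def kg_def)

lemma norm_equiv:
  assumes H: "krein_space H" and fs: "fundamental_symmetry H g J"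
  obtains C where "C > 0" "\<And>x. x \<in> kcarrier H \<Longrightarrow> krein_norm H x \<le> C * sqrt (Re (g x x))"
    "\<And>x. x \<in> kcarrier H \<Longrightarrow> sqrt (Re (g x x)) \<le> C * krein_norm H x"
proof -
  note f = fsymI[OF assms] krein_fsym[OF H]
  obtain C1 where C1: "C1 > 0" "\<And>x. x \<in> kcarrier H \<Longrightarrow> Re (g x x) \<le> C1 * Re (kg H x x)"
    using fsym_norms_le[OF f(2,1)] by blast
  obtain C2 where C2: "C2 > 0" "\<And>x. x \<in> kcarrier H \<Longrightarrow> Re (kg H x x) \<le> C2 * Re (g x x)"
    using fsym_norms_le[OF f(1,2)] by blast
  have n: "0 \<le> Re (g x x)" "0 \<le> Re (kg H x x)" if "x \<in> kcarrier H" for x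
  proof -
    interpret A: fsym H g J by fact
    interpret B: fsym H "kg H" "kJ H" by fact
    show "0 \<le> Re (g x x)" "0 \<le> Re (kg H x x)" using A.q_nonneg B.q_nonneg that by auto
  qed
  show ?thesis
  proof (rule that[of "sqrt (max C1 C2)"])
    fix x assume x: "x \<in> kcarrier H"
    have "Re (kg H x x) \<le> max C1 C2 * Re (g x x)"
      using C2(2)[OF x] mult_right_mono[of C2 "max C1 C2" "Re (g x x)"] n[OF x] by simp
    then show "krein_norm H x \<le> sqrt (max C1 C2) * sqrt (Re (g x x))"
      unfolding krein_norm_eq real_sqrt_mult[symmetric] by (rule real_sqrt_le_mono)
    have "Re (g x x) \<le> max C1 C2 * Re (kg H x x)"
      using C1(2)[OF x] mult_right_mono[of C1 "max C1 C2" "Re (kg H x x)"] n[OF x] by simp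
    then show "sqrt (Re (g x x)) \<le> sqrt (max C1 C2) * krein_norm H x"
      unfolding krein_norm_eq real_sqrt_mult[symmetric] by (rule real_sqrt_le_mono)
  qed (use C1 in simp)
qed

text \<open>\<open>bounded_ops\<close> refers to the chosen norms; by \<open>norm_equiv\<close> any
  fundamental symmetries will do, which serves a space that is built together with its own
  symmetry.\<close>

lemma bounded_opsI:
  assumes H: "krein_space H" and K: "krein_space K"
    and gH: "fundamental_symmetry H g J" and gK: "fundamental_symmetry K g' J'"
    and lin: "linear_map_on H K T" and off: "\<And>x. x \<notin> kcarrier H \<Longrightarrow> T x = 0"
    and C: "0 \<le> C" "\<And>x. x \<in> kcarrier H \<Longrightarrow> sqrt (Re (g' (T x) (T x))) \<le> C * sqrt (Re (g x x))"
  shows "T \<in> bounded_ops H K"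
proof -
  obtain A where A: "A > 0" "\<And>x. x \<in> kcarrier H \<Longrightarrow> sqrt (Re (g x x)) \<le> A * krein_norm H x"
    using norm_equiv[OF H gH] by metis
  obtain B where B: "B > 0" "\<And>x. x \<in> kcarrier K \<Longrightarrow> krein_norm K x \<le> B * sqrt (Re (g' x x))"
    using norm_equiv[OF K gK] by metis
  have "krein_norm K (T x) \<le> (B * (C * A)) * krein_norm H x" if x: "x \<in> kcarrier H" for x
  proof -
    have "krein_norm K (T x) \<le> B * sqrt (Re (g' (T x) (T x)))"
      using lin x B by (simp add: linear_map_on_def)
    also have "\<dots> \<le> B * (C * sqrt (Re (g x x)))" using C x B(1) by simp
    also have "\<dots> \<le> B * (C * (A * krein_norm H x))" using A x B(1) C(1) by (intro mult_left_mono) auto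
    finally show ?thesis by (simp add: mult_ac)
  qed
  then show ?thesis using lin off by (auto simp: bounded_ops_def)
qed

lemma bounded_ops_D:
  assumes "T \<in> bounded_ops H K"
  shows "x \<in> kcarrier H \<Longrightarrow> T x \<in> kcarrier K"
    and "x \<in> kcarrier H \<Longrightarrow> y \<in> kcarrier H \<Longrightarrow> T (x + y) = T x + T y"
    and "x \<in> kcarrier H \<Longrightarrow> T (kscale H c x) = kscale K c (T x)"
    and "x \<notin> kcarrier H \<Longrightarrow> T x = 0"
  using assms by (auto simp: bounded_ops_def linear_map_on_def)

lemma bounded_ops_bound:
  assumes "krein_space H" "T \<in> bounded_ops H K"
  obtains C where "C \<ge> 0" "\<And>x. x \<in> kcarrier H \<Longrightarrow> sqrt (Re (kg K (T x) (T x))) \<le> C * sqrt (Re (kg H x x))"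
proof -
  interpret fsym H "kg H" "kJ H" by (rule krein_fsym[OF assms(1)])
  obtain C where C: "\<And>x. x \<in> kcarrier H \<Longrightarrow> sqrt (Re (kg K (T x) (T x))) \<le> C * sqrt (Re (kg H x x))"
    using assms(2) unfolding bounded_ops_def krein_norm_eq by blast
  show ?thesis
  proof (rule that[of "\<bar>C\<bar>"])
    fix x assume x: "x \<in> kcarrier H"
    have "C * sqrt (Re (kg H x x)) \<le> \<bar>C\<bar> * sqrt (Re (kg H x x))"
      using q_nonneg[OF x] by (intro mult_right_mono) auto
    then show "sqrt (Re (kg K (T x) (T x))) \<le> \<bar>C\<bar> * sqrt (Re (kg H x x))" using C[OF x] by linarith
  qed simp
qed

lemma krein_adjoint_eqI:
  assumes H: "krein_space H" and "\<eta> \<in> kcarrier K" "\<zeta> \<in> kcarrier H"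
    and "\<And>\<xi>. \<xi> \<in> kcarrier H \<Longrightarrow> kform K (T \<xi>) \<eta> = kform H \<xi> \<zeta>"
  shows "krein_adjoint H K T \<eta> = \<zeta>"
proof -
  interpret fsym H "kg H" "kJ H" by (rule krein_fsym[OF H])
  show ?thesis
    unfolding krein_adjoint_def using assms by (auto intro!: the_equality nondegenerate)
qed

text \<open>Riesz in the second argument gives the values of \<open>T\<close>; uniqueness of the
  representing vectors makes \<open>T\<close> linear.\<close>

lemma sesquilinear_operator:
  assumes H: "krein_space H"
    and add: "\<And>x y z. x \<in> kcarrier H \<Longrightarrow> y \<in> kcarrier H \<Longrightarrow> z \<in> kcarrier H \<Longrightarrow> b (x + y) z = b x z + b y z"
    and scl: "\<And>c x z. x \<in> kcarrier H \<Longrightarrow> z \<in> kcarrier H \<Longrightarrow> b (kscale H c x) z = c * b x z"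
    and al: "\<And>x. x \<in> kcarrier H \<Longrightarrow> antilinear_on (kscale H) (kcarrier H) (b x)"
    and C: "0 \<le> C" "\<And>x z. x \<in> kcarrier H \<Longrightarrow> z \<in> kcarrier H \<Longrightarrow>
      cmod (b x z) \<le> C * sqrt (Re (kg H x x)) * sqrt (Re (kg H z z))"
  obtains T where "T \<in> bounded_ops H H" "\<And>x z. x \<in> kcarrier H \<Longrightarrow> z \<in> kcarrier H \<Longrightarrow> kform H (T x) z = b x z"
proof -
  interpret fsym H "kg H" "kJ H" by (rule krein_fsym[OF H])
  have "\<exists>t. t \<in> kcarrier H \<and> (\<forall>z\<in>kcarrier H. kform H t z = b x z) \<and> sqrt (Re (kg H t t)) \<le> C * sqrt (Re (kg H x x))"
    if x: "x \<in> kcarrier H" for x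
    using kform_riesz[OF al[OF x], of "C * sqrt (Re (kg H x x))"] C x q_nonneg by (metis mult_nonneg_nonneg real_sqrt_ge_zero)
  then obtain T0 where T0: "\<And>x. x \<in> kcarrier H \<Longrightarrow> T0 x \<in> kcarrier H"
    "\<And>x z. x \<in> kcarrier H \<Longrightarrow> z \<in> kcarrier H \<Longrightarrow> kform H (T0 x) z = b x z"
    "\<And>x. x \<in> kcarrier H \<Longrightarrow> sqrt (Re (kg H (T0 x) (T0 x))) \<le> C * sqrt (Re (kg H x x))"
    by metis
  define T where "T x = (if x \<in> kcarrier H then T0 x else 0)" for x
  have ex: "x = y" if "x \<in> kcarrier H" "y \<in> kcarrier H" "\<And>z. z \<in> kcarrier H \<Longrightarrow> kform H x z = kform H y z" for x y
    by (rule nondegenerate[OF that(1,2)]) (use that kform_simps(3) in metis)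
  have "linear_map_on H H T"
    unfolding linear_map_on_def
    by (auto intro!: ex simp: T_def T0 kform_simps(1,2) add scl)
  then have "T \<in> bounded_ops H H"
    by (rule bounded_opsI[OF H H fs fs, where C = C]) (auto simp: T_def T0 C)
  then show ?thesis using that[of T] by (simp add: T_def T0)
qed

lemma krein_adjoint:
  assumes H: "krein_space H" and K: "krein_space K" and T: "T \<in> bounded_ops H K"
    and y: "\<eta> \<in> kcarrier K"
  shows "krein_adjoint H K T \<eta> \<in> kcarrier H"
    and "\<xi> \<in> kcarrier H \<Longrightarrow> kform K (T \<xi>) \<eta> = kform H \<xi> (krein_adjoint H K T \<eta>)"
proof -
  interpret H: fsym H "kg H" "kJ H" by (rule krein_fsym[OF H])
  interpret K: fsym K "kg K" "kJ K" by (rule krein_fsym[OF K])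
  note T_D = bounded_ops_D[OF T]
  obtain C where C: "C \<ge> 0" "\<And>x. x \<in> kcarrier H \<Longrightarrow> sqrt (Re (kg K (T x) (T x))) \<le> C * sqrt (Re (kg H x x))"
    using bounded_ops_bound[OF H T] by blast
  have "antilinear_on (kscale H) (kcarrier H) (\<lambda>\<xi>. kform K \<eta> (T \<xi>))"
    using y by (simp add: antilinear_on_def T_D K.kform_simps(4,5))
  moreover have "cmod (kform K \<eta> (T \<xi>)) \<le> (sqrt (Re (kg K \<eta> \<eta>)) * C) * sqrt (Re (kg H \<xi> \<xi>))"
    if x: "\<xi> \<in> kcarrier H" for \<xi>
  proof -
    have "cmod (kform K \<eta> (T \<xi>)) \<le> sqrt (Re (kg K \<eta> \<eta>)) * sqrt (Re (kg K (T \<xi>) (T \<xi>)))"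
      using K.kform_bound y T_D(1)[OF x] by blast
    also have "\<dots> \<le> sqrt (Re (kg K \<eta> \<eta>)) * (C * sqrt (Re (kg H \<xi> \<xi>)))"
      using C(2)[OF x] K.q_nonneg[OF y] by (intro mult_left_mono) auto
    finally show ?thesis by (simp add: mult.assoc)
  qed
  ultimately obtain \<zeta> where z: "\<zeta> \<in> kcarrier H" "\<And>x. x \<in> kcarrier H \<Longrightarrow> kform H \<zeta> x = kform K \<eta> (T x)"
    using H.kform_riesz[of "\<lambda>\<xi>. kform K \<eta> (T \<xi>)" "sqrt (Re (kg K \<eta> \<eta>)) * C"] C(1) K.q_nonneg[OF y] by (metis mult_nonneg_nonneg real_sqrt_ge_zero)
  have z2: "kform K (T x) \<eta> = kform H x \<zeta>" if x: "x \<in> kcarrier H" for x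
    using z(2)[OF x] H.kform_simps(3)[OF z(1) x] K.kform_simps(3)[OF y T_D(1)[OF x]] by simp
  have "krein_adjoint H K T \<eta> = \<zeta>" using krein_adjoint_eqI[OF H y z(1) z2] .
  then show "krein_adjoint H K T \<eta> \<in> kcarrier H"
    and "\<xi> \<in> kcarrier H \<Longrightarrow> kform K (T \<xi>) \<eta> = kform H \<xi> (krein_adjoint H K T \<eta>)"
    using z z2 by auto
qed

section \<open>Kernels and finitely supported functions\<close>

lemma sum_fun_eval: "sum h A z = (\<Sum>x\<in>A. h x z)"
  by (induction A rule: infinite_finite_induct) auto

locale krein = fixes H :: "'h::ab_group_add kspace" assumes krein: "krein_space H"
begin

sublocale fsym H "kg H" "kJ H" by (rule krein_fsym[OF krein])

abbreviation F :: "('x \<Rightarrow> 'h) set" where "F \<equiv> fsupp_functions H"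

definition fsc :: "complex \<Rightarrow> ('x \<Rightarrow> 'h) \<Rightarrow> 'x \<Rightarrow> 'h" where
  "fsc c f = (\<lambda>x. kscale H c (f x))"

sublocale F: cspace fsc F
proof
  show "fsc a (x + y) = fsc a x + fsc a y" for a and x y :: "'x \<Rightarrow> 'h"
    by (simp add: fsc_def fun_eq_iff scale_right_distrib)
  show "fsc (a + b) x = fsc a x + fsc b x" for a b and x :: "'x \<Rightarrow> 'h"
    by (simp add: fsc_def fun_eq_iff scale_left_distrib)
  show "fsc a (fsc b x) = fsc (a * b) x" "fsc 1 x = x" for a b and x :: "'x \<Rightarrow> 'h"
    by (simp_all add: fsc_def)
  have *: "finite {x. (f + g) x \<noteq> 0}" if "finite {x. f x \<noteq> 0}" "finite {x. g x \<noteq> 0}" for f g :: "'x \<Rightarrow> 'h"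
    by (rule finite_subset[OF _ finite_UnI[OF that]]) auto
  have **: "finite {x. fsc c f x \<noteq> 0}" if "finite {x. f x \<noteq> 0}" for f :: "'x \<Rightarrow> 'h" and c
    by (rule finite_subset[OF _ that]) (auto simp: fsc_def)
  show "module.subspace fsc F"
    unfolding module.subspace_def[OF module.intro, OF \<open>\<And>a x y. fsc a (x + y) = fsc a x + fsc a y\<close>
      \<open>\<And>a b x. fsc (a + b) x = fsc a x + fsc b x\<close> \<open>\<And>a b x. fsc a (fsc b x) = fsc (a * b) x\<close> \<open>\<And>x. fsc 1 x = x\<close>]
    using * ** by (auto simp: fsupp_functions_def fsc_def image_subset_iff)
qed

lemma F_finite: "f \<in> F \<Longrightarrow> finite {x. f x \<noteq> 0}" and F_carrier[simp, intro]: "f \<in> F \<Longrightarrow> f x \<in> kcarrier H"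
  by (auto simp: fsupp_functions_def)

lemma delta_F[simp, intro]: "\<xi> \<in> kcarrier H \<Longrightarrow> delta_fun x \<xi> \<in> F"
  by (auto simp: fsupp_functions_def delta_fun_def intro: finite_subset[of _ "{x}"])

lemma delta_add: "delta_fun x (\<xi> + \<eta>) = delta_fun x \<xi> + (delta_fun x \<eta> :: _ \<Rightarrow> 'h)"
  by (auto simp: delta_fun_def)

lemma delta_scale: "delta_fun x (kscale H c \<xi>) = fsc c (delta_fun x \<xi>)"
  by (auto simp: delta_fun_def fsc_def)

lemma F_induct[consumes 1, case_names zero delta add]:
  assumes f: "f \<in> F" and 0: "P 0" and d: "\<And>x \<xi>. \<xi> \<in> kcarrier H \<Longrightarrow> P (delta_fun x \<xi>)"
    and a: "\<And>f g. f \<in> F \<Longrightarrow> g \<in> F \<Longrightarrow> P f \<Longrightarrow> P g \<Longrightarrow> P (f + g)"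
  shows "P f"
proof -
  have "\<forall>f\<in>F. {x. f x \<noteq> 0} \<subseteq> A \<longrightarrow> P f" if "finite A" for A
    using that
  proof (induction A rule: finite_induct)
    case empty
    have "f = 0" if "{x. f x \<noteq> 0} \<subseteq> {}" for f :: "'a \<Rightarrow> 'h" using that by auto
    then show ?case using 0 by blast
  next
    case (insert z A)
    show ?case
    proof (intro ballI impI)
      fix f assume f: "f \<in> F" "{x. f x \<noteq> 0} \<subseteq> insert z A"
      have "f = f(z := 0) + delta_fun z (f z)" by (auto simp: delta_fun_def)
      moreover have "f(z := 0) = f - delta_fun z (f z)" by (auto simp: delta_fun_def)
      moreover have "f(z := 0) \<in> F" unfolding calculation(2) using f(1) by auto
      moreover have "{x. (f(z := 0)) x \<noteq> 0} \<subseteq> A" using f(2) by auto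
      ultimately show "P f"
        using insert.IH a[of "f(z := 0)" "delta_fun z (f z)"] d[of "f z" z] f(1) by (metis F_carrier delta_F)
    qed
  qed
  then show ?thesis using F_finite[OF f] f by blast
qed

section \<open>Additive extension from point masses\<close>

text \<open>Functionals, shift maps and the sums of \<open>V x (f x)\<close> are all extensions of
  this kind.\<close>

definition fext :: "('x \<Rightarrow> 'h \<Rightarrow> 'b::ab_group_add) \<Rightarrow> ('x \<Rightarrow> 'h) \<Rightarrow> 'b" where
  "fext u f = (\<Sum>x | f x \<noteq> 0. u x (f x))"

lemma fext_sum:
  assumes "finite A" "{x. f x \<noteq> 0} \<subseteq> A" "\<And>x. u x 0 = 0"
  shows "fext u f = (\<Sum>x\<in>A. u x (f x))"
  unfolding fext_def using assms by (intro sum.mono_neutral_left) auto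

lemma fext_delta: assumes "\<And>x. u x 0 = 0" shows "fext u (delta_fun x \<xi>) = u x \<xi>"
  by (subst fext_sum[of "{x}"]) (auto simp: delta_fun_def assms split: if_splits)

lemma fext_add:
  assumes f: "f \<in> F" "g \<in> F"
    and u: "\<And>x \<xi> \<eta>. \<xi> \<in> kcarrier H \<Longrightarrow> \<eta> \<in> kcarrier H \<Longrightarrow> u x (\<xi> + \<eta>) = u x \<xi> + u x \<eta>"
  shows "fext u (f + g) = fext u f + fext u g"
proof -
  have u0: "u x 0 = 0" for x using u[of 0 0 x] by simp
  let ?A = "{x. f x \<noteq> 0} \<union> {x. g x \<noteq> 0}"
  have A: "finite ?A" using F_finite f by auto
  show ?thesis
  proof -
    have "{x. (f + g) x \<noteq> 0} \<subseteq> ?A" by auto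
    then show ?thesis
      using fext_sum[OF A Un_upper1, of u] fext_sum[OF A Un_upper2, of u] fext_sum[OF A, of "f + g" u] f u0
      by (simp add: u sum.distrib)
  qed
qed

text \<open>The additive map \<open>s\<close> covers both the linear case, scaling by
  \<open>c\<close>, and the antilinear one, multiplication by \<open>cnj c\<close>.\<close>

lemma fext_scale:
  assumes f: "f \<in> F"
    and u: "\<And>x. u x 0 = 0" "\<And>x \<xi>. \<xi> \<in> kcarrier H \<Longrightarrow> u x (kscale H c \<xi>) = s (u x \<xi>)"
    and s: "\<And>y z. s (y + z) = s y + s z"
  shows "fext u (fsc c f) = s (fext u f)"
proof -
  have s0: "s 0 = 0" using s[of 0 0] by simp
  have s_sum: "s (sum h A) = (\<Sum>x\<in>A. s (h x))" if "finite A" for h :: "'a \<Rightarrow> 'b" and A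
    using that by (induction A rule: finite_induct) (simp_all add: s0 s)
  have "fext u (fsc c f) = (\<Sum>x | f x \<noteq> 0. u x (kscale H c (f x)))"
    using fext_sum[OF F_finite[OF f], of "fsc c f" u] u(1) by (auto simp: fsc_def)
  also have "\<dots> = s (fext u f)" unfolding fext_def s_sum[OF F_finite[OF f]] using f by (intro sum.cong) (auto simp: u)
  finally show ?thesis .
qed

lemma fext_closed:
  assumes "f \<in> F" "0 \<in> B" "\<And>x y. x \<in> B \<Longrightarrow> y \<in> B \<Longrightarrow> x + y \<in> B" "\<And>x \<xi>. \<xi> \<in> kcarrier H \<Longrightarrow> u x \<xi> \<in> B"
  shows "fext u f \<in> B"
  unfolding fext_def using F_finite[OF assms(1)]
  by (induction rule: finite_induct) (use assms in auto)

section \<open>The form of a kernel\<close>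

lemma kernel_form_sum:
  assumes K: "\<And>x y. K x y \<in> bounded_ops H H" and f: "f \<in> F" and g: "g \<in> F"
    and A: "finite A" "{x. f x \<noteq> 0} \<subseteq> A" "finite B" "{x. g x \<noteq> 0} \<subseteq> B"
  shows "kernel_form H K f g = (\<Sum>x\<in>B. \<Sum>y\<in>A. kform H (K x y (f y)) (g x))"
proof -
  note KD = bounded_ops_D[OF K]
  have K0: "K x y 0 = 0" for x y using KD(2)[of 0 0 x y] by simp
  have "kernel_form H K f g = (\<Sum>x | g x \<noteq> 0. \<Sum>y\<in>A. kform H (K x y (f y)) (g x))"
    unfolding kernel_form_def using A g
    by (intro sum.cong refl sum.mono_neutral_left) (auto simp: K0 kform_simps(8))
  also have "\<dots> = (\<Sum>x\<in>B. \<Sum>y\<in>A. kform H (K x y (f y)) (g x))"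
    using A f by (intro sum.mono_neutral_left) (auto simp: KD kform_simps(9))
  finally show ?thesis .
qed

lemma kernel_form_delta:
  assumes K: "\<And>x y. K x y \<in> bounded_ops H H" and "\<xi> \<in> kcarrier H" "\<eta> \<in> kcarrier H"
  shows "kernel_form H K (delta_fun y \<eta>) (delta_fun x \<xi>) = kform H (K x y \<eta>) \<xi>"
proof -
  have "kernel_form H K (delta_fun y \<eta>) (delta_fun x \<xi>) =
      (\<Sum>x'\<in>{x}. \<Sum>y'\<in>{y}. kform H (K x' y' (delta_fun y \<eta> y')) (delta_fun x \<xi> x'))"
    by (rule kernel_form_sum[where K = K, OF K]) (use assms in auto, auto simp: delta_fun_def split: if_splits)
  then show ?thesis by (simp add: delta_fun_def)
qed

lemma kernel_form_lincomb:
  assumes A: "\<And>x y. A x y \<in> bounded_ops H H" and B: "\<And>x y. B x y \<in> bounded_ops H H" and f: "f \<in> F" and g: "g \<in> F"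
  shows "kernel_form H (A + B) f g = kernel_form H A f g + kernel_form H B f g"
    and "kernel_form H (A - B) f g = kernel_form H A f g - kernel_form H B f g"
    and "kernel_form H (- A) f g = - kernel_form H A f g"
  using f g by (simp_all add: kernel_form_def kform_simps(1,6,10) bounded_ops_D(1)[OF A] bounded_ops_D(1)[OF B]
      sum.distrib sum_subtractf sum_negf)

lemma hermitian_bounded: "hermitian_kernel H K \<Longrightarrow> K x y \<in> bounded_ops H H"
  unfolding hermitian_kernel_def by blast

lemma hermitian_kernel_kform:
  assumes K: "hermitian_kernel H K" and "\<xi> \<in> kcarrier H" "\<eta> \<in> kcarrier H"
  shows "kform H (K y x \<xi>) \<eta> = kform H \<xi> (K x y \<eta>)"
proof -
  have "K x y = krein_adjoint H H (K y x)" using K unfolding hermitian_kernel_def by blast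
  then show ?thesis using krein_adjoint(2)[OF krein krein hermitian_bounded[OF K] assms(3,2), of y x] by simp
qed

lemma hermitian_kernelI:
  assumes K: "\<And>x y. K x y \<in> bounded_ops H H"
    and herm: "\<And>x y \<xi> \<eta>. \<xi> \<in> kcarrier H \<Longrightarrow> \<eta> \<in> kcarrier H \<Longrightarrow> kform H (K y x \<xi>) \<eta> = kform H \<xi> (K x y \<eta>)"
  shows "hermitian_kernel H K"
proof -
  have "K x y \<eta> = krein_adjoint H H (K y x) \<eta>" for x y \<eta>
  proof (cases "\<eta> \<in> kcarrier H")
    case True
    then show ?thesis using krein_adjoint_eqI[OF krein True bounded_ops_D(1)[OF K True] herm] by metis
  qed (simp add: krein_adjoint_def bounded_ops_D(4)[OF K])
  then show ?thesis using K by (auto simp: hermitian_kernel_def fun_eq_iff)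
qed

lemma kernel_form_hform:
  assumes K: "hermitian_kernel H K"
  shows "hform fsc F (kernel_form H K)"
  unfolding hform_def
proof (intro conjI ballI allI)
  note Kb = hermitian_bounded[OF K] note KD = bounded_ops_D[OF Kb]
  fix f g :: "'a \<Rightarrow> 'h" assume f: "f \<in> F" and g: "g \<in> F"
  let ?A = "{x. f x \<noteq> 0} \<union> {x. g x \<noteq> 0}"
  have A: "finite ?A" using F_finite f g by auto
  show "kernel_form H K g f = cnj (kernel_form H K f g)"
  proof -
    have "kernel_form H K g f = (\<Sum>x\<in>?A. \<Sum>y\<in>?A. kform H (K x y (g y)) (f x))"
      by (rule kernel_form_sum[OF Kb g f A _ A]) auto
    also have "\<dots> = (\<Sum>y\<in>?A. \<Sum>x\<in>?A. cnj (kform H (K y x (f x)) (g y)))"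
    proof (subst sum.swap, intro sum.cong refl)
      fix x y
      show "kform H (K x y (g y)) (f x) = cnj (kform H (K y x (f x)) (g y))"
        unfolding hermitian_kernel_kform[OF K F_carrier[OF g] F_carrier[OF f]]
        using kform_simps(3)[of "K y x (f x)" "g y"] f g KD(1) by blast
    qed
    also have "\<dots> = cnj (kernel_form H K f g)"
      unfolding kernel_form_sum[OF Kb f g A Un_upper1 A Un_upper2] by simp
    finally show ?thesis .
  qed
  show "kernel_form H K (fsc c f) g = c * kernel_form H K f g" for c
  proof -
    have cf: "fsc c f \<in> F" "{x. fsc c f x \<noteq> 0} \<subseteq> ?A" using f by (blast, auto simp: fsc_def)
    show ?thesis
      unfolding kernel_form_sum[OF Kb f g A Un_upper1 A Un_upper2] kernel_form_sum[OF Kb cf(1) g A cf(2) A Un_upper2]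
      using f g by (simp add: fsc_def KD kform_simps(2) sum_distrib_left)
  qed
  fix h :: "'a \<Rightarrow> 'h" assume h: "h \<in> F"
  let ?B = "{x. h x \<noteq> 0}"
  have B: "finite ?B" using F_finite h by auto
  show "kernel_form H K (f + g) h = kernel_form H K f h + kernel_form H K g h"
    unfolding kernel_form_sum[OF Kb f h A Un_upper1 B order_refl] kernel_form_sum[OF Kb g h A Un_upper2 B order_refl]
    by (subst kernel_form_sum[OF Kb F.addE[OF f g] h A _ B order_refl])
      (use f g h in \<open>auto simp: KD kform_simps(1) sum.distrib\<close>)
qed

text \<open>Polarization makes the whole form vanish; point masses and nondegeneracy then recover
  the entries of \<open>P\<close>.\<close>

lemma kernel_form_diag_eq_0:
  fixes P :: "('x, 'h) kernel"
  assumes P: "hermitian_kernel H P" and 0: "\<And>f. f \<in> F \<Longrightarrow> Re (kernel_form H P f f) = 0"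
  shows "P = 0"
proof (intro ext)
  fix x y \<eta>
  note Pb = hermitian_bounded[OF P] note PD = bounded_ops_D[OF Pb]
  have h0: "hform fsc F (\<lambda>f g. 0 :: complex)" by (simp add: hform_def)
  then have form0: "kernel_form H P f g = 0" if "f \<in> F" "g \<in> F" for f g
    using F.hform_eqI[OF kernel_form_hform[OF P] h0 _ that] 0 by simp
  show "P x y \<eta> = 0 x y \<eta>"
  proof (cases "\<eta> \<in> kcarrier H")
    case True
    have "kform H \<xi> (P x y \<eta>) = kform H \<xi> 0" if "\<xi> \<in> kcarrier H" for \<xi>
      using form0[of "delta_fun y \<eta>" "delta_fun x \<xi>"] kernel_form_delta[where K = P, OF Pb that True] True that
        kform_simps(3)[of "P x y \<eta>" \<xi>] PD(1) by (auto simp: kform_simps(9))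
    then show ?thesis using nondegenerate[of "P x y \<eta>" 0] PD(1) True by simp
  qed (simp add: PD(4))
qed

lemma shift_map_fext:
  "shift_map H \<phi> \<alpha> a f = fext (\<lambda>x \<xi>. delta_fun (\<phi> a x) (kscale H (inverse (\<alpha> a x)) \<xi>)) f"
proof -
  show ?thesis by (auto simp: shift_map_def fext_def delta_fun_def fun_eq_iff sum_fun_eval if_distrib cong: if_cong)
qed

lemma shift_map_F: "f \<in> F \<Longrightarrow> shift_map H \<phi> \<alpha> a f \<in> F"
  unfolding shift_map_fext by (rule fext_closed) auto

lemma shift_map_add:
  "f \<in> F \<Longrightarrow> g \<in> F \<Longrightarrow> shift_map H \<phi> \<alpha> a (f + g) = shift_map H \<phi> \<alpha> a f + shift_map H \<phi> \<alpha> a g"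
  unfolding shift_map_fext by (rule fext_add) (simp_all add: scale_right_distrib delta_add)

lemma delta_0[simp]: "delta_fun x (0 :: 'h) = 0" by (auto simp: delta_fun_def)

lemma shift_map_scale:
  "f \<in> F \<Longrightarrow> shift_map H \<phi> \<alpha> a (fsc c f) = fsc c (shift_map H \<phi> \<alpha> a f)"
  unfolding shift_map_fext
  by (rule fext_scale[where s = "fsc c"])
    (auto simp: fun_eq_iff fsc_def delta_fun_def scale_right_distrib mult.commute)

lemma shift_map_0: "shift_map H \<phi> \<alpha> a 0 = 0" by (auto simp: shift_map_def)

lemma shift_map_delta':
  "shift_map H \<phi> \<alpha> a (delta_fun x \<xi>) = delta_fun (\<phi> a x) (kscale H (inverse (\<alpha> a x)) \<xi>)"
  unfolding shift_map_fext by (rule fext_delta) simp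

section \<open>Functionals on finitely supported functions\<close>

text \<open>An antilinear functional on finitely supported functions is determined by its
  restrictions to the copies of \<open>H\<close>, so the dual fits into the ambient type used in
  assertion (2). The value 0 off the carrier makes the representation unique.\<close>

definition functionals :: "('x \<Rightarrow> 'h \<Rightarrow> complex) set" where
  "functionals = {u. \<forall>x. antilinear_on (kscale H) (kcarrier H) (u x) \<and> (\<forall>\<xi>. \<xi> \<notin> kcarrier H \<longrightarrow> u x \<xi> = 0)}"

definition usc :: "complex \<Rightarrow> ('x \<Rightarrow> 'h \<Rightarrow> complex) \<Rightarrow> 'x \<Rightarrow> 'h \<Rightarrow> complex" where
  "usc c u = (\<lambda>x \<xi>. c * u x \<xi>)"

lemma functionals_D:
  assumes "u \<in> functionals"
  shows "\<xi> \<in> kcarrier H \<Longrightarrow> \<eta> \<in> kcarrier H \<Longrightarrow> u x (\<xi> + \<eta>) = u x \<xi> + u x \<eta>"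
    and "\<xi> \<in> kcarrier H \<Longrightarrow> u x (kscale H c \<xi>) = cnj c * u x \<xi>"
    and "u x 0 = 0" and "\<xi> \<notin> kcarrier H \<Longrightarrow> u x \<xi> = 0"
proof -
  have "antilinear_on (kscale H) (kcarrier H) (u x)" "\<xi> \<notin> kcarrier H \<Longrightarrow> u x \<xi> = 0"
    using assms by (auto simp: functionals_def)
  then show "\<xi> \<in> kcarrier H \<Longrightarrow> \<eta> \<in> kcarrier H \<Longrightarrow> u x (\<xi> + \<eta>) = u x \<xi> + u x \<eta>"
    and "\<xi> \<in> kcarrier H \<Longrightarrow> u x (kscale H c \<xi>) = cnj c * u x \<xi>"
    and "u x 0 = 0" and "\<xi> \<notin> kcarrier H \<Longrightarrow> u x \<xi> = 0"
    by (auto simp: antilinear_simps)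
qed

sublocale P: pairing fsc F usc functionals fext
proof
  show "usc a (x + y) = usc a x + usc a y" for a and x y :: "'x \<Rightarrow> 'h \<Rightarrow> complex"
    by (simp add: usc_def fun_eq_iff algebra_simps)
  show "usc (a + b) x = usc a x + usc b x" for a b and x :: "'x \<Rightarrow> 'h \<Rightarrow> complex"
    by (simp add: usc_def fun_eq_iff algebra_simps)
  show "usc a (usc b x) = usc (a * b) x" "usc 1 x = x" for a b and x :: "'x \<Rightarrow> 'h \<Rightarrow> complex"
    by (simp_all add: usc_def mult.assoc)
  show "module.subspace usc functionals"
    unfolding module.subspace_def[OF module.intro, OF \<open>\<And>a x y. usc a (x + y) = usc a x + usc a y\<close>
      \<open>\<And>a b x. usc (a + b) x = usc a x + usc b x\<close> \<open>\<And>a b x. usc a (usc b x) = usc (a * b) x\<close> \<open>\<And>x. usc 1 x = x\<close>]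
    by (auto simp: functionals_def usc_def antilinear_on_def algebra_simps)
  fix u :: "'x \<Rightarrow> 'h \<Rightarrow> complex" assume u: "u \<in> functionals"
  note uD = functionals_D[OF u]
  show "antilinear_on fsc F (fext u)"
    unfolding antilinear_on_def
    by (auto intro!: fext_add[where u = u] fext_scale[where u = u] simp: uD algebra_simps)
  show "fext (usc c u) f = c * fext u f" for c f
    by (simp add: fext_def usc_def sum_distrib_left)
  show "fext (u + v) f = fext u f + fext v f" for v f
    by (simp add: fext_def sum.distrib)
  show "u = 0" if 0: "\<And>f. f \<in> F \<Longrightarrow> fext u f = 0"
  proof (intro ext)
    fix x \<xi>
    show "u x \<xi> = 0 x \<xi>"
      using 0[of "delta_fun x \<xi>"] fext_delta[of u x \<xi>] uD by (cases "\<xi> \<in> kcarrier H") auto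
  qed
next
  fix h :: "('x \<Rightarrow> 'h) \<Rightarrow> complex" assume h: "antilinear_on fsc F h"
  note hD = F.antilinear_simps[OF h]
  define u where "u x \<xi> = (if \<xi> \<in> kcarrier H then h (delta_fun x \<xi>) else 0)" for x \<xi>
  have u: "u \<in> functionals"
    by (auto simp: functionals_def u_def antilinear_on_def delta_add delta_scale hD)
  note uD = functionals_D[OF u]
  have "fext u f = h f" if "f \<in> F" for f
    using that
  proof (induction rule: F_induct)
    case zero
    show ?case using hD(3) by (simp add: fext_def zero_fun_def)
  next
    case (delta x \<xi>)
    have "fext u (delta_fun x \<xi>) = u x \<xi>" by (rule fext_delta) (rule uD)
    also have "u x \<xi> = h (delta_fun x \<xi>)" using delta by (simp add: u_def)
    finally show ?case .
  next
    case (add f g)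
    then show ?case by (subst fext_add) (simp_all add: uD hD)
  qed
  then show "\<exists>u\<in>functionals. \<forall>f\<in>F. fext u f = h f" using u by blast
qed

end

section \<open>From a dominating kernel to an invariant decomposition\<close>

lemma krein_topology_closure:
  assumes K: "krein_space K"
  shows "krein_topology K closure_of S =
    {x \<in> kcarrier K. \<forall>e>0. \<exists>y\<in>S. y \<in> kcarrier K \<and> krein_norm K (x - y) < e}"
proof -
  interpret fsym K "kg K" "kJ K" by (rule krein_fsym[OF K])
  interpret Metric_space "kcarrier K" "\<lambda>x y. krein_norm K (x - y)"
    unfolding krein_norm_eq by (rule metric_space[OF q_eq_0]) (auto simp: g_off)
  show ?thesis unfolding krein_topology_def metric_closure_of by auto
qed

section \<open>Operators on the dual Krein space\<close>

context krein_dual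
begin

definition KS :: "'u kspace" where
  "KS = \<lparr>kscale = scu, kcarrier = D, kform = kip\<rparr>"

text \<open>\<open>hilbert_product_on\<close> prescribes the value 0 off the carrier, which
  \<open>ip\<close> does not guarantee.\<close>

definition gip :: "'u \<Rightarrow> 'u \<Rightarrow> complex" where
  "gip u v = (if u \<in> D \<and> v \<in> D then ip u v else 0)"

lemma gip_self: "u \<in> D \<Longrightarrow> Re (gip u u) = nq u"
  by (simp add: gip_def D.polar_self)

lemma KS_sel[simp]: "kscale KS = scu" "kcarrier KS = D" "kform KS = kip"
  by (simp_all add: KS_def)

lemma KS_symmetry: "fundamental_symmetry KS gip J"
proof -
  have h: "hform scu D gip"
    unfolding hform_def
    by (simp add: gip_def D.polar_simps(1,2)) (simp add: D.polar_simps(3)[symmetric])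
  interpret G: qform scu D "\<lambda>u. Re (gip u u)"
    by (rule D.hform_qform[OF h]) (simp add: gip_self D.q_nonneg)
  have "G.complete_form"
    unfolding G.complete_form_def
  proof (intro allI impI)
    fix s :: "nat \<Rightarrow> 'u"
    assume s: "\<forall>n. s n \<in> D" and "\<forall>e>0. \<exists>N. \<forall>m\<ge>N. \<forall>n\<ge>N. Re (gip (s m - s n) (s m - s n)) < e"
    then have "\<exists>l\<in>D. \<forall>e>0. \<exists>N. \<forall>n\<ge>N. nq (s n - l) < e"
      by (intro D_complete) (auto simp: gip_self)
    then show "\<exists>l\<in>D. \<forall>e>0. \<exists>N. \<forall>n\<ge>N. Re (gip (s n - l) (s n - l)) < e"
      using s by (auto simp: gip_self)
  qed
  then have "Metric_space.mcomplete D (\<lambda>x y. sqrt (Re (gip (x - y) (x - y))))"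
    by (subst G.mcomplete_iff) (use nq_eq_0 in \<open>auto simp: gip_self, auto simp: gip_def\<close>)
  moreover have "0 < nq u" if "u \<in> D" "u \<noteq> 0" for u
    using D.q_nonneg[OF that(1)] nq_eq_0[OF that(1)] that(2) by linarith
  ultimately have "hilbert_product_on KS gip"
    using h by (auto simp: hilbert_product_on_def inner_product_on_hform gip_self, auto simp: gip_def)
  then show ?thesis
    unfolding fundamental_symmetry_def linear_map_on_def
    by (auto simp: J J_add J_scale J_J J_sym gip_def kip_def)
qed

lemma KS_krein: "krein_space KS"
  unfolding krein_space_def
  using KS_symmetry U.vector_space_axioms D.subE kip_hform by (auto simp: inner_product_on_hform)

text \<open>Evaluating both operators at \<open>f\<close> reduces the comparison to scalar
  functionals that agree on the dense set of vectors \<open>kv g\<close>.\<close>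

lemma operator_eqI:
  assumes W: "\<And>v. v \<in> D \<Longrightarrow> W v \<in> D" "\<And>v w. v \<in> D \<Longrightarrow> w \<in> D \<Longrightarrow> W (v - w) = W v - W w"
      "\<And>v. v \<in> D \<Longrightarrow> nq (W v) \<le> C * nq v"
    and W': "\<And>v. v \<in> D \<Longrightarrow> W' v \<in> D" "\<And>v w. v \<in> D \<Longrightarrow> w \<in> D \<Longrightarrow> W' (v - w) = W' v - W' w"
      "\<And>v. v \<in> D \<Longrightarrow> nq (W' v) \<le> C' * nq v"
    and eq: "\<And>f. f \<in> E \<Longrightarrow> W (kv f) = W' (kv f)" and v: "v \<in> D"
  shows "W v = W' v"
proof (rule D_inject)
  fix f assume f: "f \<in> E"
  define T where "T v = ev (W v) f - ev (W' v) f" for v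
  have bd: "cmod (ev w f) \<le> sqrt C * sqrt (q f) * sqrt (nq v)"
    if "v \<in> D" "w \<in> D" "nq w \<le> C * nq v" for v w C
  proof -
    have "cmod (ev w f) \<le> sqrt (nq w) * sqrt (q f)" using ev_bound that f by blast
    also have "\<dots> \<le> sqrt (C * nq v) * sqrt (q f)" using that q_nonneg f by (intro mult_right_mono) auto
    finally show ?thesis by (simp add: real_sqrt_mult mult_ac)
  qed
  have "T v = 0"
  proof (rule continuous_functional_eq_0[OF _ _ _ v])
    fix v assume v: "v \<in> D"
    show "cmod (T v) \<le> (sqrt C * sqrt (q f) + sqrt C' * sqrt (q f)) * sqrt (nq v)"
      using bd[OF v W(1,3)[OF v]] bd[OF v W'(1,3)[OF v]] norm_triangle_ineq4[of "ev (W v) f" "ev (W' v) f"]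
      by (simp add: T_def distrib_right)
    show "T (v - w) = T v - T w" if "w \<in> D" for w
      using v that f by (simp add: T_def W W' ev_diff DU)
  next
    fix e :: real assume "e > 0"
    then obtain g where "g \<in> E" "nq (v - kv g) < e" using kv_dense[OF v] by blast
    then show "\<exists>w\<in>D. nq (v - w) < e \<and> T w = 0"
      using eq by (intro bexI[of _ "kv g"]) (auto simp: T_def kv)
  qed
  then show "ev (W v) f = ev (W' v) f" by (simp add: T_def)
qed (use v W W' in auto)

definition bop :: "('e \<Rightarrow> 'e) \<Rightarrow> real \<Rightarrow> bool" where
  "bop S C \<longleftrightarrow> (\<forall>f\<in>E. S f \<in> E) \<and> (\<forall>f\<in>E. \<forall>g\<in>E. S (f + g) = S f + S g) \<and>
     (\<forall>f\<in>E. \<forall>c. S (sc c f) = sc c (S f)) \<and> 0 \<le> C \<and> (\<forall>f\<in>E. q (S f) \<le> C * q f)"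

lemma bop_dop:
  assumes S: "bop S C" and u: "u \<in> D"
  shows "dop S u \<in> D" "nq (dop S u) \<le> C * nq u" "f \<in> E \<Longrightarrow> ev (dop S u) f = ev u (S f)"
    "0 \<le> C"
  using dop[of S C u] S u by (auto simp: bop_def)

lemma dop_linear:
  assumes S: "bop S C" and u: "u \<in> D" and v: "v \<in> D"
  shows "dop S (u + v) = dop S u + dop S v" "dop S (u - v) = dop S u - dop S v"
    "dop S (scu c u) = scu c (dop S u)" "dop S 0 = 0"
proof -
  have SE: "f \<in> E \<Longrightarrow> S f \<in> E" for f using S by (simp add: bop_def)
  note b = bop_dop[OF S]
  show "dop S (u + v) = dop S u + dop S v" "dop S (u - v) = dop S u - dop S v"
    "dop S (scu c u) = scu c (dop S u)"
    by (rule D_inject; use u v in \<open>simp add: b ev_add ev_diff ev_scu DU SE\<close>)+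
  have "dop S (scu 0 u) = scu 0 (dop S u)"
    by (rule D_inject; use u v in \<open>simp add: b ev_add ev_diff ev_scu DU SE del: U.scale_zero_left\<close>)
  then show "dop S 0 = 0" by simp
qed

lemma dop_bounded_ops: assumes S: "bop S C" shows "dop S \<in> bounded_ops KS KS"
proof (rule bounded_opsI[OF KS_krein KS_krein KS_symmetry KS_symmetry])
  show "linear_map_on KS KS (dop S)"
    using bop_dop[OF S] dop_linear[OF S] by (auto simp: linear_map_on_def)
  show "dop S x = 0" if "x \<notin> kcarrier KS" for x using that by (simp add: dop_def)
  show "0 \<le> sqrt C" using S by (simp add: bop_def)
  show "sqrt (Re (gip (dop S x) (dop S x))) \<le> sqrt C * sqrt (Re (gip x x))" if "x \<in> kcarrier KS" for x
    using that bop_dop[OF S, of x] by (simp add: gip_self flip: real_sqrt_mult)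
qed

text \<open>At \<open>g\<close> the functional \<open>dop T (kv f)\<close> has the value
  \<open>\<kappa> f (T g) = \<kappa> (S f) g\<close>, so the transpose of \<open>T\<close> acts on
  the vectors \<open>kv f\<close> as \<open>S\<close>. The adjoint relation holds for these vectors
  and extends by density.\<close>

lemma dop_adjoint:
  assumes S: "bop S C" and T: "bop T C'"
    and adj: "\<And>f g. f \<in> E \<Longrightarrow> g \<in> E \<Longrightarrow> \<kappa> (S f) g = \<kappa> f (T g)"
  shows "f \<in> E \<Longrightarrow> dop T (kv f) = kv (S f)"
    and "krein_adjoint KS KS (dop S) = dop T"
proof -
  note S_D = bop_dop[OF S] note T_D = bop_dop[OF T]
  have SE: "f \<in> E \<Longrightarrow> S f \<in> E" and TE: "f \<in> E \<Longrightarrow> T f \<in> E" for f using S T by (auto simp: bop_def)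
  show Tkv: "dop T (kv f) = kv (S f)" if "f \<in> E" for f
    using that by (intro D_inject) (simp_all add: T_D kv SE TE adj)
  have main: "kip (dop S v) u = kip v (dop T u)" if v: "v \<in> D" and u: "u \<in> D" for u v
  proof -
    define F where "F u = cnj (kip (dop S v) u - kip v (dop T u))" for u
    have "F u = 0"
    proof (rule continuous_functional_eq_0[OF _ _ _ u])
      fix u assume u: "u \<in> D"
      have "cmod (kip (dop S v) u) \<le> sqrt (nq (dop S v)) * sqrt (nq u)"
        using kip_bound S_D(1)[OF v] u by blast
      moreover have "cmod (kip v (dop T u)) \<le> sqrt (nq v) * sqrt (nq (dop T u))"
        using kip_bound T_D(1)[OF u] v by blast
      moreover have "sqrt (nq v) * sqrt (nq (dop T u)) \<le> sqrt (nq v) * sqrt (C' * nq u)"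
        using T_D(2)[OF u] v by (intro mult_left_mono) (auto simp: D.q_nonneg)
      moreover have "cmod (F u) \<le> cmod (kip (dop S v) u) + cmod (kip v (dop T u))"
        by (simp add: F_def norm_triangle_ineq4 del: complex_cnj_diff)
      ultimately show "cmod (F u) \<le> (sqrt (nq (dop S v)) + sqrt (nq v) * sqrt C') * sqrt (nq u)"
        by (simp add: distrib_right real_sqrt_mult mult.assoc)
      show "F (u - w) = F u - F w" if w: "w \<in> D" for w
        using u w v by (simp add: F_def dop_linear[OF T] S_D T_D D.hform_simps(7)[OF kip_hform])
    next
      fix e :: real assume "e > 0"
      then obtain g where "g \<in> E" "nq (u - kv g) < e" using kv_dense[OF u] by blast
      then show "\<exists>w\<in>D. nq (u - w) < e \<and> F w = 0"
        using v by (intro bexI[of _ "kv g"]) (auto simp: F_def kv Tkv kip_kv S_D SE)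
    qed
    then show ?thesis by (simp add: F_def)
  qed
  show "krein_adjoint KS KS (dop S) = dop T"
  proof
    fix u
    show "krein_adjoint KS KS (dop S) u = dop T u"
    proof (cases "u \<in> D")
      case True
      then show ?thesis by (intro krein_adjoint_eqI[OF KS_krein]) (simp_all add: T_D main)
    qed (simp add: krein_adjoint_def dop_def)
  qed
qed

end

section \<open>Shift maps and invariant kernels\<close>

locale invariant_setting = krein H for H :: "'h::ab_group_add kspace" +
  fixes \<phi> :: "'s::monoid_mult \<Rightarrow> 'x \<Rightarrow> 'x" and \<I> :: "'s \<Rightarrow> 's" and \<alpha> :: "'s \<Rightarrow> 'x \<Rightarrow> complex"
    and K :: "('x, 'h) kernel"
  assumes inv: "semigroup_involution \<I>" and act: "semigroup_action \<phi>"
    and nz: "\<And>a x. \<alpha> a x \<noteq> 0"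
    and mul: "\<And>a b x y. \<alpha> (a * b) x * cnj (\<alpha> (a * b) y) =
      \<alpha> a (\<phi> b x) * cnj (\<alpha> a (\<phi> b y)) * (\<alpha> b x * cnj (\<alpha> b y))"
    and one: "\<And>a x. \<alpha> (a * \<I> a) x = 1"
    and K_herm: "hermitian_kernel H K"
    and K_inv: "invariant_kernel H \<phi> \<alpha> \<I> K"
begin

abbreviation "\<psi> \<equiv> shift_map H \<phi> \<alpha>"
abbreviation "\<sigma> \<equiv> cocycle \<phi> \<alpha>"
abbreviation "\<kappa> \<equiv> kernel_form H K"

lemma invol[simp]: "\<I> (\<I> a) = a" using inv by (simp add: semigroup_involution_def)

lemma \<sigma>_eq: "\<sigma> a b = inverse (\<alpha> a (\<phi> b x)) * inverse (\<alpha> b x) * \<alpha> (a * b) x"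
  by (rule cocycle_eq[where \<alpha> = \<alpha> and \<phi> = \<phi>, OF nz mul])

lemma \<sigma>_unimodular: "\<sigma> a b * cnj (\<sigma> a b) = 1"
proof -
  obtain x :: 'x where True by simp
  show ?thesis using mul[of a b x x] nz by (simp add: \<sigma>_eq[of a b x] field_simps)
qed

lemma cmod_\<sigma>: "cmod (\<sigma> a b) = 1"
proof -
  have "of_real ((cmod (\<sigma> a b))\<^sup>2) = (1 :: complex)" using \<sigma>_unimodular by (simp only: complex_norm_square)
  then have "(cmod (\<sigma> a b))\<^sup>2 = 1" using of_real_eq_1_iff by blast
  then show ?thesis using norm_ge_zero[of "\<sigma> a b"] by (simp add: power2_eq_1_iff)
qed

text \<open>On point masses this is the definition of \<open>\<sigma>\<close>; the inverses in the
  shift map place \<open>\<sigma>\<close> where a projective representation has it.\<close>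

lemma \<psi>_mult: "f \<in> F \<Longrightarrow> \<psi> a (\<psi> b f) = fsc (\<sigma> a b) (\<psi> (a * b) f)"
proof (induction rule: F_induct)
  case zero
  then show ?case using shift_map_0 F.scale_zero_right by metis
next
  case (delta x \<xi>)
  have "inverse (\<alpha> a (\<phi> b x)) * inverse (\<alpha> b x) = \<sigma> a b * inverse (\<alpha> (a * b) x)"
    using nz by (simp add: \<sigma>_eq[of a b x])
  moreover have "\<phi> a (\<phi> b x) = \<phi> (a * b) x" using act by (simp add: semigroup_action_def)
  ultimately show ?case by (simp add: shift_map_delta' flip: delta_scale)
next
  case (add f g)
  then show ?case by (simp only: shift_map_add shift_map_F F.scale_right_distrib)
qed

lemmas \<kappa>_hform = kernel_form_hform[OF K_herm]
lemmas \<kappa>_simps = F.hform_simps[OF \<kappa>_hform]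

lemma \<psi>_adjoint_aux: "f \<in> F \<Longrightarrow> g \<in> F \<Longrightarrow> \<kappa> (\<psi> a f) g = \<sigma> a (\<I> a) * \<kappa> f (\<psi> (\<I> a) g)"
proof (induction rule: F_induct)
  case zero
  then show ?case using shift_map_0 \<kappa>_simps(8) shift_map_F by (metis mult_zero_right)
next
  case (delta y \<eta>)
  note \<eta> = delta(1)
  show ?case using delta(2)
  proof (induction rule: F_induct)
    case zero
    then show ?case using shift_map_0 \<kappa>_simps(9) shift_map_F delta_F[OF \<eta>] by (metis mult_zero_right)
  next
    case (delta x \<xi>)
    note Kb = hermitian_bounded[OF K_herm]
    have Kinv: "K x (\<phi> a y) \<eta> = kscale H (cnj (\<alpha> a (\<phi> (\<I> a) x)) * \<alpha> a y) (K (\<phi> (\<I> a) x) y \<eta>)"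
      using K_inv by (simp add: invariant_kernel_def)
    have KE: "K z y \<eta> \<in> kcarrier H" for z using bounded_ops_D(1)[OF Kb] \<eta> by blast
    have KE': "K x (\<phi> a y) \<eta> \<in> kcarrier H" using bounded_ops_D(1)[OF Kb] \<eta> by blast
    \<comment> \<open>The condition on \<open>\<alpha> (a * \<I> a) x\<close> leaves
      \<open>\<sigma> a (\<I> a)\<close> as a product of two inverses, and unimodularity trades an
      inverse for a conjugate, as in the invariance of \<open>K\<close>.\<close>
    have "\<sigma> a (\<I> a) * cnj (inverse (\<alpha> a (\<phi> (\<I> a) x)) * inverse (\<alpha> (\<I> a) x)) = 1"
      using \<sigma>_unimodular[of a "\<I> a"] one[of a x] by (simp add: \<sigma>_eq[of a "\<I> a" x])
    then have s: "\<sigma> a (\<I> a) * cnj (inverse (\<alpha> (\<I> a) x)) = cnj (\<alpha> a (\<phi> (\<I> a) x))"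
      using nz by (simp add: field_simps)
    have "\<kappa> (\<psi> a (delta_fun y \<eta>)) (delta_fun x \<xi>) = inverse (\<alpha> a y) * kform H (K x (\<phi> a y) \<eta>) \<xi>"
      using delta \<eta> by (simp add: shift_map_delta' delta_scale \<kappa>_simps(2) kernel_form_delta[where K = K, OF Kb])
    also have "\<dots> = cnj (\<alpha> a (\<phi> (\<I> a) x)) * kform H (K (\<phi> (\<I> a) x) y \<eta>) \<xi>"
      unfolding Kinv using delta KE nz by (simp add: kform_simps(2))
    also have "\<dots> = \<sigma> a (\<I> a) * \<kappa> (delta_fun y \<eta>) (\<psi> (\<I> a) (delta_fun x \<xi>))"
      using delta \<eta> by (simp add: shift_map_delta' delta_scale \<kappa>_simps(5) kernel_form_delta[where K = K, OF Kb] mult.assoc flip: s)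
    finally show ?case .
  next
    case (add g h)
    then show ?case using \<eta> by (simp only: shift_map_add shift_map_F \<kappa>_simps(4) distrib_left delta_F)
  qed
next
  case (add f g')
  then show ?case by (simp only: shift_map_add shift_map_F \<kappa>_simps(1) distrib_left)
qed

text \<open>In general \<open>\<sigma>(a, \<I> a)\<close> and \<open>\<sigma>(\<I> a, a)\<close> differ, but hermitian symmetry of \<open>K\<close> makes the
  adjoint relation hold with either of them.\<close>

lemma \<psi>_adjoint:
  assumes f: "f \<in> F" and g: "g \<in> F"
  shows "\<kappa> (\<psi> a f) g = \<kappa> f (fsc (cnj (\<sigma> (\<I> a) a)) (\<psi> (\<I> a) g))"
    and "\<kappa> (fsc (cnj (\<sigma> (\<I> a) a)) (\<psi> (\<I> a) f)) g = \<kappa> f (\<psi> a g)"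
proof -
  let ?s = "\<sigma> (\<I> a) a"
  have *: "\<kappa> (fsc (cnj ?s) (\<psi> (\<I> a) f)) g = \<kappa> f (\<psi> a g)" if f: "f \<in> F" and g: "g \<in> F" for f g
    using \<psi>_adjoint_aux[OF f g, of "\<I> a"] f g \<sigma>_unimodular[of "\<I> a" a]
    by (simp add: \<kappa>_simps(2) shift_map_F mult.assoc[symmetric] mult.commute)
  show "\<kappa> (fsc (cnj ?s) (\<psi> (\<I> a) f)) g = \<kappa> f (\<psi> a g)" using * f g .
  show "\<kappa> (\<psi> a f) g = \<kappa> f (fsc (cnj ?s) (\<psi> (\<I> a) g))"
    using *[OF g f] \<kappa>_simps(3)[OF g shift_map_F[OF f]]
      \<kappa>_simps(3)[OF f F.scE[OF shift_map_F[OF g]]] f g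
    by (metis \<kappa>_simps(3) F.scE shift_map_F)
qed

theorem dominated_imp_decomposition:
  assumes L: "L \<in> bounded_kernels H \<phi> \<alpha>" and le: "kernel_le H (- L) K" "kernel_le H K L"
  shows "\<exists>(\<K> :: ('x \<Rightarrow> 'h \<Rightarrow> complex) kspace) V. invariant_kolmogorov_decomposition H \<phi> \<alpha> \<I> K V \<K>"
proof -
  define q0 where "q0 f = Re (kernel_form H L f f)" for f
  have L_pd: "positive_definite_kernel H L" using L by (simp add: bounded_kernels_def)
  then have L_herm: "hermitian_kernel H L" and L_pos: "f \<in> F \<Longrightarrow> 0 \<le> q0 f" for f
    by (auto simp: positive_definite_kernel_def q0_def)
  note Lb = hermitian_bounded[OF L_herm]
  note Kb = hermitian_bounded[OF K_herm]
  have q0: "qform fsc F q0"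
    unfolding q0_def using F.hform_qform[OF kernel_form_hform[OF L_herm]] L_pos by (simp add: q0_def)
  have maj0: "F.majorant \<kappa> q0"
    using q0 le kernel_form_lincomb(3)[where A = L and B = L, OF Lb Lb]
    by (auto simp: F.majorant_def kernel_le_def q0_def abs_le_iff)
  obtain q where q: "F.majorant \<kappa> q" "\<forall>f\<in>F. q f \<le> q0 f" "\<forall>f\<in>F. q f \<le> qform.dualsq F q (\<kappa> f)"
    and q_op: "\<forall>S T C. S ` F \<subseteq> F \<longrightarrow> T ` F \<subseteq> F \<longrightarrow> (\<forall>f\<in>F. \<forall>g\<in>F. \<kappa> (S f) g = \<kappa> f (T g)) \<longrightarrow>
      C > 0 \<longrightarrow> (\<forall>f\<in>F. q0 (S f) \<le> C * q0 f \<and> q0 (T f) \<le> C * q0 f) \<longrightarrow> (\<forall>f\<in>F. q (S f) \<le> C * q f)"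
    using F.saturated_majorant[OF \<kappa>_hform maj0] by blast
  have "qform fsc F q" using q(1) by (simp add: F.majorant_def)
  then interpret Q: qform fsc F q .
  interpret A: krein_dual fsc F usc functionals fext q \<kappa>
    by unfold_locales (use q \<kappa>_hform in auto)
  have \<psi>_pos: "0 \<le> q0 (\<psi> a f)" if "f \<in> F" for a f by (rule L_pos[OF shift_map_F[OF that]])
  have L_bd: "\<exists>C\<ge>0. \<forall>f\<in>F. q0 (\<psi> a f) \<le> C * q0 f" for a
  proof -
    obtain C where C: "\<And>f. f \<in> F \<Longrightarrow> sqrt (q0 (\<psi> a f)) \<le> C * sqrt (q0 f)"
      using L unfolding bounded_kernels_def q0_def by blast
    have "q0 (\<psi> a f) \<le> C\<^sup>2 * q0 f" if f: "f \<in> F" for f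
    proof -
      have "q0 (\<psi> a f) = (sqrt (q0 (\<psi> a f)))\<^sup>2" using \<psi>_pos[OF f] by simp
      also have "\<dots> \<le> (C * sqrt (q0 f))\<^sup>2" using C[OF f] \<psi>_pos[OF f] by (intro power_mono) auto
      finally show ?thesis using L_pos[OF f] by (simp add: power_mult_distrib)
    qed
    then show ?thesis by (intro exI[of _ "C\<^sup>2"]) auto
  qed
  have bd: "\<exists>C>0. \<forall>f\<in>F. q (\<psi> a f) \<le> C * q f" for a
  proof -
    let ?T = "\<lambda>f. fsc (cnj (\<sigma> (\<I> a) a)) (\<psi> (\<I> a) f)"
    obtain C1 where C1: "C1 \<ge> 0" "\<And>f. f \<in> F \<Longrightarrow> q0 (\<psi> a f) \<le> C1 * q0 f" using L_bd by blast
    obtain C2 where C2: "C2 \<ge> 0" "\<And>f. f \<in> F \<Longrightarrow> q0 (\<psi> (\<I> a) f) \<le> C2 * q0 f" using L_bd by blast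
    \<comment> \<open>One positive constant for the shift and its adjoint \<open>?T\<close>, as
      \<open>saturated_majorant\<close> demands. The scalar in \<open>?T\<close> has modulus one and
      does not change \<open>q0\<close>.\<close>
    let ?C = "C1 + C2 + 1"
    have "C1 * q0 f \<le> ?C * q0 f" "C2 * q0 f \<le> ?C * q0 f" if "f \<in> F" for f
      using C1(1) C2(1) L_pos[OF that] by (auto intro!: mult_right_mono)
    then have "q0 (\<psi> a f) \<le> ?C * q0 f" "q0 (?T f) \<le> ?C * q0 f" if "f \<in> F" for f
      using C1(2)[OF that] C2(2)[OF that] that
      by (fastforce, simp add: qform.q_sc[OF q0 shift_map_F] cmod_\<sigma>) (meson order_trans)
    then have "\<forall>f\<in>F. q (\<psi> a f) \<le> ?C * q f"
      using C1(1) C2(1) \<psi>_adjoint(1)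
      by (intro ballI q_op[rule_format, of "\<psi> a" ?T ?C]) (auto simp: shift_map_F)
    then show ?thesis using C1(1) C2(1) by (intro exI[of _ ?C]) auto
  qed
  obtain c where c: "\<And>a. c a > 0" "\<And>a f. f \<in> F \<Longrightarrow> q (\<psi> a f) \<le> c a * q f" using bd by metis
  \<comment> \<open>The \<open>\<kappa>\<close>-adjoint of the shift. By \<open>dop_adjoint\<close>
    it is the transpose of this map, not of the shift itself, that sends \<open>kv f\<close> to
    \<open>kv (\<psi> a f)\<close>.\<close>
  define S where "S a f = fsc (cnj (\<sigma> (\<I> a) a)) (\<psi> (\<I> a) f)" for a f
  have \<psi>_bop: "A.bop (\<psi> a) (c a)" for a
    by (auto simp: c A.bop_def shift_map_F shift_map_add shift_map_scale less_imp_le)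
  have S_bop: "A.bop (S a) (c (\<I> a))" for a
    by (auto simp: c A.bop_def S_def shift_map_F shift_map_add shift_map_scale less_imp_le
        Q.q_sc cmod_\<sigma> F.scale_right_distrib mult.commute[of "cnj (\<sigma> (\<I> a) a)"])
  define U where "U a = A.dop (S a)" for a
  note U_D = A.bop_dop[OF S_bop, folded U_def]
  note U_lin = A.dop_linear[OF S_bop, folded U_def]
  have U_kv: "U a (A.kv f) = A.kv (\<psi> a f)" if "f \<in> F" for a f
    unfolding U_def by (rule A.dop_adjoint(1)[OF \<psi>_bop S_bop _ that]) (simp add: S_def \<psi>_adjoint(1))
  have S_adj: "\<kappa> (S a f) g = \<kappa> f (\<psi> a g)" if "f \<in> F" "g \<in> F" for a f g
    unfolding S_def using \<psi>_adjoint(2) that .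
  define V where "V x \<xi> = (if \<xi> \<in> kcarrier H then A.kv (delta_fun x \<xi>) else 0)" for x \<xi>
  have V_D: "V x \<xi> \<in> A.D" for x \<xi> by (auto simp: V_def A.kv)
  have H_fs: "fundamental_symmetry H (kg H) (kJ H)" using fs .
  have V_lin: "linear_map_on H A.KS (V x)" for x
    by (auto simp: linear_map_on_def V_def A.kv delta_add delta_scale A.kv_add A.kv_scale)
  \<comment> \<open>The squared norm of \<open>V x \<xi>\<close> is \<open>q\<close> at a point
    mass, and \<open>q \<le> q0\<close> bounds it through the bounded operator
    \<open>L x x\<close>.\<close>
  have V_bounded: "V x \<in> bounded_ops H A.KS" for x
  proof -
    obtain C where C: "C \<ge> 0" "\<And>\<xi>. \<xi> \<in> kcarrier H \<Longrightarrow> sqrt (Re (kg H (L x x \<xi>) (L x x \<xi>))) \<le> C * sqrt (Re (kg H \<xi> \<xi>))"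
      using bounded_ops_bound[OF krein Lb] by blast
    show ?thesis
    proof (rule bounded_opsI[OF krein A.KS_krein H_fs A.KS_symmetry V_lin])
      show "V x \<xi> = 0" if "\<xi> \<notin> kcarrier H" for \<xi> using that by (simp add: V_def)
      show "0 \<le> sqrt C" using C by simp
      fix \<xi> assume \<xi>: "\<xi> \<in> kcarrier H"
      have n: "0 \<le> Re (kg H \<xi> \<xi>)" using g_pos[OF \<xi>] g_simps(8)[OF \<xi>] by (cases "\<xi> = 0") auto
      have "q (delta_fun x \<xi>) \<le> q0 (delta_fun x \<xi>)" using q(2) \<xi> by blast
      also have "\<dots> = Re (kform H (L x x \<xi>) \<xi>)"
        using kernel_form_delta[where K = L, OF Lb \<xi> \<xi>] by (simp add: q0_def)
      also have "\<dots> \<le> cmod (kform H (L x x \<xi>) \<xi>)" by (rule complex_Re_le_cmod)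
      also have "\<dots> \<le> sqrt (Re (kg H (L x x \<xi>) (L x x \<xi>))) * sqrt (Re (kg H \<xi> \<xi>))"
        using kform_bound[OF bounded_ops_D(1)[OF Lb \<xi>] \<xi>] .
      also have "\<dots> \<le> (C * sqrt (Re (kg H \<xi> \<xi>))) * sqrt (Re (kg H \<xi> \<xi>))"
        using C(2)[OF \<xi>] n by (intro mult_right_mono) auto
      also have "\<dots> = C * Re (kg H \<xi> \<xi>)" using n by (simp add: mult.assoc)
      finally show "sqrt (Re (A.gip (V x \<xi>) (V x \<xi>))) \<le> sqrt C * sqrt (Re (kg H \<xi> \<xi>))"
        unfolding real_sqrt_mult[symmetric] using \<xi> by (simp add: A.gip_self V_D) (simp add: V_def A.kv)
    qed
  qed
  have V_kolm: "K x y = krein_adjoint H A.KS (V x) \<circ> V y" for x y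
  proof
    fix \<eta>
    have K_car: "K x y \<eta> \<in> kcarrier H"
      using bounded_ops_D(1,4)[OF Kb, of \<eta> x y] zeroE by (cases "\<eta> \<in> kcarrier H") auto
    have "krein_adjoint H A.KS (V x) (V y \<eta>) = K x y \<eta>"
    proof (rule krein_adjoint_eqI[OF krein _ K_car])
      show "V y \<eta> \<in> kcarrier A.KS" by (simp add: V_D)
      fix \<xi> assume \<xi>: "\<xi> \<in> kcarrier H"
      show "kform A.KS (V x \<xi>) (V y \<eta>) = kform H \<xi> (K x y \<eta>)"
      proof (cases "\<eta> \<in> kcarrier H")
        case True
        have "kform A.KS (V x \<xi>) (V y \<eta>) = \<kappa> (delta_fun x \<xi>) (delta_fun y \<eta>)"
          using \<xi> True by (simp add: V_def A.kip_kv A.kv)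
        also have "\<dots> = kform H (K y x \<xi>) \<eta>" by (rule kernel_form_delta[where K = K, OF Kb True \<xi>])
        also have "\<dots> = kform H \<xi> (K x y \<eta>)" by (rule hermitian_kernel_kform[OF K_herm \<xi> True])
        finally show ?thesis .
      next
        case False
        then show ?thesis
          using \<xi> A.D.hform_simps(9)[OF A.kip_hform A.kv(1)] bounded_ops_D(4)[OF Kb False] by (simp add: V_def kform_simps(9))
      qed
    qed
    then show "K x y \<eta> = (krein_adjoint H A.KS (V x) \<circ> V y) \<eta>" by simp
  qed
  let ?span = "module.span (kscale A.KS) (\<Union>x. V x ` kcarrier H)"
  have kv_span: "A.kv f \<in> ?span" if "f \<in> F" for f
    using that
  proof (induction rule: F_induct)
    case zero
    have "A.kv (fsc 0 0) = usc 0 (A.kv 0)" by (rule A.kv_scale) auto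
    then have "A.kv 0 = 0" by simp
    then show ?case by (simp only: P.U.span_zero A.KS_sel)
  next
    case (delta x \<xi>)
    then have "A.kv (delta_fun x \<xi>) \<in> (\<Union>x. V x ` kcarrier H)" by (auto simp: V_def)
    then show ?case unfolding A.KS_sel by (rule P.U.span_base)
  next
    case (add f g)
    then show ?case using P.U.span_add by (simp only: A.kv_add A.KS_sel)
  qed
  have V_dense: "krein_topology A.KS closure_of ?span = kcarrier A.KS"
  proof -
    obtain C where C: "C > 0" "\<And>u. u \<in> A.D \<Longrightarrow> krein_norm A.KS u \<le> C * sqrt (Re (A.gip u u))"
      using norm_equiv[OF A.KS_krein A.KS_symmetry] by (metis A.KS_sel(2))
    have "\<exists>w\<in>?span. w \<in> A.D \<and> krein_norm A.KS (u - w) < e" if u: "u \<in> A.D" and e: "e > 0" for u e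
    proof -
      obtain f where f: "f \<in> F" "A.nq (u - A.kv f) < (e / C)\<^sup>2"
        using A.kv_dense[OF u, of "(e / C)\<^sup>2"] e C(1) by auto
      have d: "u - A.kv f \<in> A.D" using u f by (simp add: A.kv)
      have "sqrt (A.nq (u - A.kv f)) < e / C"
        using f(2) e C(1) by (intro real_less_lsqrt) (auto simp: A.D.q_nonneg[OF d])
      then have "C * sqrt (A.nq (u - A.kv f)) < e" using C(1) by (simp add: field_simps)
      then have "krein_norm A.KS (u - A.kv f) < e" using C(2)[OF d] by (simp add: A.gip_self d)
      then show ?thesis using kv_span f(1) A.kv(1) by blast
    qed
    then show ?thesis unfolding krein_topology_closure[OF A.KS_krein] by auto
  qed
  \<comment> \<open>On the vectors \<open>kv f\<close> the identity is \<open>\<psi>_mult\<close>;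
    boundedness of both sides carries it to \<open>A.D\<close>, and off the carrier both sides are
    0.\<close>
  have U_proj: "U a \<circ> U b = kscale A.KS (\<sigma> a b) \<circ> U (a * b)" for a b
  proof
    fix u
    show "(U a \<circ> U b) u = (kscale A.KS (\<sigma> a b) \<circ> U (a * b)) u"
    proof (cases "u \<in> A.D")
      case True
      have "U a (U b u) = usc (\<sigma> a b) (U (a * b) u)"
      proof (rule A.operator_eqI[OF _ _ _ _ _ _ _ True])
        fix v assume v: "v \<in> A.D"
        show "U a (U b v) \<in> A.D" "usc (\<sigma> a b) (U (a * b) v) \<in> A.D" using v by (auto simp: U_D)
        have "A.nq (U a (U b v)) \<le> c (\<I> a) * A.nq (U b v)" using U_D(2)[OF U_D(1)[OF v]] .
        also have "\<dots> \<le> c (\<I> a) * (c (\<I> b) * A.nq v)" using U_D(2)[OF v] c(1)[of "\<I> a"] by (intro mult_left_mono) auto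
        finally show "A.nq (U a (U b v)) \<le> (c (\<I> a) * c (\<I> b)) * A.nq v" by (simp add: mult.assoc)
        show "A.nq (usc (\<sigma> a b) (U (a * b) v)) \<le> c (\<I> (a * b)) * A.nq v"
          using U_D(2)[OF v, of "a * b"] U_D(1)[OF v] by (simp add: A.D.q_sc cmod_\<sigma>)
        fix w assume w: "w \<in> A.D"
        show "U a (U b (v - w)) = U a (U b v) - U a (U b w)" using v w by (simp add: U_lin U_D)
        show "usc (\<sigma> a b) (U (a * b) (v - w)) = usc (\<sigma> a b) (U (a * b) v) - usc (\<sigma> a b) (U (a * b) w)"
          using v w by (simp add: U_lin P.U.scale_right_diff_distrib)
      next
        fix f :: "'x \<Rightarrow> 'h" assume f: "f \<in> F"
        show "U a (U b (A.kv f)) = usc (\<sigma> a b) (U (a * b) (A.kv f))"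
          using f by (simp add: U_kv shift_map_F \<psi>_mult A.kv_scale)
      qed
      then show ?thesis by simp
    next
      case False
      have "U a 0 = 0" for a using U_lin(4)[OF A.D.zeroE A.D.zeroE] .
      then show ?thesis using False by (simp add: U_def A.dop_def)
    qed
  qed
  have U_V: "V (\<phi> a x) = kscale A.KS (\<alpha> a x) \<circ> U a \<circ> V x" for a x
  proof
    fix \<xi>
    show "V (\<phi> a x) \<xi> = (kscale A.KS (\<alpha> a x) \<circ> U a \<circ> V x) \<xi>"
    proof (cases "\<xi> \<in> kcarrier H")
      case True
      then show ?thesis
        using nz[of a x] by (simp add: V_def U_kv shift_map_delta' delta_scale A.kv_scale)
    next
      case False
      then show ?thesis using U_lin(4)[OF A.D.zeroE A.D.zeroE, of a] by (simp add: V_def)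
    qed
  qed
  \<comment> \<open>The adjoint of the transpose of \<open>S a\<close> is the transpose of
    \<open>\<psi> a\<close>. The left side agrees with it because both send \<open>kv f\<close> to
    \<open>kv (S a f)\<close>.\<close>
  have U_adj: "kscale A.KS (cnj (\<sigma> (\<I> a) a)) \<circ> U (\<I> a) = krein_adjoint A.KS A.KS (U a)" for a
  proof -
    have "usc (cnj (\<sigma> (\<I> a) a)) (U (\<I> a) u) = A.dop (\<psi> a) u" for u
    proof (cases "u \<in> A.D")
      case True
      show ?thesis
      proof (rule A.operator_eqI[OF _ _ _ _ _ _ _ True])
        fix v assume v: "v \<in> A.D"
        show "usc (cnj (\<sigma> (\<I> a) a)) (U (\<I> a) v) \<in> A.D" "A.dop (\<psi> a) v \<in> A.D"
          using v by (auto simp: U_D A.bop_dop[OF \<psi>_bop])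
        show "A.nq (usc (cnj (\<sigma> (\<I> a) a)) (U (\<I> a) v)) \<le> c a * A.nq v"
          using U_D(2)[OF v, of "\<I> a"] U_D(1)[OF v] by (simp add: A.D.q_sc cmod_\<sigma>)
        show "A.nq (A.dop (\<psi> a) v) \<le> c a * A.nq v" by (rule A.bop_dop(2)[OF \<psi>_bop v])
        fix w assume w: "w \<in> A.D"
        show "usc (cnj (\<sigma> (\<I> a) a)) (U (\<I> a) (v - w)) = usc (cnj (\<sigma> (\<I> a) a)) (U (\<I> a) v) - usc (cnj (\<sigma> (\<I> a) a)) (U (\<I> a) w)"
          using v w by (simp add: U_lin P.U.scale_right_diff_distrib)
        show "A.dop (\<psi> a) (v - w) = A.dop (\<psi> a) v - A.dop (\<psi> a) w"
          by (rule A.dop_linear(2)[OF \<psi>_bop v w])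
      next
        fix f :: "'x \<Rightarrow> 'h" assume f: "f \<in> F"
        show "usc (cnj (\<sigma> (\<I> a) a)) (U (\<I> a) (A.kv f)) = A.dop (\<psi> a) (A.kv f)"
          using A.dop_adjoint(1)[OF S_bop \<psi>_bop S_adj f, of a] f
          by (simp add: U_kv S_def A.kv_scale shift_map_F)
      qed
    next
      case False
      then show ?thesis by (simp add: U_def A.dop_def)
    qed
    moreover have "krein_adjoint A.KS A.KS (U a) = A.dop (\<psi> a)"
      unfolding U_def by (rule A.dop_adjoint(2)[OF S_bop \<psi>_bop S_adj])
    ultimately show ?thesis by (simp add: fun_eq_iff)
  qed
  have "invariant_kolmogorov_decomposition H \<phi> \<alpha> \<I> K V A.KS"
    unfolding invariant_kolmogorov_decomposition_def kolmogorov_decomposition_def projective_representation_def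
  proof (intro conjI allI exI[of _ U])
    show "U a \<in> bounded_ops A.KS A.KS" for a unfolding U_def by (rule A.dop_bounded_ops[OF S_bop])
  qed (fact A.KS_krein V_bounded V_kolm V_dense U_proj U_V U_adj)+
  then show ?thesis by blast
qed

end

section \<open>From a decomposition to disjoint kernels\<close>

lemma (in krein) kernel_eqI:
  fixes A B :: "('x, 'h) kernel"
  assumes "\<And>x y \<eta>. \<eta> \<in> kcarrier H \<Longrightarrow> A x y \<eta> \<in> kcarrier H" "\<And>x y \<eta>. \<eta> \<in> kcarrier H \<Longrightarrow> B x y \<eta> \<in> kcarrier H"
    and "\<And>x y \<eta>. \<eta> \<notin> kcarrier H \<Longrightarrow> A x y \<eta> = B x y \<eta>"
    and eq: "\<And>x y \<eta> \<xi>. \<eta> \<in> kcarrier H \<Longrightarrow> \<xi> \<in> kcarrier H \<Longrightarrow> kform H (A x y \<eta>) \<xi> = kform H (B x y \<eta>) \<xi>"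
  shows "A = B"
proof (intro ext)
  fix x y \<eta>
  show "A x y \<eta> = B x y \<eta>"
  proof (cases "\<eta> \<in> kcarrier H")
    case True
    note AB = assms(1,2)[OF True, of x y]
    show ?thesis
      using kform_simps(3)[OF AB(1)] kform_simps(3)[OF AB(2)] eq[OF True, of _ x y]
      by (intro nondegenerate[OF AB]) metis
  qed (use assms(3) in blast)
qed

section \<open>Pulling back forms along V\<close>

locale decomposition = krein H + W: fsym \<K> "kg \<K>" "kJ \<K>"
  for H :: "'h::ab_group_add kspace" and \<K> :: "'k::ab_group_add kspace" +
  fixes V :: "'x \<Rightarrow> 'h \<Rightarrow> 'k"
  assumes V: "\<And>x. V x \<in> bounded_ops H \<K>"
begin

lemmas V_D = bounded_ops_D[OF V]

lemma V_0[simp]: "V x 0 = 0" using V_D(2)[of 0 0 x] by simp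

abbreviation "vsum \<equiv> fext V"

lemma vsum_closed[simp, intro]: "f \<in> F \<Longrightarrow> vsum f \<in> kcarrier \<K>"
  by (rule fext_closed) (auto simp: V_D)

lemma vsum_add: "f \<in> F \<Longrightarrow> g \<in> F \<Longrightarrow> vsum (f + g) = vsum f + vsum g"
  by (rule fext_add) (auto simp: V_D)

lemma vsum_scale: "f \<in> F \<Longrightarrow> vsum (fsc c f) = kscale \<K> c (vsum f)"
  by (rule fext_scale) (auto simp: V_D W.scale_right_distrib)

lemma vsum_delta: "vsum (delta_fun x \<xi>) = V x \<xi>"
  by (rule fext_delta) simp

lemma vsum_0: "vsum 0 = 0" by (simp add: fext_def)

lemma vsum_diff: "f \<in> F \<Longrightarrow> g \<in> F \<Longrightarrow> vsum (f - g) = vsum f - vsum g"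
  using vsum_add[of "f - g" g] by (simp only: F.diffE diff_add_cancel) (simp add: algebra_simps)

text \<open>Bounded hermitian forms on the Krein space pull back along \<open>V\<close> to hermitian
  kernels; one construction serves the positive part, the negative part and their sum.\<close>

lemma kernel_of_form:
  assumes b: "hform (kscale \<K>) (kcarrier \<K>) b"
    and bd: "\<And>u w. u \<in> kcarrier \<K> \<Longrightarrow> w \<in> kcarrier \<K> \<Longrightarrow>
      cmod (b u w) \<le> sqrt (Re (kg \<K> u u)) * sqrt (Re (kg \<K> w w))"
  obtains T where "hermitian_kernel H T"
    "\<And>x y \<eta> \<xi>. \<eta> \<in> kcarrier H \<Longrightarrow> \<xi> \<in> kcarrier H \<Longrightarrow> kform H (T x y \<eta>) \<xi> = b (V y \<eta>) (V x \<xi>)"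
    "\<And>f g. f \<in> F \<Longrightarrow> g \<in> F \<Longrightarrow> kernel_form H T f g = b (vsum f) (vsum g)"
proof -
  note b_simps = W.hform_simps[OF b]
  have "\<exists>T. T \<in> bounded_ops H H \<and> (\<forall>\<eta>\<in>kcarrier H. \<forall>\<xi>\<in>kcarrier H. kform H (T \<eta>) \<xi> = b (V y \<eta>) (V x \<xi>))" for x y
  proof -
    obtain C where C: "C \<ge> 0" "\<And>\<xi>. \<xi> \<in> kcarrier H \<Longrightarrow> sqrt (Re (kg \<K> (V x \<xi>) (V x \<xi>))) \<le> C * sqrt (Re (kg H \<xi> \<xi>))"
      using bounded_ops_bound[OF krein V] by blast
    obtain C' where C': "C' \<ge> 0" "\<And>\<xi>. \<xi> \<in> kcarrier H \<Longrightarrow> sqrt (Re (kg \<K> (V y \<xi>) (V y \<xi>))) \<le> C' * sqrt (Re (kg H \<xi> \<xi>))"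
      using bounded_ops_bound[OF krein V] by blast
    obtain T where "T \<in> bounded_ops H H"
      "\<And>\<eta> \<xi>. \<eta> \<in> kcarrier H \<Longrightarrow> \<xi> \<in> kcarrier H \<Longrightarrow> kform H (T \<eta>) \<xi> = b (V y \<eta>) (V x \<xi>)"
    proof (rule sesquilinear_operator[OF krein, of "\<lambda>\<eta> \<xi>. b (V y \<eta>) (V x \<xi>)" "C' * C"])
      show "antilinear_on (kscale H) (kcarrier H) (\<lambda>\<xi>. b (V y \<eta>) (V x \<xi>))" if "\<eta> \<in> kcarrier H" for \<eta>
        using that by (simp add: antilinear_on_def V_D b_simps(4,5))
      show "0 \<le> C' * C" using C C' by simp
      fix \<eta> \<xi> assume h: "\<eta> \<in> kcarrier H" "\<xi> \<in> kcarrier H"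
      have "cmod (b (V y \<eta>) (V x \<xi>)) \<le> sqrt (Re (kg \<K> (V y \<eta>) (V y \<eta>))) * sqrt (Re (kg \<K> (V x \<xi>) (V x \<xi>)))"
        using bd V_D(1) h by blast
      also have "\<dots> \<le> (C' * sqrt (Re (kg H \<eta> \<eta>))) * (C * sqrt (Re (kg H \<xi> \<xi>)))"
        using C C' h q_nonneg W.q_nonneg V_D(1) by (intro mult_mono) auto
      finally show "cmod (b (V y \<eta>) (V x \<xi>)) \<le> C' * C * sqrt (Re (kg H \<eta> \<eta>)) * sqrt (Re (kg H \<xi> \<xi>))"
        by (simp add: mult_ac)
    qed (use V_D b_simps(1,2) in \<open>auto\<close>)
    then show ?thesis by blast
  qed
  then have "\<exists>T. \<forall>x y. T x y \<in> bounded_ops H H \<and>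
      (\<forall>\<eta>\<in>kcarrier H. \<forall>\<xi>\<in>kcarrier H. kform H (T x y \<eta>) \<xi> = b (V y \<eta>) (V x \<xi>))"
    by (intro choice allI)
  then obtain T where T: "\<And>x y. T x y \<in> bounded_ops H H"
    "\<And>x y \<eta> \<xi>. \<eta> \<in> kcarrier H \<Longrightarrow> \<xi> \<in> kcarrier H \<Longrightarrow> kform H (T x y \<eta>) \<xi> = b (V y \<eta>) (V x \<xi>)"
    by blast
  have herm: "hermitian_kernel H T"
  proof (rule hermitian_kernelI[OF T(1)])
    fix x y \<xi> \<eta> assume h: "\<xi> \<in> kcarrier H" "\<eta> \<in> kcarrier H"
    have "T x y \<eta> \<in> kcarrier H" using bounded_ops_D(1)[OF T(1)] h by blast
    then have "kform H \<xi> (T x y \<eta>) = cnj (kform H (T x y \<eta>) \<xi>)" using kform_simps(3) h by blast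
    also have "\<dots> = kform H (T y x \<xi>) \<eta>" using h T(2) b_simps(3)[of "V y \<eta>" "V x \<xi>"] V_D(1) by simp
    finally show "kform H (T y x \<xi>) \<eta> = kform H \<xi> (T x y \<eta>)" by simp
  qed
  note Tf = F.hform_simps[OF kernel_form_hform[OF herm]]
  have "kernel_form H T f g = b (vsum f) (vsum g)" if f: "f \<in> F" and g: "g \<in> F" for f g
    using f
  proof (induction rule: F_induct)
    case zero
    then show ?case using Tf(8)[OF g] b_simps(8)[OF vsum_closed[OF g]] by (simp only: vsum_0)
  next
    case (delta y \<eta>)
    note \<eta> = delta
    show ?case using g
    proof (induction rule: F_induct)
      case zero
      then show ?case using Tf(9)[OF delta_F[OF \<eta>]] b_simps(9)[OF vsum_closed[OF delta_F[OF \<eta>]]]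
        by (simp only: vsum_0)
    next
      case (delta x \<xi>)
      then show ?case using kernel_form_delta[where K = T, OF T(1) delta \<eta>] T(2) \<eta> by (simp add: vsum_delta)
    next
      case (add g h)
      then show ?case using \<eta> by (simp only: Tf(4) vsum_add b_simps(4) delta_F vsum_closed)
    qed
  next
    case (add f h)
    then show ?case using g by (simp only: Tf(1) vsum_add b_simps(1) vsum_closed)
  qed
  then show ?thesis using that herm T(2) by blast
qed

text \<open>For \<open>s = 1\<close> and \<open>s = -1\<close> these are the forms of the orthogonal projections onto the eigenspaces of \<open>J\<close>.\<close>

definition pform :: "real \<Rightarrow> 'k \<Rightarrow> 'k \<Rightarrow> complex" where
  "pform s u w = (kg \<K> u w + of_real s * kg \<K> (kJ \<K> u) w) / 2"

lemma pform_hform: "hform (kscale \<K>) (kcarrier \<K>) (pform s)"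
proof -
  have J: "kg \<K> (kJ \<K> y) x = cnj (kg \<K> (kJ \<K> x) y)" if "x \<in> kcarrier \<K>" "y \<in> kcarrier \<K>" for x y
    using W.g_simps(3)[of "kJ \<K> x" y] W.J_sym[of y x] that by simp
  show ?thesis
    unfolding hform_def
  proof (intro conjI ballI allI)
    fix x y c assume x: "x \<in> kcarrier \<K>" and y: "y \<in> kcarrier \<K>"
    show "pform s (x + y) z = pform s x z + pform s y z" if "z \<in> kcarrier \<K>" for z
      using x y that by (simp add: pform_def W.g_simps(1) W.J_add distrib_left add_divide_distrib)
    show "pform s (kscale \<K> c x) y = c * pform s x y"
      using x y by (simp add: pform_def W.g_simps(2) W.J_scale distrib_left add_divide_distrib)
    show "pform s y x = cnj (pform s x y)"
      unfolding pform_def J[OF x y] W.g_simps(3)[OF x y] by simp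
  qed
qed

lemma pform_bound:
  assumes s: "\<bar>s\<bar> = 1" and u: "u \<in> kcarrier \<K>" and w: "w \<in> kcarrier \<K>"
  shows "cmod (pform s u w) \<le> sqrt (Re (kg \<K> u u)) * sqrt (Re (kg \<K> w w))"
proof -
  have "cmod (pform s u w) \<le> (cmod (kg \<K> u w) + cmod (kg \<K> (kJ \<K> u) w)) / 2"
    using norm_triangle_ineq[of "kg \<K> u w" "of_real s * kg \<K> (kJ \<K> u) w"] s
    by (simp add: pform_def norm_mult norm_divide)
  then show ?thesis
    using W.g_bound[OF u w] W.g_bound[OF W.J_closed[OF u] w] u by (simp add: W.q_J)
qed

lemma pform_nonneg:
  assumes s: "\<bar>s\<bar> = 1" and u: "u \<in> kcarrier \<K>"
  shows "0 \<le> Re (pform s u u)"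
proof -
  have "\<bar>Re (kg \<K> (kJ \<K> u) u)\<bar> \<le> Re (kg \<K> u u)"
    using abs_Re_le_cmod[of "kg \<K> (kJ \<K> u) u"] W.g_bound[OF W.J_closed[OF u] u] W.q_nonneg[OF u] u
    by (simp add: W.q_J)
  moreover have "s = 1 \<or> s = - 1" using s by auto
  ultimately show ?thesis by (auto simp: pform_def)
qed

text \<open>With \<open>E1\<close> and \<open>E2\<close> the projections onto the eigenspaces for 1
  and -1, the vector \<open>E1 v - w\<close> splits orthogonally into \<open>E1 (v - w)\<close> and
  \<open>- E2 w\<close>. The identity joins a bound by one part at \<open>f - h\<close> with a bound
  by the other part at \<open>h\<close>.\<close>

lemma pform_split:
  assumes v: "v \<in> kcarrier \<K>" and w: "w \<in> kcarrier \<K>"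
  shows "pform 1 (v - w) (v - w) + pform (- 1) w w =
    kg \<K> (kscale \<K> (1/2) (v + kJ \<K> v) - w) (kscale \<K> (1/2) (v + kJ \<K> v) - w)"
proof -
  note J = W.J_closed[OF v] W.J_closed[OF w]
  have s: "kg \<K> (kJ \<K> v) (kJ \<K> v) = kg \<K> v v" "kg \<K> v (kJ \<K> v) = kg \<K> (kJ \<K> v) v"
    "kg \<K> w (kJ \<K> v) = kg \<K> (kJ \<K> w) v" "kJ \<K> (v - w) = kJ \<K> v - kJ \<K> w"
    using W.J_sym[OF v J(1)] W.J_sym[OF v v] W.J_sym[OF w v] W.J_add[OF W.diffE[OF v w] w] v w
    by (simp_all add: algebra_simps)
  let ?p = "kscale \<K> (1/2) (v + kJ \<K> v)"
  have p: "?p \<in> kcarrier \<K>" using v by auto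
  have "kg \<K> (?p - w) (?p - w) = kg \<K> ?p ?p - kg \<K> ?p w - kg \<K> w ?p + kg \<K> w w"
    using p w by (simp add: W.g_simps(6,7))
  also have "kg \<K> ?p ?p = (kg \<K> v v + kg \<K> (kJ \<K> v) v) / 2"
    using v J by (simp add: W.g_simps(1,2,4,5) s(1,2) add_divide_distrib)
  also have "kg \<K> ?p w = (kg \<K> v w + kg \<K> (kJ \<K> v) w) / 2"
    using v w J by (simp add: W.g_simps(1,2))
  also have "kg \<K> w ?p = (kg \<K> w v + kg \<K> (kJ \<K> w) v) / 2"
    using v w J by (simp add: W.g_simps(4,5) s(3))
  finally have rhs: "kg \<K> (?p - w) (?p - w) = (kg \<K> v v + kg \<K> (kJ \<K> v) v) / 2 -
    (kg \<K> v w + kg \<K> (kJ \<K> v) w) / 2 - (kg \<K> w v + kg \<K> (kJ \<K> w) v) / 2 + kg \<K> w w" .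
  have "kg \<K> (v - w) (v - w) = kg \<K> v v - kg \<K> v w - kg \<K> w v + kg \<K> w w"
    "kg \<K> (kJ \<K> v - kJ \<K> w) (v - w) =
      kg \<K> (kJ \<K> v) v - kg \<K> (kJ \<K> v) w - kg \<K> (kJ \<K> w) v + kg \<K> (kJ \<K> w) w"
    using v w J by (simp_all add: W.g_simps(6,7))
  then show ?thesis
    unfolding rhs pform_def s(4) by (simp add: add_divide_distrib diff_divide_distrib)
qed

end

section \<open>Disjointness and boundedness of the two parts\<close>

context invariant_setting
begin

theorem decomposition_imp_disjoint:
  fixes \<K> :: "'k::ab_group_add kspace"
  assumes dec: "invariant_kolmogorov_decomposition H \<phi> \<alpha> \<I> K V \<K>"
  shows "\<exists>Kp Km. positive_definite_kernel H Kp \<and> positive_definite_kernel H Km \<and>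
      disjoint_kernels H Kp Km \<and> K = Kp - Km \<and> Kp + Km \<in> bounded_kernels H \<phi> \<alpha>"
proof -
  note dec = dec[unfolded invariant_kolmogorov_decomposition_def kolmogorov_decomposition_def]
  have \<K>: "krein_space \<K>" and V: "V x \<in> bounded_ops H \<K>" and KV: "K x y = krein_adjoint H \<K> (V x) \<circ> V y"
    and dense: "krein_topology \<K> closure_of (module.span (kscale \<K>) (\<Union>x. V x ` kcarrier H)) = kcarrier \<K>" for x y
    using dec by auto
  obtain U where U: "\<And>a. U a \<in> bounded_ops \<K> \<K>" and UV: "\<And>a x. V (\<phi> a x) = kscale \<K> (\<alpha> a x) \<circ> U a \<circ> V x"
    using dec unfolding projective_representation_def by blast
  interpret W: fsym \<K> "kg \<K>" "kJ \<K>" by (rule krein_fsym[OF \<K>])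
  interpret A: decomposition H \<K> V by unfold_locales (rule V)
  note Kb = hermitian_bounded[OF K_herm]
  have K_form: "kform H (K x y \<eta>) \<xi> = kform \<K> (V y \<eta>) (V x \<xi>)" if h: "\<eta> \<in> kcarrier H" "\<xi> \<in> kcarrier H" for x y \<eta> \<xi>
  proof -
    have "kform \<K> (V x \<xi>) (V y \<eta>) = kform H \<xi> (K x y \<eta>)"
      unfolding KV o_apply by (rule krein_adjoint(2)[OF krein \<K> V A.V_D(1)[OF h(1)] h(2)])
    moreover have "kform H (K x y \<eta>) \<xi> = cnj (kform H \<xi> (K x y \<eta>))"
      using kform_simps(3)[OF h(2) bounded_ops_D(1)[OF Kb h(1)]] .
    moreover have "kform \<K> (V y \<eta>) (V x \<xi>) = cnj (kform \<K> (V x \<xi>) (V y \<eta>))"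
      using W.kform_simps(3) A.V_D(1) h by blast
    ultimately show ?thesis by simp
  qed
  obtain Kp where Kp: "hermitian_kernel H Kp"
    "\<And>x y \<eta> \<xi>. \<eta> \<in> kcarrier H \<Longrightarrow> \<xi> \<in> kcarrier H \<Longrightarrow> kform H (Kp x y \<eta>) \<xi> = A.pform 1 (V y \<eta>) (V x \<xi>)"
    "\<And>f g. f \<in> F \<Longrightarrow> g \<in> F \<Longrightarrow> kernel_form H Kp f g = A.pform 1 (A.vsum f) (A.vsum g)"
    using A.kernel_of_form[OF A.pform_hform A.pform_bound, of 1] by auto
  obtain Km where Km: "hermitian_kernel H Km"
    "\<And>x y \<eta> \<xi>. \<eta> \<in> kcarrier H \<Longrightarrow> \<xi> \<in> kcarrier H \<Longrightarrow> kform H (Km x y \<eta>) \<xi> = A.pform (- 1) (V y \<eta>) (V x \<xi>)"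
    "\<And>f g. f \<in> F \<Longrightarrow> g \<in> F \<Longrightarrow> kernel_form H Km f g = A.pform (- 1) (A.vsum f) (A.vsum g)"
    using A.kernel_of_form[OF A.pform_hform A.pform_bound, of "- 1"] by auto
  \<comment> \<open>The pullback of the Hilbert product, which will be the sum of the two parts; for
    it boundedness of the shifts is boundedness of the operators \<open>U a\<close>.\<close>
  obtain L where L: "hermitian_kernel H L"
    "\<And>x y \<eta> \<xi>. \<eta> \<in> kcarrier H \<Longrightarrow> \<xi> \<in> kcarrier H \<Longrightarrow> kform H (L x y \<eta>) \<xi> = kg \<K> (V y \<eta>) (V x \<xi>)"
    "\<And>f g. f \<in> F \<Longrightarrow> g \<in> F \<Longrightarrow> kernel_form H L f g = kg \<K> (A.vsum f) (A.vsum g)"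
    using A.kernel_of_form[OF W.g_hform W.g_bound] by blast
  note Kp_D = bounded_ops_D[OF hermitian_bounded[OF Kp(1)]] and Km_D = bounded_ops_D[OF hermitian_bounded[OF Km(1)]]
    and L_D = bounded_ops_D[OF hermitian_bounded[OF L(1)]] and K_D = bounded_ops_D[OF Kb]
  have diff: "K = Kp - Km"
    by (rule kernel_eqI)
      (auto simp: K_D Kp_D Km_D kform_simps(6) Kp(2) Km(2) K_form A.pform_def W.kform_g A.V_D field_simps)
  have sum: "Kp + Km = L"
    by (rule kernel_eqI)
      (auto simp: L_D Kp_D Km_D kform_simps(1) Kp(2) Km(2) L(2) A.pform_def field_simps)
  have pd: "positive_definite_kernel H Kp" "positive_definite_kernel H Km" "positive_definite_kernel H L"
    using Kp(1,3) Km(1,3) L(1,3) A.pform_nonneg[of 1] A.pform_nonneg[of "- 1"] W.q_nonneg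
    by (auto simp: positive_definite_kernel_def)
  \<comment> \<open>The factor \<open>\<alpha> a x\<close> in the relation for \<open>V\<close>
    cancels against the inverse in the shift map.\<close>
  have vsum_shift: "A.vsum (\<psi> a f) = U a (A.vsum f)" if "f \<in> F" for a f
    using that
  proof (induction rule: F_induct)
    case zero
    have "U a 0 = 0" using bounded_ops_D(2)[OF U W.zeroE W.zeroE, of a] by simp
    then show ?case by (simp only: shift_map_0) (simp add: fext_def)
  next
    case (delta x \<xi>)
    have "U a (kscale \<K> c (V x \<xi>)) = kscale \<K> c (U a (V x \<xi>))" for c
      using bounded_ops_D(3)[OF U A.V_D(1)[OF delta]] .
    then show ?case
      using delta nz[of a x] by (simp add: shift_map_delta' A.vsum_delta A.V_D UV)
  next
    case (add f g)
    then show ?case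
      using bounded_ops_D(2)[OF U A.vsum_closed A.vsum_closed, of f g a]
      by (simp only: shift_map_add shift_map_F A.vsum_add)
  qed
  have "L \<in> bounded_kernels H \<phi> \<alpha>"
    unfolding bounded_kernels_def
  proof (intro CollectI conjI allI pd(3))
    fix a
    obtain C where C: "\<And>u. u \<in> kcarrier \<K> \<Longrightarrow> sqrt (Re (kg \<K> (U a u) (U a u))) \<le> C * sqrt (Re (kg \<K> u u))"
      using bounded_ops_bound[OF \<K> U] by blast
    show "\<exists>C. \<forall>f\<in>F. sqrt (Re (kernel_form H L (\<psi> a f) (\<psi> a f))) \<le> C * sqrt (Re (kernel_form H L f f))"
      by (rule exI[of _ C]) (auto simp: L(3) shift_map_F vsum_shift C)
  qed
  moreover have "disjoint_kernels H Kp Km"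
    unfolding disjoint_kernels_def
  proof (intro allI impI)
    fix P :: "('x, 'h) kernel"
    assume P: "positive_definite_kernel H P \<and> kernel_le H P Kp \<and> kernel_le H P Km"
    then have P_herm: "hermitian_kernel H P" by (simp add: positive_definite_kernel_def)
    let ?p = "\<lambda>f. Re (kernel_form H P f f)"
    interpret p: qform fsc F ?p
      using P by (intro F.hform_qform[OF kernel_form_hform[OF P_herm]]) (simp add: positive_definite_kernel_def)
    \<comment> \<open>Approximants taken from the span thus come from functions \<open>h\<close> at
      which the form of \<open>P\<close> can be evaluated.\<close>
    have span: "module.span (kscale \<K>) (\<Union>x. V x ` kcarrier H) \<subseteq> A.vsum ` F"
    proof (rule W.span_minimal)
      show "(\<Union>x. V x ` kcarrier H) \<subseteq> A.vsum ` F"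
        by (auto intro: image_eqI[of _ _ "delta_fun _ _"] simp: A.vsum_delta)
      have "A.vsum f + A.vsum g \<in> A.vsum ` F" if "f \<in> F" "g \<in> F" for f g
        using A.vsum_add[OF that] F.addE[OF that] by (metis imageI)
      moreover have "kscale \<K> c (A.vsum f) \<in> A.vsum ` F" if "f \<in> F" for f c
        using A.vsum_scale[OF that] F.scE[OF that] by (metis imageI)
      moreover have "0 \<in> A.vsum ` F" using F.zeroE A.vsum_0 by (metis imageI)
      ultimately show "W.subspace (A.vsum ` F)"
        unfolding W.subspace_def by blast
    qed
    have "?p f = 0" if f: "f \<in> F" for f
    proof (rule ccontr)
      assume "?p f \<noteq> 0"
      then have e: "?p f > 0" using p.q_nonneg[OF f] by simp
      let ?v = "A.vsum f" let ?u = "kscale \<K> (1/2) (?v + kJ \<K> ?v)"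
      have u: "?u \<in> kcarrier \<K>" using f by auto
      \<comment> \<open>The threshold makes twice the squared distance smaller than
        \<open>?p f\<close>.\<close>
      obtain w where "w \<in> A.vsum ` F" and w: "krein_norm \<K> (?u - w) < sqrt (?p f / 2)"
      proof -
        have "?u \<in> krein_topology \<K> closure_of (module.span (kscale \<K>) (\<Union>x. V x ` kcarrier H))"
          using u dense by simp
        moreover have "sqrt (?p f / 2) > 0" using e by simp
        ultimately have "\<exists>w\<in>module.span (kscale \<K>) (\<Union>x. V x ` kcarrier H). krein_norm \<K> (?u - w) < sqrt (?p f / 2)"
          unfolding krein_topology_closure[OF \<K>] by blast
        then show ?thesis using that span by blast
      qed
      then obtain h where h: "h \<in> F" and wh: "w = A.vsum h" by auto
      have "?p f \<le> 2 * ?p (f - h) + 2 * ?p h" using p.q_add_le[of "f - h" h] f h by simp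
      also have "\<dots> \<le> 2 * Re (kernel_form H Kp (f - h) (f - h)) + 2 * Re (kernel_form H Km h h)"
        using P f h by (intro add_mono mult_left_mono) (auto simp: kernel_le_def)
      also have "\<dots> = 2 * Re (A.pform 1 (?v - w) (?v - w) + A.pform (- 1) w w)"
        using f h by (simp add: Kp(3) Km(3) A.vsum_diff wh)
      also have "\<dots> = 2 * Re (kg \<K> (?u - w) (?u - w))"
        using f h by (subst A.pform_split) (auto simp: wh)
      also have "\<dots> < 2 * (?p f / 2)"
        using w unfolding krein_norm_eq by (simp only: real_sqrt_less_iff mult_less_cancel_left_pos zero_less_numeral)
      finally show False by simp
    qed
    then show "P = 0" by (rule kernel_form_diag_eq_0[OF P_herm])
  qed
  ultimately show ?thesis using pd diff sum by blast
qed

end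

section \<open>Equivalence of the four assertions\<close>

theorem theorem3p1:
  fixes \<phi> :: "'s::monoid_mult \<Rightarrow> 'x \<Rightarrow> 'x"
    and \<I> :: "'s \<Rightarrow> 's"
    and \<alpha> :: "'s \<Rightarrow> 'x \<Rightarrow> complex"
    and H :: "('h::ab_group_add) kspace"
    and K :: "('x, 'h) kernel"
  assumes "semigroup_involution \<I>"
    and "semigroup_action \<phi>"
    and "\<And>a x. \<alpha> a x \<noteq> 0"
    and "\<And>a b x y. \<alpha> (a * b) x * cnj (\<alpha> (a * b) y) =
      \<alpha> a (\<phi> b x) * cnj (\<alpha> a (\<phi> b y)) * (\<alpha> b x * cnj (\<alpha> b y))"
    and "\<And>a x. \<alpha> (a * \<I> a) x = 1"
    and "krein_space H"
    and "hermitian_kernel H K"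
    and "invariant_kernel H \<phi> \<alpha> \<I> K"
  defines "assertion1 \<equiv> \<exists>L \<in> bounded_kernels H \<phi> \<alpha>. kernel_le H (- L) K \<and> kernel_le H K L"
    and "assertion2 \<equiv> \<exists>(\<K> :: ('x \<Rightarrow> 'h \<Rightarrow> complex) kspace) V.
      invariant_kolmogorov_decomposition H \<phi> \<alpha> \<I> K V \<K>"
    and "assertion2_any \<equiv> \<exists>(\<K> :: ('k::ab_group_add) kspace) V.
      invariant_kolmogorov_decomposition H \<phi> \<alpha> \<I> K V \<K>"
    and "assertion3 \<equiv> \<exists>K1 K2. positive_definite_kernel H K1 \<and> positive_definite_kernel H K2 \<and>
      K = K1 - K2 \<and> K1 + K2 \<in> bounded_kernels H \<phi> \<alpha>"
    and "assertion4 \<equiv> \<exists>Kp Km. positive_definite_kernel H Kp \<and> positive_definite_kernel H Km \<and>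
      disjoint_kernels H Kp Km \<and> K = Kp - Km \<and> Kp + Km \<in> bounded_kernels H \<phi> \<alpha>"
  shows "(assertion1 \<longleftrightarrow> assertion2) \<and> (assertion1 \<longleftrightarrow> assertion3) \<and> (assertion1 \<longleftrightarrow> assertion4) \<and>
    (assertion2_any \<longrightarrow> assertion2)"
proof -
  interpret invariant_setting H \<phi> \<I> \<alpha> K
    by (intro invariant_setting.intro krein.intro invariant_setting_axioms.intro assms)
  have "assertion2" if "assertion1"
    using that dominated_imp_decomposition unfolding assertion1_def assertion2_def by blast
  moreover have "assertion4" if "assertion2"
    using that decomposition_imp_disjoint unfolding assertion2_def assertion4_def by blast
  \<comment> \<open>This implication holds over any ambient type, so a decomposition elsewhere leads
    through disjoint kernels and a dominating kernel back to one in the function type.\<close>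
  moreover have "assertion4" if "assertion2_any"
    using that decomposition_imp_disjoint unfolding assertion2_any_def assertion4_def by blast
  moreover have "assertion3" if "assertion4"
    using that unfolding assertion3_def assertion4_def by blast
  moreover have "assertion1" if 3: "assertion3"
  proof -
    obtain K1 K2 where K12: "positive_definite_kernel H K1" "positive_definite_kernel H K2"
      "K = K1 - K2" "K1 + K2 \<in> bounded_kernels H \<phi> \<alpha>"
      using 3 unfolding assertion3_def by blast
    have herm: "hermitian_kernel H K1" "hermitian_kernel H K2" "hermitian_kernel H (K1 + K2)"
      and pos: "\<And>f. f \<in> F \<Longrightarrow> 0 \<le> Re (kernel_form H K1 f f)" "\<And>f. f \<in> F \<Longrightarrow> 0 \<le> Re (kernel_form H K2 f f)"
      using K12 by (auto simp: positive_definite_kernel_def bounded_kernels_def)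
    note b = hermitian_bounded[OF herm(1)] hermitian_bounded[OF herm(2)] hermitian_bounded[OF herm(3)]
    \<comment> \<open>The two inequalities amount to nonnegativity of twice \<open>K1\<close> and of
      twice \<open>K2\<close>.\<close>
    have "kernel_le H (- (K1 + K2)) K" "kernel_le H K (K1 + K2)"
      unfolding kernel_le_def K12(3)
      using pos kernel_form_lincomb(1,2)[where A = K1 and B = K2, OF b(1,2)]
        kernel_form_lincomb(3)[where A = "K1 + K2" and B = K2, OF b(3,2)] by fastforce+
    then show ?thesis unfolding assertion1_def using K12(4) by blast
  qed
  ultimately show ?thesis by blast
qed

end
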